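(* Let $\nu\ge0$. (i) For each interval $A=[a_1,a_2]\subset\mathbb{R}^+$ with $a=a_2-a_1>0$ and all $\lambda,T>0$, there are a sequence $\{u_k\}_{k\in\mathbb{N}^+}\subset C_0^\infty(\mathbb{R}^+)$ and a constant $M>0$ such that for all $k$ $$\int_{\mathbb{R}^+}e^{\lambda x}|u_k(x)|^2dx\le M\quad\text{and}\quad\int_{\mathbb{R}^+}|u_k(x)|^2dx=1,$$ and $$\lim_{k\to\infty}\int_A|u(x,T;u_k)|^2dx=0.$$ (ii) Let $\lambda,b,T>0$ and let $\alpha:\mathbb{R}^+\to\mathbb{R}$ be an increasing function with $\lim_{s\to\infty}\alpha(s)/s=0$. Then for each $\gamma\in(0,1)$ there is no positive constant $C$ such that for all $u_0\in C_0^\infty(\mathbb{R}^+)$, $$\int_{\mathbb{R}^+}|u_0(x)|^2dx\le C\left(\int_{[0,b]^c}|u(x,T;u_0)|^2dx\right)^\gamma\left(\int_{\mathbb{R}^+}e^{\lambda\alpha(x)}|u_0(x)|^2dx\right)^{1-\gamma}.$$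
   Context: $\mathbb{R}^+=(0,\infty)$, $L^2(\mathbb{R}^+)=L^2(\mathbb{R}^+;\mathbb{C})$, $C_0^\infty(\mathbb{R}^+)$ denotes complex-valued smooth functions with compact support in $(0,\infty)$, and $E^c=\mathbb{R}^+\setminus E$. For $\nu\ge0$, $H_\nu$ is the Friedrichs extension in $L^2(\mathbb{R}^+)$ of the operator $-\partial_x^2+(\nu^2-\frac14)\frac1{x^2}$ with domain $C_0^\infty(\mathbb{R}^+)$. For $u_0\in L^2(\mathbb{R}^+)$, $u(x,t;u_0)=(e^{-itH_\nu}u_0)(x)$ denotes the solution of $i\partial_tu=H_\nu u$, $u(\cdot,0)=u_0$. *)

theory Defs
  imports "HOL-Analysis.Analysis"
begin

abbreviation half_line :: "real measure" where
  "half_line \<equiv> restrict_space lborel {0<..}"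

text \<open>
  \<open>L\<^sup>2(\<real>\<^sup>+;\<complex>)\<close> is represented by functions instead of classes modulo null sets. Values
  outside \<open>(0,\<infinity>)\<close> are irrelevant, and everything below respects equality almost everywhere
  on \<open>half_line\<close>.
\<close>

definition L2 :: "(real \<Rightarrow> complex) set" where
  "L2 = {f \<in> borel_measurable half_line. integrable half_line (\<lambda>x. (cmod (f x))\<^sup>2)}"

definition l2_inner :: "(real \<Rightarrow> complex) \<Rightarrow> (real \<Rightarrow> complex) \<Rightarrow> complex" where
  "l2_inner f g = (LINT x|half_line. f x * cnj (g x))"

definition l2_norm :: "(real \<Rightarrow> complex) \<Rightarrow> real" where
  "l2_norm f = sqrt (LINT x|half_line. (cmod (f x))\<^sup>2)"

definition vderiv :: "(real \<Rightarrow> complex) \<Rightarrow> real \<Rightarrow> complex" where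
  "vderiv f = (\<lambda>x. vector_derivative f (at x))"

text \<open>
  Elements of \<open>C\<^sub>0\<^sup>\<infinity>(\<real>\<^sup>+)\<close> are identified with their extensions by zero to the real line.
\<close>

definition test_functions :: "(real \<Rightarrow> complex) set" where
  "test_functions = {f. (\<forall>n x. (vderiv ^^ n) f differentiable (at x)) \<and>
     (\<exists>K. compact K \<and> K \<subseteq> {0<..} \<and> (\<forall>x. x \<notin> K \<longrightarrow> f x = 0))}"

text \<open>
  An unbounded operator in \<open>L\<^sup>2(\<real>\<^sup>+)\<close> is given by its graph, a set of pairs \<open>(f, Hf)\<close>.
\<close>

type_synonym l2_operator = "((real \<Rightarrow> complex) \<times> (real \<Rightarrow> complex)) set"

definition bessel_minimal :: "real \<Rightarrow> l2_operator" where
  "bessel_minimal \<nu> =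
     {(\<phi>, \<lambda>x. - vderiv (vderiv \<phi>) x + of_real ((\<nu>\<^sup>2 - 1/4) * (1 / x\<^sup>2)) * \<phi> x) | \<phi>.
        \<phi> \<in> test_functions}"

text \<open>
  Domain of the closure of the quadratic form \<open>q[\<phi>] = \<langle>S\<phi>, \<phi>\<rangle>\<close> of a symmetric operator \<open>S\<close> that is
  bounded below: the \<open>L\<^sup>2\<close> limits of sequences in the domain of \<open>S\<close> that are Cauchy with respect
  to \<open>q\<close>.
\<close>

definition form_domain :: "l2_operator \<Rightarrow> (real \<Rightarrow> complex) set" where
  "form_domain S = {f \<in> L2. \<exists>\<phi> \<psi>. (\<forall>n::nat. (\<phi> n, \<psi> n) \<in> S) \<and>
     (\<lambda>n. l2_norm (\<lambda>x. \<phi> n x - f x)) \<longlonglongrightarrow> 0 \<and>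
     (\<forall>\<epsilon>>0. \<exists>N. \<forall>m\<ge>N. \<forall>n\<ge>N.
        cmod (l2_inner (\<lambda>x. \<psi> m x - \<psi> n x) (\<lambda>x. \<phi> m x - \<phi> n x)) < \<epsilon>)}"

definition l2_adjoint :: "l2_operator \<Rightarrow> l2_operator" where
  "l2_adjoint S = {(f, g). f \<in> L2 \<and> g \<in> L2 \<and>
     (\<forall>(\<phi>, \<psi>) \<in> S. l2_inner \<psi> f = l2_inner \<phi> g)}"

text \<open>
  The Friedrichs extension of \<open>S\<close> is the restriction of the adjoint of \<open>S\<close> to the form domain.
\<close>

definition friedrichs_extension :: "l2_operator \<Rightarrow> l2_operator" where
  "friedrichs_extension S = {(f, g) \<in> l2_adjoint S. f \<in> form_domain S}"

definition H_bessel :: "real \<Rightarrow> l2_operator" where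
  "H_bessel \<nu> = friedrichs_extension (bessel_minimal \<nu>)"

definition unitary_group :: "(real \<Rightarrow> (real \<Rightarrow> complex) \<Rightarrow> (real \<Rightarrow> complex)) \<Rightarrow> bool" where
  "unitary_group U \<longleftrightarrow>
     (\<forall>t. \<forall>f\<in>L2. U t f \<in> L2 \<and> l2_norm (U t f) = l2_norm f) \<and>
     (\<forall>t c. \<forall>f\<in>L2. \<forall>g\<in>L2.
        AE x in half_line. U t (\<lambda>y. f y + c * g y) x = U t f x + c * U t g x) \<and>
     (\<forall>f\<in>L2. AE x in half_line. U 0 f x = f x) \<and>
     (\<forall>s t. \<forall>f\<in>L2. AE x in half_line. U (s + t) f x = U s (U t f) x) \<and>
     (\<forall>f\<in>L2. ((\<lambda>t. l2_norm (\<lambda>x. U t f x - f x)) \<longlongrightarrow> 0) (at 0))"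

definition group_generator :: "(real \<Rightarrow> (real \<Rightarrow> complex) \<Rightarrow> (real \<Rightarrow> complex)) \<Rightarrow> l2_operator" where
  "group_generator U = {(f, g). f \<in> L2 \<and> g \<in> L2 \<and>
     ((\<lambda>t. l2_norm (\<lambda>x. (U t f x - f x) / of_real t - g x)) \<longlongrightarrow> 0) (at 0)}"

text \<open>
  \<open>schrodinger_group H t\<close> is \<open>e\<^sup>-\<^sup>i\<^sup>t\<^sup>H\<close>: by Stone's theorem a self-adjoint \<open>H\<close> determines a strongly
  continuous unitary group with infinitesimal generator \<open>-iH\<close>. It is unique only up to the choice
  of representatives modulo null sets, hence the choice operator.
\<close>

definition schrodinger_group :: "l2_operator \<Rightarrow> real \<Rightarrow> (real \<Rightarrow> complex) \<Rightarrow> (real \<Rightarrow> complex)" where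
  "schrodinger_group H = (SOME U. unitary_group U \<and>
     group_generator U = {(f, \<lambda>x. - \<i> * g x) | f g. (f, g) \<in> H})"

definition bessel_solution :: "real \<Rightarrow> (real \<Rightarrow> complex) \<Rightarrow> real \<Rightarrow> real \<Rightarrow> complex" where
  "bessel_solution \<nu> u0 x t = schrodinger_group (H_bessel \<nu>) t u0 x"

end

theory Submission
  imports Defs
begin

text \<open>
  Write \<open>e\<^sub>p(x) = p powr (- \<nu> - 1) * x powr (\<nu> + 1/2) * exp (- x\<^sup>2 / p)\<close> for \<open>Re p > 0\<close>. These functions lie in
  the domain of \<open>H\<^sub>\<nu>\<close> and \<open>exp (- \<i> t H\<^sub>\<nu>) e\<^sub>p = e\<^sub>q\<close> with \<open>q = p + 4 \<i> t\<close>. Their span is dense and invariant, hence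
  it is a core, and the evolution on the span extends to the unitary group generated by \<open>- \<i> H\<^sub>\<nu>\<close>; this avoids
  Stone's theorem and Bessel functions. For (i) take \<open>1 / p = 1 + \<i> k\<close> with \<open>k \<rightarrow> \<infinity>\<close>: the modulus of the
  normalized datum does not depend on \<open>k\<close>, while \<open>\<bar>p\<bar> / \<bar>p + 4 \<i> T\<bar> \<rightarrow> 0\<close>. For (ii) take the datum \<open>e\<^sub>q\<close> with
  \<open>q = p - 4 \<i> T\<close> and \<open>p \<rightarrow> 0\<close> real, which focuses to \<open>e\<^sub>p\<close> at time \<open>T\<close>. In both cases multiplication by smooth
  cutoffs yields test functions.
\<close>

section \<open>The Hilbert space of square integrable functions modulo null sets\<close>

text \<open>\<open>schrodinger_group\<close> is a choice, so it says nothing until some unitary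
  group is shown to have generator exactly -i H, domains included. For the Gaussian evolution this
  is two inclusions. A pair in its generator is a graph limit of Gaussian sums, and the form of a
  difference of such sums is at most the norm of the difference times the norm of its image; so the
  sums converge in form norm as well, and the limit is in the form domain. Conversely, a function in
  the form domain that satisfies the adjoint relation against test functions satisfies it against
  Gaussian sums, which lie in the form domain too, and such a weak derivative is a strong one. The
  group picked by the choice is tied to the explicit Gaussians by uniqueness of solutions. All
  statements about the form go through a factorization H = A^* A, which treats \<nu> < 1/2, where
  the potential is negative, like the other values. At \<nu> = 0 the Gaussians are of exact order
  sqrt x at 0, the borderline for approximation by test functions.\<close>

lemma borel_measurable_cnj [measurable (raw)]:
  "f \<in> borel_measurable M \<Longrightarrow> (\<lambda>x. cnj (f x)) \<in> borel_measurable M"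
  by (rule borel_measurable_continuous_on) (auto intro: continuous_intros)

lemma L2_I [intro]:
  "f \<in> borel_measurable half_line \<Longrightarrow> integrable half_line (\<lambda>x. (cmod (f x))\<^sup>2) \<Longrightarrow> f \<in> L2"
  by (simp add: L2_def)

lemma L2_measurable [measurable_dest]: "f \<in> L2 \<Longrightarrow> f \<in> borel_measurable half_line"
  and L2_integrable: "f \<in> L2 \<Longrightarrow> integrable half_line (\<lambda>x. (cmod (f x))\<^sup>2)"
  by (auto simp: L2_def)

lemma L2_dominated:
  assumes "f \<in> borel_measurable half_line" "integrable half_line w"
    and "\<And>x. x > 0 \<Longrightarrow> (cmod (f x))\<^sup>2 \<le> w x"
  shows "f \<in> L2"
proof
  show "integrable half_line (\<lambda>x. (cmod (f x))\<^sup>2)"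
  proof (rule Bochner_Integration.integrable_bound[OF assms(2)])
    show "(\<lambda>x. (cmod (f x))\<^sup>2) \<in> borel_measurable half_line"
      using assms(1) by measurable
    show "AE x in half_line. norm ((cmod (f x))\<^sup>2) \<le> norm (w x)"
      using assms(3) by (intro AE_I2) (fastforce simp: space_restrict_space)
  qed
qed fact

lemma L2_zero [simp]: "(\<lambda>_. 0) \<in> L2"
  by auto

lemma cmod_add_square_le: "(cmod (a + b))\<^sup>2 \<le> 2 * (cmod a)\<^sup>2 + 2 * (cmod b)\<^sup>2"
proof -
  have "(cmod (a + b))\<^sup>2 \<le> (cmod a + cmod b)\<^sup>2"
    by (intro power_mono norm_triangle_ineq) auto
  also have "\<dots> \<le> 2 * (cmod a)\<^sup>2 + 2 * (cmod b)\<^sup>2"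
    using sum_squares_bound[of "cmod a" "cmod b"] by (simp add: power2_sum)
  finally show ?thesis .
qed

lemma L2_add [intro]:
  assumes "f \<in> L2" "g \<in> L2"
  shows "(\<lambda>x. f x + g x) \<in> L2"
proof (rule L2_dominated)
  show "integrable half_line (\<lambda>x. 2 * (cmod (f x))\<^sup>2 + 2 * (cmod (g x))\<^sup>2)"
    using assms by (auto simp: L2_integrable)
  show "(cmod (f x + g x))\<^sup>2 \<le> 2 * (cmod (f x))\<^sup>2 + 2 * (cmod (g x))\<^sup>2" for x
    by (rule cmod_add_square_le)
qed (use assms[THEN L2_measurable] in measurable)

lemma L2_cmult [intro]:
  assumes "f \<in> L2"
  shows "(\<lambda>x. c * f x) \<in> L2"
  using assms by (auto simp: L2_def norm_mult power_mult_distrib)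

lemma L2_uminus [intro]: "f \<in> L2 \<Longrightarrow> (\<lambda>x. - f x) \<in> L2"
  using L2_cmult[of f "-1"] by simp

lemma L2_diff [intro]: "f \<in> L2 \<Longrightarrow> g \<in> L2 \<Longrightarrow> (\<lambda>x. f x - g x) \<in> L2"
  using L2_add[of f "\<lambda>x. - g x"] by auto

lemma L2_scaleR [intro]: "f \<in> L2 \<Longrightarrow> (\<lambda>x. r *\<^sub>R f x) \<in> L2"
  using L2_cmult[of f "of_real r"] by (simp add: scaleR_conv_of_real)

lemma L2_AE_cong:
  assumes "f \<in> L2" "g \<in> borel_measurable half_line" "AE x in half_line. f x = g x"
  shows "g \<in> L2"
proof
  show "integrable half_line (\<lambda>x. (cmod (g x))\<^sup>2)"
    using L2_integrable[OF assms(1)]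
  proof (rule integrable_cong_AE_imp)
    show "(\<lambda>x. (cmod (g x))\<^sup>2) \<in> borel_measurable half_line"
      using assms(2) by measurable
    show "AE x in half_line. (cmod (f x))\<^sup>2 = (cmod (g x))\<^sup>2"
      using assms(3) by eventually_elim auto
  qed
qed fact

lemma L2_integrable_mult_cnj:
  assumes "f \<in> L2" "g \<in> L2"
  shows "integrable half_line (\<lambda>x. f x * cnj (g x))"
proof (rule Bochner_Integration.integrable_bound)
  show "integrable half_line (\<lambda>x. (cmod (f x))\<^sup>2 + (cmod (g x))\<^sup>2)"
    using assms by (auto simp: L2_integrable)
  show "(\<lambda>x. f x * cnj (g x)) \<in> borel_measurable half_line"
    using assms[THEN L2_measurable] by measurable
  have "cmod (f x * cnj (g x)) \<le> (cmod (f x))\<^sup>2 + (cmod (g x))\<^sup>2" for x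
    using sum_squares_bound[of "cmod (f x)" "cmod (g x)"]
      zero_le_power2[of "cmod (f x)"] zero_le_power2[of "cmod (g x)"]
      mult_nonneg_nonneg[OF norm_ge_zero[of "f x"] norm_ge_zero[of "g x"]]
    unfolding norm_mult complex_mod_cnj by linarith
  then show "AE x in half_line. norm (f x * cnj (g x)) \<le> norm ((cmod (f x))\<^sup>2 + (cmod (g x))\<^sup>2)"
    by (intro AE_I2) simp
qed

section \<open>Square integrable functions as a type of classes\<close>

definition l2_rel :: "(real \<Rightarrow> complex) \<Rightarrow> (real \<Rightarrow> complex) \<Rightarrow> bool" where
  "l2_rel f g \<longleftrightarrow> f \<in> L2 \<and> g \<in> L2 \<and> (AE x in half_line. f x = g x)"

lemma part_equivp_l2_rel: "part_equivp l2_rel"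
proof (rule part_equivpI)
  show "\<exists>x. l2_rel x x"
    by (rule exI[of _ "\<lambda>_. 0"]) (auto simp: l2_rel_def)
  show "symp l2_rel"
    by (auto simp: l2_rel_def symp_def elim: AE_mp)
  show "transp l2_rel"
    unfolding l2_rel_def transp_def by (auto elim: AE_mp)
qed

\<comment> \<open>The relation is reflexive only on \<open>L2\<close>, so the partial quotient
  consists of the classes of square integrable functions. As a type it can carry norms, limits and
  derivatives, with equality almost everywhere turned into equality.\<close>
quotient_type l2 = "real \<Rightarrow> complex" / partial: l2_rel
  by (rule part_equivp_l2_rel)

lemma abs_l2_eq_iff:
  assumes "f \<in> L2" "g \<in> L2"
  shows "abs_l2 f = abs_l2 g \<longleftrightarrow> (AE x in half_line. f x = g x)"
  using assms Quotient_rel[OF Quotient_l2] by (auto simp: l2_rel_def)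

lemma rep_l2_L2 [simp, intro]: "rep_l2 u \<in> L2"
  using Quotient_rep_reflp[OF Quotient_l2, of u] by (simp add: l2_rel_def)

lemma abs_rep_l2 [simp]: "abs_l2 (rep_l2 u) = u"
  by (rule Quotient_abs_rep[OF Quotient_l2])

lemma rep_abs_l2: "f \<in> L2 \<Longrightarrow> AE x in half_line. rep_l2 (abs_l2 f) x = f x"
  using abs_l2_eq_iff[of "rep_l2 (abs_l2 f)" f] by simp

lemma abs_l2_cases: obtains f where "f \<in> L2" "u = abs_l2 f"
  by (rule that[of "rep_l2 u"]) auto

text \<open>The type classes of analysis provide real scalars and a real inner product. Complex
  scalars and the complex pairing are therefore operations of their own, and the inner product of
  the instance will be the real part of \<open>cinner\<close>.\<close>

lift_definition cscale :: "complex \<Rightarrow> l2 \<Rightarrow> l2" is "\<lambda>c f x. c * f x"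
  by (auto simp: l2_rel_def elim: AE_mp)

lift_definition cinner :: "l2 \<Rightarrow> l2 \<Rightarrow> complex" is l2_inner
  unfolding l2_rel_def l2_inner_def
proof (intro integral_cong_AE, goal_cases)
  case (1 f1 f2 g1 g2)
  then have "f1 \<in> L2" "g1 \<in> L2" by auto
  then show ?case by measurable
next
  case (2 f1 f2 g1 g2)
  then have "f2 \<in> L2" "g2 \<in> L2" by auto
  then show ?case by measurable
next
  case (3 f1 f2 g1 g2)
  then have "AE x in half_line. f1 x = f2 x" "AE x in half_line. g1 x = g2 x" by auto
  then show ?case by eventually_elim auto
qed

instantiation l2 :: real_vector
begin
lift_definition zero_l2 :: l2 is "\<lambda>_. 0" by (auto simp: l2_rel_def)
lift_definition plus_l2 :: "l2 \<Rightarrow> l2 \<Rightarrow> l2" is "\<lambda>f g x. f x + g x"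
  by (auto simp: l2_rel_def elim: AE_mp)
lift_definition uminus_l2 :: "l2 \<Rightarrow> l2" is "\<lambda>f x. - f x"
  by (auto simp: l2_rel_def elim: AE_mp)
lift_definition minus_l2 :: "l2 \<Rightarrow> l2 \<Rightarrow> l2" is "\<lambda>f g x. f x - g x"
  by (auto simp: l2_rel_def elim: AE_mp)
lift_definition scaleR_l2 :: "real \<Rightarrow> l2 \<Rightarrow> l2" is "\<lambda>r f x. r *\<^sub>R f x"
  by (auto simp: l2_rel_def elim: AE_mp)
instance
  by standard (transfer; auto simp: l2_rel_def algebra_simps intro!: L2_add L2_diff L2_uminus L2_scaleR)+
end

lemma cnj_l2_inner: "cnj (l2_inner f g) = l2_inner g f"
  unfolding l2_inner_def Bochner_Integration.integral_cnj[symmetric] by (simp add: mult.commute)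

lemma cinner_cnj: "cnj (cinner u v) = cinner v u"
  by transfer (rule cnj_l2_inner)

lemma cinner_add_left: "cinner (u + v) w = cinner u w + cinner v w"
  by transfer (auto simp: l2_inner_def l2_rel_def distrib_right L2_integrable_mult_cnj)

lemma cinner_cscale_left: "cinner (cscale c u) w = c * cinner u w"
  by transfer (auto simp: l2_inner_def l2_rel_def mult.assoc)

lemma cinner_add_right: "cinner w (u + v) = cinner w u + cinner w v"
  by (metis cinner_add_left cinner_cnj complex_cnj_add)

lemma cinner_cscale_right: "cinner w (cscale c u) = cnj c * cinner w u"
  by (metis cinner_cscale_left cinner_cnj complex_cnj_mult)

lemma cscale_of_real: "cscale (of_real r) u = r *\<^sub>R u"
  by transfer (auto simp: l2_rel_def scaleR_conv_of_real)

lemma l2_inner_self: "l2_inner f f = of_real (LINT x|half_line. (cmod (f x))\<^sup>2)"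
  unfolding l2_inner_def by (simp add: complex_norm_square[symmetric] flip: integral_complex_of_real)

lemma cinner_self_real: "cinner u u = of_real (Re (cinner u u))"
  by transfer (simp add: l2_inner_self)

lemma cinner_self_nonneg: "0 \<le> Re (cinner u u)"
  by transfer (simp add: l2_inner_self)

lemma cinner_self_eq_0: "Re (cinner u u) = 0 \<longleftrightarrow> u = 0"
proof transfer
  fix f :: "real \<Rightarrow> complex" assume "l2_rel f f"
  then have f: "f \<in> L2" by (simp add: l2_rel_def)
  have "Re (l2_inner f f) = 0 \<longleftrightarrow> (AE x in half_line. (cmod (f x))\<^sup>2 = 0)"
    unfolding l2_inner_self Re_complex_of_real
    by (rule integral_nonneg_eq_0_iff_AE) (auto simp: L2_integrable f)
  also have "\<dots> \<longleftrightarrow> l2_rel f (\<lambda>_. 0)"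
    using f by (auto simp: l2_rel_def)
  finally show "Re (l2_inner f f) = 0 \<longleftrightarrow> l2_rel f (\<lambda>_. 0)" .
qed

instantiation l2 :: real_inner
begin
definition inner_l2 :: "l2 \<Rightarrow> l2 \<Rightarrow> real" where "inner_l2 u v = Re (cinner u v)"
definition norm_l2 :: "l2 \<Rightarrow> real" where "norm_l2 u = sqrt (inner u u)"
definition sgn_l2 :: "l2 \<Rightarrow> l2" where "sgn_l2 u = u /\<^sub>R norm u"
definition dist_l2 :: "l2 \<Rightarrow> l2 \<Rightarrow> real" where "dist_l2 u v = norm (u - v)"
definition uniformity_l2 :: "(l2 \<times> l2) filter" where
  "uniformity_l2 = (INF e\<in>{0<..}. principal {(x, y). dist x y < e})"
definition open_l2 :: "l2 set \<Rightarrow> bool" where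
  "open_l2 U \<longleftrightarrow> (\<forall>x\<in>U. eventually (\<lambda>(x', y). x' = x \<longrightarrow> y \<in> U) uniformity)"
instance
proof
  fix u v w :: l2 and r :: real
  show "inner u v = inner v u"
    unfolding inner_l2_def by (metis cinner_cnj cnj.sel(1))
  show "inner (u + v) w = inner u w + inner v w"
    by (simp add: inner_l2_def cinner_add_left)
  show "inner (r *\<^sub>R u) v = r * inner u v"
    by (simp add: inner_l2_def cinner_cscale_left flip: cscale_of_real)
  show "0 \<le> inner u u" by (simp add: inner_l2_def cinner_self_nonneg)
  show "inner u u = 0 \<longleftrightarrow> u = 0" by (simp add: inner_l2_def cinner_self_eq_0)
qed (fact sgn_l2_def dist_l2_def uniformity_l2_def open_l2_def norm_l2_def)+
end

lemma inner_abs_l2: "f \<in> L2 \<Longrightarrow> g \<in> L2 \<Longrightarrow> inner (abs_l2 f) (abs_l2 g) = Re (l2_inner f g)"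
  by (simp add: inner_l2_def cinner.abs_eq l2_rel_def)

lemma cinner_abs_l2: "f \<in> L2 \<Longrightarrow> g \<in> L2 \<Longrightarrow> cinner (abs_l2 f) (abs_l2 g) = l2_inner f g"
  by (simp add: cinner.abs_eq l2_rel_def)

lemma norm_abs_l2: "f \<in> L2 \<Longrightarrow> norm (abs_l2 f) = l2_norm f"
  by (simp add: norm_eq_sqrt_inner inner_abs_l2 l2_inner_self l2_norm_def)

lemma norm_abs_l2_square: "f \<in> L2 \<Longrightarrow> (norm (abs_l2 f))\<^sup>2 = (LINT x|half_line. (cmod (f x))\<^sup>2)"
  by (simp add: norm_abs_l2 l2_norm_def)

lemma abs_l2_add: "f \<in> L2 \<Longrightarrow> g \<in> L2 \<Longrightarrow> abs_l2 (\<lambda>x. f x + g x) = abs_l2 f + abs_l2 g"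
  and abs_l2_diff: "f \<in> L2 \<Longrightarrow> g \<in> L2 \<Longrightarrow> abs_l2 (\<lambda>x. f x - g x) = abs_l2 f - abs_l2 g"
  and abs_l2_cmult: "f \<in> L2 \<Longrightarrow> abs_l2 (\<lambda>x. c * f x) = cscale c (abs_l2 f)"
  and abs_l2_scaleR: "f \<in> L2 \<Longrightarrow> abs_l2 (\<lambda>x. r *\<^sub>R f x) = r *\<^sub>R abs_l2 f"
  by (simp_all add: plus_l2.abs_eq minus_l2.abs_eq cscale.abs_eq scaleR_l2.abs_eq l2_rel_def)

lemma abs_l2_zero: "abs_l2 (\<lambda>_. 0) = 0"
  by (simp add: zero_l2_def)

lemma abs_l2_eqI:
  assumes "f \<in> L2" "\<And>x. x > 0 \<Longrightarrow> f x = g x" "g \<in> borel_measurable half_line"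
  shows "g \<in> L2" "abs_l2 f = abs_l2 g"
proof -
  have ae: "AE x in half_line. f x = g x"
    using assms(2) by (intro AE_I2) (auto simp: space_restrict_space)
  show g: "g \<in> L2" using L2_AE_cong[OF assms(1,3) ae] .
  show "abs_l2 f = abs_l2 g" using ae assms(1) g by (simp add: abs_l2_eq_iff)
qed

lemma cscale_add_right: "cscale c (u + v) = cscale c u + cscale c v"
  by transfer (auto simp: l2_rel_def algebra_simps intro!: L2_add L2_cmult)

lemma cscale_cscale: "cscale c (cscale d u) = cscale (c * d) u"
  by transfer (auto simp: l2_rel_def algebra_simps)

lemma cscale_scaleR: "cscale c (r *\<^sub>R u) = r *\<^sub>R cscale c u"
  by (simp add: cscale_cscale mult.commute flip: cscale_of_real)

lemma cscale_one [simp]: "cscale 1 u = u"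
  using cscale_of_real[of 1 u] by simp

lemma norm_cscale: "norm (cscale c u) = cmod c * norm u"
proof -
  have "(norm (cscale c u))\<^sup>2 = Re (c * cnj c * cinner u u)"
    by (simp only: power2_norm_eq_inner inner_l2_def cinner_cscale_left cinner_cscale_right ac_simps)
  also have "\<dots> = (cmod c)\<^sup>2 * (norm u)\<^sup>2"
    by (subst cinner_self_real)
      (simp add: power2_norm_eq_inner inner_l2_def cinner_self_nonneg flip: complex_norm_square)
  finally show ?thesis
    by (metis norm_ge_zero mult_nonneg_nonneg power2_eq_imp_eq power_mult_distrib)
qed

lemma bounded_linear_cscale: "bounded_linear (cscale c)"
  by (rule bounded_linear_intro[where K="cmod c"])
    (auto simp: cscale_add_right cscale_scaleR norm_cscale mult.commute)

lemmas cscale_zero [simp] = bounded_linear.linear[OF bounded_linear_cscale, THEN linear_0]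
lemmas tendsto_cscale = bounded_linear.tendsto[OF bounded_linear_cscale]

lemma Im_cinner: "Im (cinner u v) = inner u (cscale \<i> v)"
  by (simp add: inner_l2_def cinner_cscale_right)

text \<open>The pairing is antilinear in its second argument, so rotating that argument by i moves
  the imaginary part into the real part. This reduces continuity of \<open>cinner\<close> to
  continuity of the real inner product.\<close>

lemma cinner_eq_Complex: "cinner u v = Complex (inner u v) (inner u (cscale \<i> v))"
  by (simp add: complex_eq_iff Im_cinner inner_l2_def)

lemma tendsto_cinner:
  assumes "(f \<longlongrightarrow> a) F" "(g \<longlongrightarrow> b) F"
  shows "((\<lambda>x. cinner (f x) (g x)) \<longlongrightarrow> cinner a b) F"
  unfolding cinner_eq_Complex
  by (intro tendsto_Complex tendsto_inner tendsto_cscale assms)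

lemma AE_half_lineI: "(\<And>x. x > 0 \<Longrightarrow> P x) \<Longrightarrow> AE x in half_line. P x"
  by (intro AE_I2) (auto simp: space_restrict_space)

lemma abs_l2_dominated_convergence:
  fixes F :: "nat \<Rightarrow> real \<Rightarrow> complex"
  assumes F: "\<And>n. F n \<in> borel_measurable half_line"
    and f: "f \<in> borel_measurable half_line"
    and w: "integrable half_line w"
    and bound: "\<And>n x. x > 0 \<Longrightarrow> (cmod (F n x))\<^sup>2 \<le> w x"
    and lim: "AE x in half_line. (\<lambda>n. F n x) \<longlonglongrightarrow> f x"
  shows "f \<in> L2" "(\<lambda>n. abs_l2 (F n)) \<longlonglongrightarrow> abs_l2 f"
proof -
  have bound': "AE x in half_line. \<forall>n. (cmod (F n x))\<^sup>2 \<le> w x"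
    using bound by (intro AE_half_lineI) auto
  have fb: "AE x in half_line. (cmod (f x))\<^sup>2 \<le> w x"
    using lim bound'
  proof eventually_elim
    case (elim x)
    show ?case
      by (rule LIMSEQ_le_const2[of "\<lambda>n. (cmod (F n x))\<^sup>2"])
        (use elim in \<open>auto intro!: tendsto_intros\<close>)
  qed
  show fL: "f \<in> L2"
  proof
    show "integrable half_line (\<lambda>x. (cmod (f x))\<^sup>2)"
      using f fb by (intro Bochner_Integration.integrable_bound[OF w]) auto
  qed fact
  have FL: "F n \<in> L2" for n
    by (rule L2_dominated[OF F w bound])
  have "(\<lambda>n. LINT x|half_line. (cmod (F n x - f x))\<^sup>2) \<longlonglongrightarrow> (LINT x|half_line. (0::real))"
  proof (rule integral_dominated_convergence)
    \<comment> \<open>The squared modulus of a difference is at most twice the sum of the squares,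
      each of which is at most \<open>w\<close>.\<close>
    show "integrable half_line (\<lambda>x. 4 * w x)" using w by simp
    show "AE x in half_line. (\<lambda>n. (cmod (F n x - f x))\<^sup>2) \<longlonglongrightarrow> 0"
      using lim
    proof eventually_elim
      case (elim x)
      have "(\<lambda>n. (cmod (F n x - f x))\<^sup>2) \<longlonglongrightarrow> (cmod (f x - f x))\<^sup>2"
        by (intro tendsto_intros elim)
      then show ?case by simp
    qed
    show "AE x in half_line. norm ((cmod (F n x - f x))\<^sup>2) \<le> 4 * w x" for n
      using fb bound'
    proof eventually_elim
      case (elim x)
      then show ?case using cmod_add_square_le[of "F n x" "- f x"] by (auto dest!: spec[of _ n])
    qed
  qed (use F f in measurable)
  then have "(\<lambda>n. (norm (abs_l2 (F n) - abs_l2 f))\<^sup>2) \<longlonglongrightarrow> 0"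
    by (simp add: FL fL norm_abs_l2_square L2_diff flip: abs_l2_diff)
  then have "(\<lambda>n. norm (abs_l2 (F n) - abs_l2 f)) \<longlonglongrightarrow> 0"
    using tendsto_real_sqrt[of "\<lambda>n. (norm (abs_l2 (F n) - abs_l2 f))\<^sup>2" 0] by simp
  then show "(\<lambda>n. abs_l2 (F n)) \<longlonglongrightarrow> abs_l2 f"
    by (simp add: LIM_zero_cancel tendsto_norm_zero_iff)
qed

lemma L2_sum:
  assumes "\<And>i. i \<in> I \<Longrightarrow> f i \<in> L2"
  shows "(\<lambda>x. \<Sum>i\<in>I. f i x) \<in> L2"
  using assms by (induction I rule: infinite_finite_induct) auto

lemma abs_l2_sum:
  assumes "\<And>i. i \<in> I \<Longrightarrow> f i \<in> L2"
  shows "abs_l2 (\<lambda>x. \<Sum>i\<in>I. f i x) = (\<Sum>i\<in>I. abs_l2 (f i))"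
  using assms by (induction I rule: infinite_finite_induct)
    (auto simp: abs_l2_zero abs_l2_add L2_sum)

section \<open>Completeness\<close>

lemma Cauchy_fast_subseq:
  fixes X :: "nat \<Rightarrow> 'a::metric_space"
  assumes "Cauchy X"
  obtains r where "strict_mono r" "\<And>n. dist (X (r (Suc n))) (X (r n)) < (1/2) ^ n"
proof -
  have "\<exists>N. \<forall>m\<ge>N. \<forall>n\<ge>N. dist (X m) (X n) < (1/2) ^ k" for k
    using assms by (simp add: Cauchy_def)
  then obtain N where N: "\<And>k m n. m \<ge> N k \<Longrightarrow> n \<ge> N k \<Longrightarrow> dist (X m) (X n) < (1/2) ^ k"
    by metis
  \<comment> \<open>The sum dominates every \<open>N k\<close> with k at most n, and the summand n
    makes the index strictly increasing.\<close>
  define r where "r n = n + (\<Sum>k\<le>n. N k)" for n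
  have "r n < r (Suc n)" for n by (simp add: r_def)
  then have r: "strict_mono r" by (simp add: strict_mono_Suc_iff)
  have "N n \<le> r n" for n
    unfolding r_def by (simp add: member_le_sum trans_le_add2)
  moreover have "r n \<le> r (Suc n)" for n using \<open>r n < r (Suc n)\<close> by simp
  ultimately have "dist (X (r (Suc n))) (X (r n)) < (1/2) ^ n" for n
    by (intro N) (metis order_trans)+
  with r show thesis using that by blast
qed

text \<open>The triangle inequality in L2 keeps all partial sums of the moduli below the geometric
  sum 2. By monotone convergence the square of their supremum is integrable, hence finite almost
  everywhere.\<close>

lemma AE_summable_of_fast_L2_sequence:
  fixes F :: "nat \<Rightarrow> real \<Rightarrow> complex"
  assumes F: "\<And>n. F n \<in> L2"
    and fast: "\<And>n. norm (abs_l2 (F n)) \<le> (1/2) ^ n"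
  shows "AE x in half_line. summable (\<lambda>n. cmod (F n x))"
proof -
  \<comment> \<open>The moduli are elements of L2 with the same norms as the \<open>F n\<close>, so
    that the triangle inequality of L2 applies to them.\<close>
  define D where "D n x = complex_of_real (cmod (F n x))" for n x
  have [measurable]: "F n \<in> borel_measurable half_line" for n using F L2_measurable by blast
  have D: "D n \<in> L2" for n
  proof
    show "D n \<in> borel_measurable half_line" unfolding D_def by measurable
    show "integrable half_line (\<lambda>x. (cmod (D n x))\<^sup>2)"
      using L2_integrable[OF F, of n] by (simp add: D_def)
  qed
  have nD: "norm (abs_l2 (D n)) = norm (abs_l2 (F n))" for n
    by (simp add: norm_abs_l2 D F l2_norm_def) (simp add: D_def)
  define S where "S n x = (\<Sum>i<n. cmod (F i x))" for n x
  have [measurable]: "S n \<in> borel_measurable half_line" for n unfolding S_def by measurable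
  have SD: "(\<Sum>i<n. D i x) = of_real (S n x)" for n x by (simp add: S_def D_def)
  have int: "integrable half_line (\<lambda>x. (S n x)\<^sup>2)" for n
    using L2_integrable[of "\<lambda>x. \<Sum>i<n. D i x", OF L2_sum[OF D]] by (simp add: SD)
  have le: "(LINT x|half_line. (S n x)\<^sup>2) \<le> 4" for n
  proof -
    have eq: "(LINT x|half_line. (S n x)\<^sup>2) = (norm (\<Sum>i<n. abs_l2 (D i)))\<^sup>2"
      using norm_abs_l2_square[of "\<lambda>x. \<Sum>i<n. D i x", OF L2_sum[OF D]]
        abs_l2_sum[of "{..<n}" D, OF D] by (simp add: SD)
    have "norm (\<Sum>i<n. abs_l2 (D i)) \<le> (\<Sum>i<n. (1/2) ^ i)"
      by (rule order_trans[OF norm_sum]) (intro sum_mono, simp add: nD fast)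
    also have "\<dots> \<le> 2" by (subst sum_gp_strict) (simp add: field_simps)
    finally have "norm (\<Sum>i<n. abs_l2 (D i)) \<le> 2" .
    from power_mono[OF this norm_ge_zero, of 2] show ?thesis unfolding eq by simp
  qed
  have nn: "(\<integral>\<^sup>+x. ennreal ((S n x)\<^sup>2) \<partial>half_line) \<le> ennreal 4" for n
    using le[of n] by (subst nn_integral_eq_integral[OF int]) (auto simp del: ennreal_numeral)
  have "(\<integral>\<^sup>+x. (SUP n. ennreal ((S n x)\<^sup>2)) \<partial>half_line) = (SUP n. \<integral>\<^sup>+x. ennreal ((S n x)\<^sup>2) \<partial>half_line)"
  proof (rule nn_integral_monotone_convergence_SUP)
    show "incseq (\<lambda>n x. ennreal ((S n x)\<^sup>2))"
      by (auto simp: incseq_def le_fun_def S_def intro!: ennreal_leI power_mono sum_mono2 sum_nonneg)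
  qed measurable
  also have "\<dots> \<le> ennreal 4" by (intro SUP_least nn)
  also have "\<dots> < \<infinity>" by simp
  finally have "(\<integral>\<^sup>+x. (SUP n. ennreal ((S n x)\<^sup>2)) \<partial>half_line) \<noteq> \<infinity>" by simp
  then have "AE x in half_line. (SUP n. ennreal ((S n x)\<^sup>2)) \<noteq> \<infinity>"
    by (intro nn_integral_noteq_infinite) auto
  then show ?thesis
  proof eventually_elim
    case (elim x)
    then obtain c where c: "c \<ge> 0" "(SUP n. ennreal ((S n x)\<^sup>2)) = ennreal c"
      by (metis ennreal_cases infinity_ennreal_def)
    have "(S n x)\<^sup>2 \<le> c" for n
      using c(1) SUP_upper[of n UNIV "\<lambda>n. ennreal ((S n x)\<^sup>2)"] unfolding c(2) by simp
    then have "S n x \<le> sqrt c" for n by (simp add: real_le_rsqrt)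
    then show ?case
      unfolding S_def by (intro summableI_nonneg_bounded[where x="sqrt c"]) auto
  qed
qed

text \<open>Riesz-Fischer: the increments of a fast subsequence are summable almost everywhere,
  which gives a pointwise limit, and Fatou's lemma turns it into a limit in norm.\<close>

instance l2 :: complete_space
proof
  fix X :: "nat \<Rightarrow> l2" assume X: "Cauchy X"
  obtain r where r: "strict_mono r" and fast: "\<And>n. dist (X (r (Suc n))) (X (r n)) < (1/2) ^ n"
    using Cauchy_fast_subseq[OF X] by blast
  define F where "F n = rep_l2 (X (r n))" for n
  have FL: "F n \<in> L2" and aF: "abs_l2 (F n) = X (r n)" for n by (simp_all add: F_def)
  have [measurable]: "F n \<in> borel_measurable half_line" for n using FL L2_measurable by blast
  have "AE x in half_line. summable (\<lambda>n. cmod (F (Suc n) x - F n x))"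
    by (rule AE_summable_of_fast_L2_sequence)
      (use fast in \<open>auto simp: FL L2_diff abs_l2_diff aF dist_norm less_imp_le\<close>)
  then have conv: "AE x in half_line. (\<lambda>n. F n x) \<longlonglongrightarrow> lim (\<lambda>n. F n x)"
  proof eventually_elim
    case (elim x)
    then have "summable (\<lambda>n. F (Suc n) x - F n x)" by (rule summable_norm_cancel)
    then have "convergent (\<lambda>n. \<Sum>i<n. F (Suc i) x - F i x)"
      by (simp add: summable_iff_convergent)
    then have "convergent (\<lambda>n. F n x - F 0 x)"
      by (subst (asm) sum_lessThan_telescope[of "\<lambda>n. F n x"])
    then have "convergent (\<lambda>n. F n x)"
      using convergent_add[OF _ convergent_const[of "F 0 x"]] by fastforce
    then show ?case by (simp add: convergent_LIMSEQ_iff)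
  qed
  define f where "f x = lim (\<lambda>n. F n x)" for x
  have [measurable]: "f \<in> borel_measurable half_line"
    unfolding f_def by (rule borel_measurable_lim_metric) measurable
  \<comment> \<open>Fatou in the second index with \<open>n\<close> fixed. The estimate is for the
    nonnegative integral, because square integrability of the difference is a consequence of
    it.\<close>
  have key: "\<exists>N. \<forall>n\<ge>N. (\<integral>\<^sup>+x. ennreal ((cmod (F n x - f x))\<^sup>2) \<partial>half_line) \<le> ennreal (e\<^sup>2)"
    if e: "e > 0" for e
  proof -
    have "Cauchy (\<lambda>n. X (r n))" using X r Cauchy_subseq_Cauchy[of X r] by (simp add: o_def)
    then obtain N where N: "\<And>m n. m \<ge> N \<Longrightarrow> n \<ge> N \<Longrightarrow> norm (X (r m) - X (r n)) < e"
      using e by (metis CauchyD)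
    have "(\<integral>\<^sup>+x. ennreal ((cmod (F n x - f x))\<^sup>2) \<partial>half_line) \<le> ennreal (e\<^sup>2)" if n: "n \<ge> N" for n
    proof -
      have "(\<integral>\<^sup>+x. ennreal ((cmod (F n x - f x))\<^sup>2) \<partial>half_line)
          = (\<integral>\<^sup>+x. liminf (\<lambda>m. ennreal ((cmod (F n x - F m x))\<^sup>2)) \<partial>half_line)"
      proof (rule nn_integral_cong_AE)
        show "AE x in half_line. ennreal ((cmod (F n x - f x))\<^sup>2)
            = liminf (\<lambda>m. ennreal ((cmod (F n x - F m x))\<^sup>2))"
          using conv
        proof eventually_elim
          case (elim x)
          have "(\<lambda>m. ennreal ((cmod (F n x - F m x))\<^sup>2)) \<longlonglongrightarrow> ennreal ((cmod (F n x - f x))\<^sup>2)"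
            unfolding f_def by (intro tendsto_intros tendsto_ennrealI elim)
          then show ?case by (intro lim_imp_Liminf[symmetric]) auto
        qed
      qed
      also have "\<dots> \<le> liminf (\<lambda>m. \<integral>\<^sup>+x. ennreal ((cmod (F n x - F m x))\<^sup>2) \<partial>half_line)"
        by (rule nn_integral_liminf) measurable
      also have "\<dots> \<le> ennreal (e\<^sup>2)"
      proof (rule Liminf_le)
        show "\<forall>\<^sub>F m in sequentially. (\<integral>\<^sup>+x. ennreal ((cmod (F n x - F m x))\<^sup>2) \<partial>half_line) \<le> ennreal (e\<^sup>2)"
          using eventually_ge_at_top[of N]
        proof eventually_elim
          case (elim m)
          have "(\<integral>\<^sup>+x. ennreal ((cmod (F n x - F m x))\<^sup>2) \<partial>half_line)
              = ennreal ((norm (X (r n) - X (r m)))\<^sup>2)"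
            using L2_integrable[OF L2_diff[OF FL FL], of n m]
            by (subst nn_integral_eq_integral)
              (auto simp: norm_abs_l2_square L2_diff FL simp flip: aF abs_l2_diff)
          also have "\<dots> \<le> ennreal (e\<^sup>2)"
            using N[OF n elim] by (intro ennreal_leI power_mono) auto
          finally show ?case .
        qed
      qed simp
      finally show ?thesis .
    qed
    then show ?thesis by blast
  qed
  have L: "(\<lambda>x. F n x - f x) \<in> L2"
    if "(\<integral>\<^sup>+x. ennreal ((cmod (F n x - f x))\<^sup>2) \<partial>half_line) \<le> ennreal (e\<^sup>2)" for n e
  proof (rule L2_I)
    show "integrable half_line (\<lambda>x. (cmod (F n x - f x))\<^sup>2)"
      using that by (intro integrableI_nonneg) (auto intro: le_less_trans)
  qed measurable
  obtain N0 where "(\<integral>\<^sup>+x. ennreal ((cmod (F N0 x - f x))\<^sup>2) \<partial>half_line) \<le> ennreal (1\<^sup>2)"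
    using key[of 1] by auto
  from L2_diff[OF FL L[OF this]] have "(\<lambda>x. F N0 x - (F N0 x - f x)) \<in> L2" .
  then have fL: "f \<in> L2" by simp
  have "(\<lambda>n. X (r n)) \<longlonglongrightarrow> abs_l2 f"
  proof (rule metric_LIMSEQ_I)
    fix e :: real assume "e > 0"
    then obtain N where N: "\<And>n. n \<ge> N \<Longrightarrow>
        (\<integral>\<^sup>+x. ennreal ((cmod (F n x - f x))\<^sup>2) \<partial>half_line) \<le> ennreal ((e/2)\<^sup>2)"
      using key[of "e/2"] by auto
    have "dist (X (r n)) (abs_l2 f) < e" if "n \<ge> N" for n
    proof -
      have "(LINT x|half_line. (cmod (F n x - f x))\<^sup>2) \<le> (e/2)\<^sup>2"
        using N[OF that] L2_integrable[OF L2_diff[OF FL fL], of n]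
        by (subst (asm) nn_integral_eq_integral) (auto simp: ennreal_le_iff)
      then have "(dist (X (r n)) (abs_l2 f))\<^sup>2 \<le> (e/2)\<^sup>2"
        by (simp add: dist_norm norm_abs_l2_square L2_diff FL fL flip: aF abs_l2_diff)
      then have "dist (X (r n)) (abs_l2 f) \<le> e/2"
        by (rule power2_le_imp_le) (use \<open>e > 0\<close> in simp)
      then show ?thesis using \<open>e > 0\<close> by simp
    qed
    then show "\<exists>N. \<forall>n\<ge>N. dist (X (r n)) (abs_l2 f) < e" by blast
  qed
  then have "X \<longlonglongrightarrow> abs_l2 f"
    using Cauchy_converges_subseq[of X r] X r by (simp add: o_def)
  then show "convergent X" by (rule convergentI)
qed

section \<open>Integrals over the half line and Gaussian bounds\<close>

lemma integrable_half_line_iff: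
  fixes f :: "real \<Rightarrow> 'b::{banach, second_countable_topology}"
  shows "integrable half_line f \<longleftrightarrow> integrable lborel (\<lambda>x. indicator {0<..} x *\<^sub>R f x)"
  by (rule integrable_restrict_space) simp

lemma integral_half_line:
  fixes f :: "real \<Rightarrow> 'b::{banach, second_countable_topology}"
  shows "integral\<^sup>L half_line f = (LINT x|lborel. indicator {0<..} x *\<^sub>R f x)"
  by (rule integral_restrict_space) simp

lemma borel_measurable_half_line: "f \<in> borel_measurable borel \<Longrightarrow> f \<in> borel_measurable half_line"
  by (rule measurable_restrict_space1) simp

lemma integrable_exp_minus_half_line:
  fixes d :: real
  assumes d: "d > 0"
  shows "integrable half_line (\<lambda>x. exp (- (d * x)))"
proof -
  have "(\<integral>\<^sup>+x. ennreal (exp (- (d * x))) * indicator {0..} x \<partial>lborel) = ennreal (0 - (- exp (- (d * 0)) / d))"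
  proof (rule nn_integral_FTC_atLeast)
    have "filterlim (\<lambda>x. - (d * x)) at_bot at_top"
      using d by (intro filterlim_compose[OF filterlim_uminus_at_bot_at_top]
          filterlim_tendsto_pos_mult_at_top[OF tendsto_const _ filterlim_ident])
    from tendsto_divide[OF tendsto_minus[OF filterlim_compose[OF exp_at_bot this]] tendsto_const[of d]]
    show "((\<lambda>x. - exp (- (d * x)) / d) \<longlongrightarrow> 0) at_top" using d by simp
  qed (use d in \<open>auto intro!: derivative_eq_intros\<close>)
  then have "(\<integral>\<^sup>+x. ennreal (indicator {0..} x *\<^sub>R exp (- (d * x))) \<partial>lborel) < \<infinity>"
    by (subst (asm) nn_integral_cong[where v="\<lambda>x. ennreal (indicator {0..} x *\<^sub>R exp (- (d * x)))"])
      (auto simp: indicator_def)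
  then have "integrable lborel (\<lambda>x. indicator {0..} x *\<^sub>R exp (- (d * x)))"
    by (intro integrableI_nonneg) auto
  then have "set_integrable lborel {0..} (\<lambda>x. exp (- (d * x)))"
    by (simp add: set_integrable_def)
  then have "set_integrable lborel {0<..} (\<lambda>x. exp (- (d * x)))"
    by (rule set_integrable_subset) auto
  then show ?thesis by (simp add: integrable_half_line_iff set_integrable_def)
qed

text \<open>Completing the square reduces every bound of this kind to \<open>exp (- x)\<close>, because \<open>ln x \<le> x\<close>.\<close>

lemma powr_exp_quadratic_le:
  fixes x a s l :: real
  assumes "x > 0" "a \<ge> 0" "s > 0"
  shows "x powr a * exp (l * x - s * x\<^sup>2) \<le> exp ((a + l + 1)\<^sup>2 / (4 * s)) * exp (- x)"
proof -
  have "ln x \<le> x" using ln_le_minus_one[of x] assms by simp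
  then have "a * ln x \<le> a * x" using assms by (simp add: mult_left_mono)
  moreover have "s * (x - b / (2 * s))\<^sup>2 = s * x\<^sup>2 - b * x + b\<^sup>2 / (4 * s)" for b
    using assms by (simp add: power2_eq_square field_simps)
  \<comment> \<open>The linear coefficient collects a from \<open>a * ln x \<le> a * x\<close>, l
    from the exponent, and 1 for the factor exp (- x) that is to remain.\<close>
  from this[of "a + l + 1"] have "(a + l + 1) * x - s * x\<^sup>2 \<le> (a + l + 1)\<^sup>2 / (4 * s)"
    using assms zero_le_power2[of "x - (a + l + 1) / (2 * s)"]
      mult_nonneg_nonneg[of s "(x - (a + l + 1) / (2 * s))\<^sup>2"] by linarith
  ultimately have "a * ln x + (l * x - s * x\<^sup>2) \<le> (a + l + 1)\<^sup>2 / (4 * s) + - x"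
    by (simp add: algebra_simps)
  then show ?thesis
    using assms by (simp add: powr_def mult.commute flip: exp_add)
qed

lemma integrable_powr_exp_quadratic:
  fixes a s l :: real
  assumes "a \<ge> 0" "s > 0"
  shows "integrable half_line (\<lambda>x. x powr a * exp (l * x - s * x\<^sup>2))"
proof (rule Bochner_Integration.integrable_bound)
  show "integrable half_line (\<lambda>x. exp ((a + l + 1)\<^sup>2 / (4 * s)) * exp (- x))"
    using integrable_exp_minus_half_line[of 1] by simp
  show "AE x in half_line. norm (x powr a * exp (l * x - s * x\<^sup>2)) \<le>
      norm (exp ((a + l + 1)\<^sup>2 / (4 * s)) * exp (- x))"
    using powr_exp_quadratic_le[OF _ assms] by (intro AE_half_lineI) simp
qed (intro borel_measurable_half_line, measurable)

lemma power2_powr: "x > 0 \<Longrightarrow> (x powr a)\<^sup>2 = x powr (2 * a)" for x a :: real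
  by (simp add: power2_eq_square flip: powr_add)

lemma power2_exp: "(exp a)\<^sup>2 = exp (2 * a)" for a :: real
  by (simp add: power2_eq_square flip: exp_add)

lemma gaussian_dominated_square:
  fixes a s l C :: real
  assumes "x > 0" "cmod z \<le> C * (x powr a * exp (l * x - s * x\<^sup>2))"
  shows "(cmod z)\<^sup>2 \<le> C\<^sup>2 * (x powr (2 * a) * exp (2 * l * x - 2 * s * x\<^sup>2))"
proof -
  have "(cmod z)\<^sup>2 \<le> (C * (x powr a * exp (l * x - s * x\<^sup>2)))\<^sup>2"
    using assms(2) by (intro power_mono) auto
  also have "\<dots> = C\<^sup>2 * (x powr (2 * a) * exp (2 * l * x - 2 * s * x\<^sup>2))"
    using assms(1) by (simp add: power_mult_distrib power2_powr power2_exp algebra_simps)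
  finally show ?thesis .
qed

lemma gaussian_dominated_L2:
  fixes a s l C :: real
  assumes "f \<in> borel_measurable half_line" "a \<ge> 0" "s > 0"
    and "\<And>x. x > 0 \<Longrightarrow> cmod (f x) \<le> C * (x powr a * exp (l * x - s * x\<^sup>2))"
  shows "f \<in> L2"
proof (rule L2_dominated)
  show "integrable half_line (\<lambda>x. C\<^sup>2 * (x powr (2 * a) * exp (2 * l * x - 2 * s * x\<^sup>2)))"
    using integrable_powr_exp_quadratic[of "2 * a" "2 * s" "2 * l"] assms by simp
  show "(cmod (f x))\<^sup>2 \<le> C\<^sup>2 * (x powr (2 * a) * exp (2 * l * x - 2 * s * x\<^sup>2))" if "x > 0" for x
    using gaussian_dominated_square[OF that assms(4)[OF that]] .
qed fact

lemma measurable_half_line_continuous: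
  fixes f :: "real \<Rightarrow> 'b::{second_countable_topology, topological_space}"
  assumes "continuous_on {0<..} f"
  shows "f \<in> borel_measurable half_line"
proof -
  have "f \<in> borel_measurable (restrict_space borel {0<..})"
    by (rule borel_measurable_continuous_on_restrict[OF assms])
  then show ?thesis
    by (simp cong: measurable_cong_sets add: sets_restrict_space)
qed

lemma compact_support_integrable:
  fixes f :: "real \<Rightarrow> 'b::{banach, second_countable_topology}"
  assumes "continuous_on {0<..} f" "0 < c" "\<And>x. x \<notin> {c..d} \<Longrightarrow> f x = 0"
  shows "integrable half_line f"
proof -
  have "integrable lborel (\<lambda>x. indicator {c..d} x *\<^sub>R f x)"
    using assms(2) by (intro borel_integrable_compact continuous_on_subset[OF assms(1)]) auto
  moreover have "(\<lambda>x. indicator {0<..} x *\<^sub>R f x) = (\<lambda>x. indicator {c..d} x *\<^sub>R f x)"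
    using assms(2,3) by (fastforce simp: indicator_def)
  ultimately show ?thesis by (simp only: integrable_half_line_iff)
qed

lemma compact_support_L2:
  fixes f :: "real \<Rightarrow> complex"
  assumes "continuous_on {0<..} f" "0 < c" "\<And>x. x \<notin> {c..d} \<Longrightarrow> f x = 0"
  shows "f \<in> L2"
proof (rule L2_I)
  show "f \<in> borel_measurable half_line"
    by (rule measurable_half_line_continuous) fact
  show "integrable half_line (\<lambda>x. (cmod (f x))\<^sup>2)"
    using assms by (intro compact_support_integrable[of _ c d] continuous_intros) auto
qed

lemma integral_derivative_compact_support:
  fixes F :: "real \<Rightarrow> complex"
  assumes der: "\<And>x. x > 0 \<Longrightarrow> (F has_vector_derivative f x) (at x)"
    and cont: "continuous_on {0<..} f" and c: "0 < c"
    and F: "\<And>x. x \<notin> {c..d} \<Longrightarrow> F x = 0" and f: "\<And>x. x \<notin> {c..d} \<Longrightarrow> f x = 0"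
  shows "integral\<^sup>L half_line f = 0"
proof -
  \<comment> \<open>The integral is taken over [c/2, d'], which contains [c, d] in its interior:
    vanishing of \<open>F\<close> is known only off [c, d].\<close>
  define d' where "d' = max c d + 1"
  have d': "c / 2 \<le> d'" "d < d'" "c < d'" using c by (auto simp: d'_def)
  have "(\<lambda>x. indicator {0<..} x *\<^sub>R f x) = (\<lambda>x. indicator {c/2..d'} x *\<^sub>R f x)"
    using c f d' by (fastforce simp: indicator_def)
  then have "integral\<^sup>L half_line f = (LINT x|lborel. indicator {c/2..d'} x *\<^sub>R f x)"
    by (simp only: integral_half_line)
  also have "\<dots> = F d' - F (c/2)"
    using d' c by (intro integral_FTC_Icc has_vector_derivative_at_within[OF der]
        continuous_on_subset[OF cont]) auto
  also have "\<dots> = 0" using F[of d'] F[of "c/2"] d' c by simp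
  finally show ?thesis .
qed

section \<open>Smooth cutoff functions\<close>

lemma power_le_exp:
  fixes y :: real
  assumes "y \<ge> 0" "n > 0"
  shows "y ^ n \<le> real n ^ n * exp y"
proof -
  have "(y / real n) ^ n \<le> (1 + y / real n) ^ n"
    using assms by (intro power_mono) auto
  also have "\<dots> \<le> exp y"
    using assms by (intro exp_ge_one_plus_x_over_n_power_n) auto
  finally show ?thesis using assms by (simp add: power_divide field_simps)
qed

text \<open>The classical argument for exp (-1/w), with the coefficients abstracted into a class R.
  Differentiation maps R exp (-1/w) to itself, and members of R have at most poles in w, which the
  exponential beats. So every derivative is again some \<open>ext r'\<close>, and only
  differentiability once has to be verified.\<close>

lemma smooth_bump:
  fixes \<alpha> \<beta> L :: real and w :: "real \<Rightarrow> real" and R :: "(real \<Rightarrow> complex) set"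
  defines "ext \<equiv> \<lambda>r x. if x \<in> {\<alpha><..<\<beta>} then r x * of_real (exp (- 1 / w x)) else 0"
  assumes der: "\<And>r. r \<in> R \<Longrightarrow> \<exists>r'\<in>R. \<forall>x\<in>{\<alpha><..<\<beta>}.
      ((\<lambda>x. r x * of_real (exp (- 1 / w x))) has_vector_derivative (r' x * of_real (exp (- 1 / w x)))) (at x)"
    and bound: "\<And>r. r \<in> R \<Longrightarrow> \<exists>C k. \<forall>x\<in>{\<alpha><..<\<beta>}. cmod (r x) \<le> C / w x ^ k"
    and w_pos: "\<And>x. x \<in> {\<alpha><..<\<beta>} \<Longrightarrow> 0 < w x"
    and w_lip: "\<And>x y. x \<in> {\<alpha><..<\<beta>} \<Longrightarrow> y \<notin> {\<alpha><..<\<beta>} \<Longrightarrow> w x \<le> L * \<bar>x - y\<bar>"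
    and r: "r \<in> R"
  shows "(vderiv ^^ n) (ext r) differentiable (at x)"
proof -
  \<comment> \<open>Off the open interval the extension is of order |x - y|^2: the exponential
    supplies w^(k+2), of which k powers cancel the pole of r and the other two become |x - y|^2 by
    the Lipschitz bound.\<close>
  have flat: "(ext r has_vector_derivative 0) (at y)" if r: "r \<in> R" and y: "y \<notin> {\<alpha><..<\<beta>}" for r y
  proof -
    obtain C k where C: "\<And>x. x \<in> {\<alpha><..<\<beta>} \<Longrightarrow> cmod (r x) \<le> C / w x ^ k"
      using bound[OF r] by blast
    define K where "K = \<bar>C\<bar> * real (k + 2) ^ (k + 2) * L\<^sup>2"
    have K: "cmod (ext r x) \<le> K * \<bar>x - y\<bar>\<^sup>2" for x
    proof (cases "x \<in> {\<alpha><..<\<beta>}")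
      case True
      have wx: "w x > 0" "w x \<le> L * \<bar>x - y\<bar>" using w_pos w_lip True y by auto
      have "(1 / w x) ^ (k + 2) \<le> real (k + 2) ^ (k + 2) * exp (1 / w x)"
        using wx by (intro power_le_exp) auto
      then have e: "exp (- 1 / w x) / w x ^ k \<le> real (k + 2) ^ (k + 2) * (w x)\<^sup>2"
        using wx by (simp add: exp_minus power_divide power_add field_simps power2_eq_square)
      have "cmod (ext r x) = cmod (r x) * exp (- 1 / w x)"
        using True by (simp add: ext_def norm_mult)
      also have "\<dots> \<le> \<bar>C\<bar> / w x ^ k * exp (- 1 / w x)"
        using order_trans[OF C[OF True] divide_right_mono[of C "\<bar>C\<bar>" "w x ^ k"]] wx
        by (intro mult_right_mono) auto
      also have "\<dots> \<le> \<bar>C\<bar> * (real (k + 2) ^ (k + 2) * (w x)\<^sup>2)"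
        using mult_left_mono[OF e, of "\<bar>C\<bar>"] by (simp add: field_simps)
      also have "\<dots> \<le> \<bar>C\<bar> * (real (k + 2) ^ (k + 2) * (L * \<bar>x - y\<bar>)\<^sup>2)"
        using wx by (intro mult_left_mono power_mono) auto
      finally show ?thesis by (simp add: K_def power_mult_distrib mult_ac)
    next
      case False
      then have "ext r x = 0" unfolding ext_def by (rule if_not_P)
      then show ?thesis by (simp add: K_def)
    qed
    have "((\<lambda>x. K * \<bar>x - y\<bar>) \<longlongrightarrow> K * \<bar>y - y\<bar>) (at y)" by (intro tendsto_intros)
    then have "((\<lambda>x. K * \<bar>x - y\<bar>) \<longlongrightarrow> 0) (at y)" by simp
    then have "((\<lambda>x. norm (ext r x - ext r y - (x - y) *\<^sub>R 0) / norm (x - y)) \<longlongrightarrow> 0) (at y)"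
    proof (rule Lim_null_comparison[rotated])
      have "norm (ext r x) / \<bar>x - y\<bar> \<le> K * \<bar>x - y\<bar>" if "x \<noteq> y" for x
        using K[of x] that by (simp add: pos_divide_le_eq power2_eq_square mult.assoc)
      then show "\<forall>\<^sub>F x in at y. norm (norm (ext r x - ext r y - (x - y) *\<^sub>R 0) / norm (x - y)) \<le> K * \<bar>x - y\<bar>"
        using y by (auto simp: eventually_at_filter ext_def)
    qed
    then show ?thesis
      unfolding has_vector_derivative_def has_derivative_iff_norm by simp
  qed
  have step: "\<exists>r'\<in>R. \<forall>x. (ext r has_vector_derivative ext r' x) (at x)" if r: "r \<in> R" for r
  proof -
    obtain r' where r': "r' \<in> R" and d: "\<And>x. x \<in> {\<alpha><..<\<beta>} \<Longrightarrow>
      ((\<lambda>x. r x * of_real (exp (- 1 / w x))) has_vector_derivative (r' x * of_real (exp (- 1 / w x)))) (at x)"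
      using der[OF r] by blast
    have "(ext r has_vector_derivative ext r' x) (at x)" for x
    proof (cases "x \<in> {\<alpha><..<\<beta>}")
      case True
      have "(ext r has_vector_derivative (r' x * of_real (exp (- 1 / w x)))) (at x)"
        by (rule has_vector_derivative_transform_within_open[OF d[OF True] open_greaterThanLessThan True])
          (simp add: ext_def)
      then show ?thesis using True by (simp add: ext_def)
    next
      case False
      then have "ext r' x = 0" unfolding ext_def by (rule if_not_P)
      then show ?thesis using flat[OF r False] by simp
    qed
    with r' show ?thesis by blast
  qed
  have iter: "\<exists>r'\<in>R. (vderiv ^^ n) (ext r) = ext r'" for n
  proof (induction n)
    case (Suc n)
    then obtain r' where r': "r' \<in> R" "(vderiv ^^ n) (ext r) = ext r'" by blast
    obtain r'' where r'': "r'' \<in> R" "\<And>x. (ext r' has_vector_derivative ext r'' x) (at x)"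
      using step[OF r'(1)] by blast
    have "vderiv (ext r') = ext r''"
      using r''(2) by (auto simp: vderiv_def intro: vector_derivative_at)
    with r' r''(1) show ?case by (intro bexI[of _ r'']) simp
  next
    case 0
    show ?case using r by (intro bexI[of _ r]) simp
  qed
  obtain r' where "r' \<in> R" "(vderiv ^^ n) (ext r) = ext r'" using iter by blast
  with step[of r'] show ?thesis
    by (metis differentiableI_vector)
qed

text \<open>
  Cutoffs that are functions of \<open>ln x\<close>: their Dirichlet energy with respect to \<open>x dx\<close> tends to \<open>0\<close>,
  which is needed for \<open>\<nu> = 0\<close>.
\<close>

definition cut_weight :: "real \<Rightarrow> real \<Rightarrow> real" where
  "cut_weight m x = 1 - (ln x / m)\<^sup>2"

text \<open>The standard bump in the variable s = ln x / m, normalized to the value 1 at s = 0. For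
  fixed x the variable s tends to 0 as m grows, so the cutoffs converge to 1.\<close>

definition log_cutoff :: "real \<Rightarrow> real \<Rightarrow> real" where
  "log_cutoff m x = (if x \<in> {exp (- m)<..<exp m} then exp (1 - 1 / cut_weight m x) else 0)"

lemma ln_bounds_in_exp_interval:
  fixes x m :: real
  assumes "x \<in> {exp (- m)<..<exp m}"
  shows "x > 0" "\<bar>ln x\<bar> < m"
proof -
  show x: "x > 0" using less_trans[OF exp_gt_zero, of "- m" x] assms by simp
  have "ln (exp (- m)) < ln x" "ln x < ln (exp m)"
    using assms x by (auto simp only: ln_less_cancel_iff exp_gt_zero greaterThanLessThan_iff)
  then show "\<bar>ln x\<bar> < m" by (simp add: abs_less_iff)
qed

lemma cut_weight_bounds:
  assumes "x \<in> {exp (- m)<..<exp m}"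
  shows "0 < cut_weight m x" "cut_weight m x \<le> 1"
proof -
  have "\<bar>ln x / m\<bar> < 1" using ln_bounds_in_exp_interval[OF assms] by (simp add: abs_divide)
  then show "0 < cut_weight m x" by (simp add: cut_weight_def abs_square_less_1)
  show "cut_weight m x \<le> 1" by (simp add: cut_weight_def)
qed

lemma cut_weight_derivative:
  assumes "x > 0" "m > 0"
  shows "(cut_weight m has_real_derivative (- 2 * ln x / (m\<^sup>2 * x))) (at x)"
  unfolding cut_weight_def
  using assms by (auto intro!: derivative_eq_intros simp: power2_eq_square)

lemma cut_weight_lipschitz:
  assumes x: "x \<in> {exp (- m)<..<exp m}" and y: "y \<notin> {exp (- m)<..<exp m}" and m: "m > 0"
  shows "cut_weight m x \<le> 2 * exp m / m * \<bar>x - y\<bar>"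
proof -
  let ?L = "2 * exp m / m"
  \<comment> \<open>The end point of the interval on the side of y. The weight vanishes there, and
    it is no farther from x than y is, so the mean value inequality between x and z gives the
    claim.\<close>
  define z where "z = (if y \<le> exp (- m) then exp (- m) else exp m)"
  have zI: "z \<in> {exp (- m)..exp m}" using m by (auto simp: z_def)
  have wz: "cut_weight m z = 0" using m by (auto simp: cut_weight_def z_def)
  have "\<bar>x - z\<bar> \<le> \<bar>x - y\<bar>" using x y by (auto simp: z_def)
  have "norm (cut_weight m x - cut_weight m z) \<le> ?L * norm (x - z)"
  proof (rule field_differentiable_bound[where S="{exp (- m)..exp m}" and f'="\<lambda>t. - 2 * ln t / (m\<^sup>2 * t)"])
    fix t assume t: "t \<in> {exp (- m)..exp m}"
    then have t0: "t > 0" by (auto intro: less_le_trans[OF exp_gt_zero])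
    show "(cut_weight m has_field_derivative - 2 * ln t / (m\<^sup>2 * t)) (at t within {exp (- m)..exp m})"
      by (rule DERIV_subset[OF cut_weight_derivative[OF t0 m]]) simp
    have "ln (exp (- m)) \<le> ln t" "ln t \<le> ln (exp m)"
      using t t0 by (auto simp only: ln_le_cancel_iff exp_gt_zero atLeastAtMost_iff)
    then have l: "\<bar>ln t\<bar> \<le> m" by (simp add: abs_le_iff)
    have "inverse t \<le> inverse (exp (- m))" using t t0 by (intro le_imp_inverse_le) auto
    then have "1 / t \<le> exp m" by (simp add: inverse_eq_divide exp_minus)
    then have "\<bar>ln t\<bar> * (1 / t) \<le> m * exp m" using l t0 m by (intro mult_mono) auto
    then have "2 / m\<^sup>2 * (\<bar>ln t\<bar> * (1 / t)) \<le> 2 / m\<^sup>2 * (m * exp m)"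
      by (intro mult_left_mono) auto
    then show "norm (- 2 * ln t / (m\<^sup>2 * t)) \<le> ?L"
      using m t0 by (simp add: abs_mult power2_eq_square)
  qed (use x zI in auto)
  also have "\<dots> \<le> ?L * \<bar>x - y\<bar>"
    using \<open>\<bar>x - z\<bar> \<le> \<bar>x - y\<bar>\<close> m by (intro mult_left_mono) auto
  finally show ?thesis using wz by simp
qed

text \<open>The coefficient class to which \<open>smooth_bump\<close> is applied. The derivative of
  each generator other than \<open>g\<close> stays in the generated algebra, so smoothness of cutoff
  times \<open>g\<close> reduces to one first order condition on \<open>g\<close>. A Gaussian
  satisfies it, since its logarithmic derivative is a combination of 1/x and x.\<close>

inductive_set cut_coeffs :: "real \<Rightarrow> (real \<Rightarrow> complex) \<Rightarrow> (real \<Rightarrow> complex) set"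
  for m :: real and g :: "real \<Rightarrow> complex" where
  const: "(\<lambda>_. c) \<in> cut_coeffs m g"
| base: "g \<in> cut_coeffs m g"
| ident: "(\<lambda>x. of_real x) \<in> cut_coeffs m g"
| recip: "(\<lambda>x. of_real (1 / x)) \<in> cut_coeffs m g"
| log: "(\<lambda>x. of_real (ln x)) \<in> cut_coeffs m g"
| recip_weight: "(\<lambda>x. of_real (1 / cut_weight m x)) \<in> cut_coeffs m g"
| add: "r \<in> cut_coeffs m g \<Longrightarrow> s \<in> cut_coeffs m g \<Longrightarrow> (\<lambda>x. r x + s x) \<in> cut_coeffs m g"
| mult: "r \<in> cut_coeffs m g \<Longrightarrow> s \<in> cut_coeffs m g \<Longrightarrow> (\<lambda>x. r x * s x) \<in> cut_coeffs m g"

text \<open>The closed interval is a compact subset of (0,\<infinity>), so all generators are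
  bounded there except the reciprocal of the weight, which contributes one pole.\<close>

lemma cut_coeffs_bound:
  assumes m: "m > 0" and g: "continuous_on {0<..} g" and r: "r \<in> cut_coeffs m g"
  shows "\<exists>C k. \<forall>x\<in>{exp (- m)<..<exp m}. cmod (r x) \<le> C / cut_weight m x ^ k"
  using r
proof induction
  case (const c)
  show ?case by (rule exI[of _ "cmod c"], rule exI[of _ 0]) auto
next
  case base
  have "compact (g ` {exp (- m)..exp m})"
    by (intro compact_continuous_image continuous_on_subset[OF g])
      (auto intro: less_le_trans[OF exp_gt_zero])
  then obtain C where "\<forall>y\<in>g ` {exp (- m)..exp m}. cmod y \<le> C"
    by (metis compact_imp_bounded bounded_iff)
  then show ?case by (intro exI[of _ C] exI[of _ 0]) auto
next
  case ident
  have "\<bar>x\<bar> \<le> exp m" if "x \<in> {exp (- m)<..<exp m}" for x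
    using ln_bounds_in_exp_interval(1)[OF that] that by simp
  then show ?case by (intro exI[of _ "exp m"] exI[of _ 0]) simp
next
  case recip
  have "1 / x \<le> exp m" if "x \<in> {exp (- m)<..<exp m}" for x
  proof -
    have "inverse x \<le> inverse (exp (- m))" using that by (intro le_imp_inverse_le) auto
    then show ?thesis by (simp add: inverse_eq_divide exp_minus)
  qed
  then show ?case
    using ln_bounds_in_exp_interval(1)[of _ m]
    by (intro exI[of _ "exp m"] exI[of _ 0]) (force simp: norm_divide)
next
  case log
  show ?case using ln_bounds_in_exp_interval(2)[of _ m]
    by (intro exI[of _ m] exI[of _ 0]) (force simp: less_imp_le)
next
  case recip_weight
  show ?case using cut_weight_bounds(1)[of _ m]
    by (intro exI[of _ 1] exI[of _ 1]) (force simp: norm_divide)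
next
  case (add r s)
  then obtain C k D l where
    *: "\<And>x. x \<in> {exp (- m)<..<exp m} \<Longrightarrow> cmod (r x) \<le> C / cut_weight m x ^ k"
    "\<And>x. x \<in> {exp (- m)<..<exp m} \<Longrightarrow> cmod (s x) \<le> D / cut_weight m x ^ l" by metis
  have "cmod (r x + s x) \<le> (\<bar>C\<bar> + \<bar>D\<bar>) / cut_weight m x ^ (k + l)" if x: "x \<in> {exp (- m)<..<exp m}" for x
  proof -
    have w: "0 < cut_weight m x" "cut_weight m x \<le> 1" using cut_weight_bounds[OF x] .
    \<comment> \<open>The weight is at most 1, so both exponents may be raised to the common value k
      + l.\<close>
    have "C / cut_weight m x ^ k \<le> \<bar>C\<bar> / cut_weight m x ^ (k + l)"
      using w by (intro frac_le power_decreasing) auto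
    moreover have "D / cut_weight m x ^ l \<le> \<bar>D\<bar> / cut_weight m x ^ (k + l)"
      using w by (intro frac_le power_decreasing) auto
    ultimately show ?thesis
      using *[OF x] norm_triangle_ineq[of "r x" "s x"] by (simp add: add_divide_distrib)
  qed
  then show ?case by blast
next
  case (mult r s)
  then obtain C k D l where
    *: "\<And>x. x \<in> {exp (- m)<..<exp m} \<Longrightarrow> cmod (r x) \<le> C / cut_weight m x ^ k"
    "\<And>x. x \<in> {exp (- m)<..<exp m} \<Longrightarrow> cmod (s x) \<le> D / cut_weight m x ^ l" by metis
  have "cmod (r x * s x) \<le> (C * D) / cut_weight m x ^ (k + l)" if x: "x \<in> {exp (- m)<..<exp m}" for x
    using mult_mono'[OF *[OF x] norm_ge_zero norm_ge_zero] by (simp add: norm_mult power_add)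
  then show ?case by blast
qed

lemma cut_coeffs_deriv:
  assumes m: "m > 0"
    and g: "g' \<in> cut_coeffs m g" "\<And>x. x > 0 \<Longrightarrow> (g has_vector_derivative g' x) (at x)"
    and r: "r \<in> cut_coeffs m g"
  shows "\<exists>r'\<in>cut_coeffs m g. \<forall>x\<in>{exp (- m)<..<exp m}. (r has_vector_derivative r' x) (at x)"
  using r
proof induction
  case (const c)
  show ?case by (rule bexI[OF _ cut_coeffs.const[of 0]]) auto
next
  case base
  show ?case using g ln_bounds_in_exp_interval(1) by blast
next
  case ident
  show ?case
    by (rule bexI[OF _ cut_coeffs.const[of 1]])
      (auto intro!: derivative_eq_intros has_vector_derivative_of_real)
next
  case recip
  show ?case
  proof (rule bexI[OF _ cut_coeffs.mult[OF cut_coeffs.const[of "-1"] cut_coeffs.mult[OF cut_coeffs.recip cut_coeffs.recip]]], safe)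
    fix x assume "x \<in> {exp (- m)<..<exp m}"
    then have "x > 0" by (rule ln_bounds_in_exp_interval)
    then have "((\<lambda>x. 1 / x) has_real_derivative - (1 / x * (1 / x))) (at x)"
      by (auto intro!: derivative_eq_intros)
    then have "((\<lambda>x. complex_of_real (1 / x)) has_vector_derivative of_real (- (1 / x * (1 / x)))) (at x)"
      by (intro has_vector_derivative_of_real) (simp add: has_real_derivative_iff_has_vector_derivative)
    then show "((\<lambda>x. complex_of_real (1 / x)) has_vector_derivative - 1 * (of_real (1 / x) * of_real (1 / x))) (at x)"
      by (simp only: of_real_minus of_real_mult mult_minus1)
  qed
next
  case log
  show ?case
  proof (rule bexI[OF _ cut_coeffs.recip], safe)
    fix x assume "x \<in> {exp (- m)<..<exp m}"
    then have "x > 0" by (rule ln_bounds_in_exp_interval)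
    then show "((\<lambda>x. complex_of_real (ln x)) has_vector_derivative of_real (1 / x)) (at x)"
      by (intro has_vector_derivative_of_real)
        (auto simp: has_real_derivative_iff_has_vector_derivative[symmetric] intro!: derivative_eq_intros)
  qed
next
  case recip_weight
  let ?r' = "\<lambda>x. complex_of_real (1 / cut_weight m x) * (of_real (1 / cut_weight m x) *
      (of_real (2 / m\<^sup>2) * (of_real (ln x) * of_real (1 / x))))"
  show ?case
  proof (rule bexI[of _ ?r'], safe)
    show "?r' \<in> cut_coeffs m g" by (intro cut_coeffs.intros)
    fix x assume x: "x \<in> {exp (- m)<..<exp m}"
    then have x0: "x > 0" by (rule ln_bounds_in_exp_interval)
    have w: "cut_weight m x \<noteq> 0" using cut_weight_bounds(1)[OF x] by simp
    have "((\<lambda>x. 1 / cut_weight m x) has_real_derivative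
        (1 / cut_weight m x * (1 / cut_weight m x * (2 / m\<^sup>2 * (ln x * (1 / x)))))) (at x)"
      by (rule derivative_eq_intros cut_weight_derivative x0 m w refl
          | use w x0 m in \<open>simp add: field_simps power2_eq_square\<close>)+
    then show "((\<lambda>x. complex_of_real (1 / cut_weight m x)) has_vector_derivative ?r' x) (at x)"
      unfolding of_real_mult[symmetric]
      by (intro has_vector_derivative_of_real) (simp add: has_real_derivative_iff_has_vector_derivative)
  qed
next
  case (add r s)
  then obtain r' s' where *: "r' \<in> cut_coeffs m g" "s' \<in> cut_coeffs m g"
    "\<And>x. x \<in> {exp (- m)<..<exp m} \<Longrightarrow> (r has_vector_derivative r' x) (at x)"
    "\<And>x. x \<in> {exp (- m)<..<exp m} \<Longrightarrow> (s has_vector_derivative s' x) (at x)" by metis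
  show ?case
    by (rule bexI[OF _ cut_coeffs.add[OF *(1,2)]]) (auto intro!: has_vector_derivative_add *)
next
  case (mult r s)
  then obtain r' s' where *: "r' \<in> cut_coeffs m g" "s' \<in> cut_coeffs m g"
    "\<And>x. x \<in> {exp (- m)<..<exp m} \<Longrightarrow> (r has_vector_derivative r' x) (at x)"
    "\<And>x. x \<in> {exp (- m)<..<exp m} \<Longrightarrow> (s has_vector_derivative s' x) (at x)" by metis
  show ?case
    by (rule bexI[OF _ cut_coeffs.add[OF cut_coeffs.mult[OF mult.hyps(1) *(2)] cut_coeffs.mult[OF *(1) mult.hyps(2)]]])
      (auto intro!: has_vector_derivative_mult *)
qed

lemma log_cutoff_test_function:
  assumes m: "m > 0" and g: "g' \<in> cut_coeffs m g" "\<And>x. x > 0 \<Longrightarrow> (g has_vector_derivative g' x) (at x)"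
  shows "(\<lambda>x. of_real (log_cutoff m x) * g x) \<in> test_functions"
proof -
  define R where "R = cut_coeffs m g"
  define ext where "ext = (\<lambda>r x. if x \<in> {exp (- m)<..<exp m}
    then r x * of_real (exp (- 1 / cut_weight m x)) else (0::complex))"
  \<comment> \<open>The factor e is the normalization of the cutoff, split off from exp (1 -
    1/w).\<close>
  define r where "r = (\<lambda>x. of_real (exp 1) * g x)"
  have r: "r \<in> R" unfolding R_def r_def by (intro cut_coeffs.intros)
  have "continuous_on {0<..} g"
    using g(2) by (meson continuous_at_imp_continuous_on greaterThan_iff has_vector_derivative_continuous)
  note bound = cut_coeffs_bound[OF m this, folded R_def]
  have eq: "(\<lambda>x. of_real (log_cutoff m x) * g x) = ext r"
    by (auto simp: fun_eq_iff log_cutoff_def ext_def r_def exp_diff exp_minus field_simps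
        simp flip: of_real_mult)
  have der: "\<exists>r'\<in>R. \<forall>x\<in>{exp (- m)<..<exp m}. ((\<lambda>x. r x * of_real (exp (- 1 / cut_weight m x)))
      has_vector_derivative (r' x * of_real (exp (- 1 / cut_weight m x)))) (at x)" if "r \<in> R" for r
  proof -
    obtain r' where r': "r' \<in> R" "\<And>x. x \<in> {exp (- m)<..<exp m} \<Longrightarrow> (r has_vector_derivative r' x) (at x)"
      using cut_coeffs_deriv[of m g' g r] m g \<open>r \<in> R\<close> unfolding R_def by blast
    \<comment> \<open>The derivative of the exponent -1/w, namely w'/w^2 with w' = - 2 ln x / (m^2
      x).\<close>
    let ?v = "\<lambda>x. complex_of_real (1 / cut_weight m x) * (of_real (1 / cut_weight m x) *
      (of_real (- 2 / m\<^sup>2) * (of_real (ln x) * of_real (1 / x))))"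
    let ?s = "\<lambda>x. r' x + r x * ?v x"
    have "?s \<in> R" using r'(1) that unfolding R_def by (intro cut_coeffs.intros)
    moreover have "((\<lambda>x. r x * of_real (exp (- 1 / cut_weight m x)))
      has_vector_derivative (?s x * of_real (exp (- 1 / cut_weight m x)))) (at x)"
      if x: "x \<in> {exp (- m)<..<exp m}" for x
    proof -
      have x0: "x > 0" using x by (rule ln_bounds_in_exp_interval)
      have w: "cut_weight m x \<noteq> 0" using cut_weight_bounds(1)[OF x] by simp
      let ?d = "1 / cut_weight m x * (1 / cut_weight m x * (- 2 / m\<^sup>2 * (ln x * (1 / x))))"
      have "((\<lambda>x. - 1 / cut_weight m x) has_real_derivative ?d) (at x)"
        using DERIV_divide[OF DERIV_const[of "- 1"] cut_weight_derivative[OF x0 m] w]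
        by (simp add: mult_ac)
      from DERIV_fun_exp[OF this]
      have "((\<lambda>x. exp (- 1 / cut_weight m x)) has_real_derivative (?d * exp (- 1 / cut_weight m x))) (at x)"
        by (simp only: mult.commute)
      then have "((\<lambda>x. complex_of_real (exp (- 1 / cut_weight m x))) has_vector_derivative
         of_real (?d * exp (- 1 / cut_weight m x))) (at x)"
        by (intro has_vector_derivative_of_real) (simp add: has_real_derivative_iff_has_vector_derivative)
      from has_vector_derivative_mult[OF r'(2)[OF x] this] show ?thesis
        by (rule has_vector_derivative_eq_rhs) (simp add: algebra_simps)
    qed
    ultimately show ?thesis by (intro bexI[of _ ?s] ballI)
  qed
  have "(vderiv ^^ n) (ext r) differentiable (at x)" for n x
    unfolding ext_def
    by (rule smooth_bump[OF der bound cut_weight_bounds(1) cut_weight_lipschitz[OF _ _ m] r])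
  moreover have "\<forall>x. x \<notin> {exp (- m)..exp m} \<longrightarrow> ext r x = 0" by (auto simp: ext_def)
  moreover have "{exp (- m)..exp m} \<subseteq> {0<..}" by (auto intro: less_le_trans[OF exp_gt_zero])
  ultimately show ?thesis
    unfolding eq test_functions_def using compact_Icc by blast
qed

section \<open>Test functions and the energy of the cutoffs\<close>

lemma test_function_derivs:
  assumes "\<phi> \<in> test_functions"
  shows "(\<phi> has_vector_derivative vderiv \<phi> x) (at x)"
    "(vderiv \<phi> has_vector_derivative vderiv (vderiv \<phi>) x) (at x)"
    "continuous_on A \<phi>" "continuous_on A (vderiv \<phi>)" "continuous_on A (vderiv (vderiv \<phi>))"
proof -
  have d: "(vderiv ^^ n) \<phi> differentiable (at x)" for n x
    using assms by (simp add: test_functions_def)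
  note d0 = d[of 0, simplified] and d1 = d[of 1, simplified] and d2 = d[of 2, simplified numeral_2_eq_2, simplified]
  show "(\<phi> has_vector_derivative vderiv \<phi> x) (at x)"
    "(vderiv \<phi> has_vector_derivative vderiv (vderiv \<phi>) x) (at x)"
    using d0 d1 by (simp_all add: vderiv_def flip: vector_derivative_works)
  show "continuous_on A \<phi>" "continuous_on A (vderiv \<phi>)" "continuous_on A (vderiv (vderiv \<phi>))"
    using d0 d1 d2 by (auto intro!: continuous_at_imp_continuous_on differentiable_imp_continuous_within)
qed

lemma vderiv_eq_0_off_closed:
  assumes "closed K" "\<And>x. x \<notin> K \<Longrightarrow> f x = 0" "x \<notin> K"
  shows "vderiv f x = 0"
proof -
  have "((\<lambda>_. 0) has_vector_derivative 0) (at x)" by simp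
  then have "(f has_vector_derivative 0) (at x)"
    by (rule has_vector_derivative_transform_within_open[where S="- K"]) (use assms in auto)
  then show ?thesis by (simp add: vderiv_def vector_derivative_at)
qed

lemma test_function_support:
  assumes "\<phi> \<in> test_functions"
  obtains c d where "0 < c" "\<And>x. x \<notin> {c..d} \<Longrightarrow> \<phi> x = 0" "\<And>x. x \<notin> {c..d} \<Longrightarrow> vderiv \<phi> x = 0"
    "\<And>x. x \<notin> {c..d} \<Longrightarrow> vderiv (vderiv \<phi>) x = 0"
proof -
  obtain K where K: "compact K" "K \<subseteq> {0<..}" "\<And>x. x \<notin> K \<Longrightarrow> \<phi> x = 0"
    using assms unfolding test_functions_def by blast
  have "\<exists>c d. 0 < c \<and> K \<subseteq> {c..d}"
  proof (cases "K = {}")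
    case False
    obtain c where "c \<in> K" "\<forall>t\<in>K. c \<le> t" using compact_attains_inf[OF K(1) False] by blast
    moreover obtain d where "\<forall>t\<in>K. t \<le> d" using compact_attains_sup[OF K(1) False] by blast
    ultimately show ?thesis using K(2) by (intro exI[of _ c] exI[of _ d]) auto
  qed (auto intro: exI[of _ 1])
  then obtain c d where c: "0 < c" "K \<subseteq> {c..d}" by blast
  have 0: "\<And>x. x \<notin> {c..d} \<Longrightarrow> \<phi> x = 0" using K(3) c(2) by blast
  have 1: "\<And>x. x \<notin> {c..d} \<Longrightarrow> vderiv \<phi> x = 0" by (rule vderiv_eq_0_off_closed[OF closed_atLeastAtMost 0])
  have 2: "\<And>x. x \<notin> {c..d} \<Longrightarrow> vderiv (vderiv \<phi>) x = 0" by (rule vderiv_eq_0_off_closed[OF closed_atLeastAtMost 1])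
  show thesis using that[OF c(1) 0 1 2] .
qed

lemma test_function_L2: "\<phi> \<in> test_functions \<Longrightarrow> \<phi> \<in> L2"
  by (metis compact_support_L2 test_function_derivs(3) test_function_support)

lemma log_cutoff_bounds: "0 \<le> log_cutoff m x" "log_cutoff m x \<le> 1"
  using cut_weight_bounds[of x m] by (auto simp: log_cutoff_def)

lemma log_cutoff_measurable [measurable]: "log_cutoff m \<in> borel_measurable borel"
  unfolding log_cutoff_def[abs_def] cut_weight_def by measurable

lemma log_cutoff_tendsto:
  assumes "x > 0"
  shows "(\<lambda>n. log_cutoff (real (Suc n)) x) \<longlonglongrightarrow> 1"
proof -
  have "(\<lambda>n. ln x / real (Suc n)) \<longlonglongrightarrow> 0"
    by (intro real_tendsto_divide_at_top[OF tendsto_const] filterlim_compose[OF filterlim_real_sequentially filterlim_Suc])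
  then have "(\<lambda>n. exp (1 - 1 / (1 - (ln x / real (Suc n))\<^sup>2))) \<longlonglongrightarrow> exp (1 - 1 / (1 - 0\<^sup>2))"
    by (intro tendsto_intros) auto
  then have "(\<lambda>n. exp (1 - 1 / cut_weight (real (Suc n)) x)) \<longlonglongrightarrow> 1"
    by (simp add: cut_weight_def)
  moreover have "\<forall>\<^sub>F n in sequentially. exp (1 - 1 / cut_weight (real (Suc n)) x) = log_cutoff (real (Suc n)) x"
  proof -
    obtain N :: nat where N: "\<bar>ln x\<bar> < real N" using reals_Archimedean2 by blast
    have "exp (1 - 1 / cut_weight (real (Suc n)) x) = log_cutoff (real (Suc n)) x" if "n \<ge> N" for n
    proof -
      have "- real (Suc n) < ln x" "ln x < real (Suc n)" using N that by auto
      then have "exp (- real (Suc n)) < exp (ln x)" "exp (ln x) < exp (real (Suc n))"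
        by (auto simp only: exp_less_cancel_iff)
      then show ?thesis using assms by (simp add: log_cutoff_def)
    qed
    then show ?thesis by (auto simp: eventually_sequentially)
  qed
  ultimately show ?thesis by (rule Lim_transform_eventually)
qed

abbreviation cutoff :: "real \<Rightarrow> real \<Rightarrow> complex" where
  "cutoff m \<equiv> \<lambda>x. of_real (log_cutoff m x)"

lemma cutoff_test_function: "m > 0 \<Longrightarrow> cutoff m \<in> test_functions"
  using log_cutoff_test_function[of m "\<lambda>_. 0" "\<lambda>_. 1"] by (simp add: cut_coeffs.const)

text \<open>The factor exp (-1/w) absorbs the double pole in w, and |ln x| < m cancels one of the
  two factors 1/m. What remains is of order 1/(m x).\<close>

lemma vderiv_cutoff_bound:
  assumes m: "m > 0"
  shows "cmod (vderiv (cutoff m) x) \<le> indicator {exp (- m)..exp m} x * (8 * exp 1 / (m * x))"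
proof -
  have d: "(cutoff m has_vector_derivative vderiv (cutoff m) x) (at x)" for x
    using test_function_derivs(1)[OF cutoff_test_function[OF m]] .
  show ?thesis
  proof (cases "x \<in> {exp (- m)<..<exp m}")
    case True
    have x0: "x > 0" and l: "\<bar>ln x\<bar> < m" using ln_bounds_in_exp_interval[OF True] .
    have w: "cut_weight m x > 0" using cut_weight_bounds(1)[OF True] .
    let ?w' = "- 2 * ln x / (m\<^sup>2 * x)"
    let ?d = "exp (1 - 1 / cut_weight m x) * (?w' / (cut_weight m x * cut_weight m x))"
    have "((\<lambda>x. 1 - 1 / cut_weight m x) has_real_derivative (0 - (0 * cut_weight m x - 1 * ?w') / (cut_weight m x * cut_weight m x))) (at x)"
      using w by (intro DERIV_diff DERIV_const DERIV_divide cut_weight_derivative x0 m) auto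
    then have "((\<lambda>x. 1 - 1 / cut_weight m x) has_real_derivative ?w' / (cut_weight m x * cut_weight m x)) (at x)"
      by simp
    from DERIV_fun_exp[OF this]
    have "((\<lambda>x. exp (1 - 1 / cut_weight m x)) has_vector_derivative ?d) (at x)"
      by (simp add: has_real_derivative_iff_has_vector_derivative)
    then have "(log_cutoff m has_vector_derivative ?d) (at x)"
      by (rule has_vector_derivative_transform_within_open[OF _ open_greaterThanLessThan True])
        (simp add: log_cutoff_def)
    then have "(cutoff m has_vector_derivative of_real ?d) (at x)"
      by (intro has_vector_derivative_of_real) (simp add: has_real_derivative_iff_has_vector_derivative)
    then have "vderiv (cutoff m) x = of_real ?d"
      by (simp only: vderiv_def vector_derivative_at)
    then have "cmod (vderiv (cutoff m) x) = \<bar>?d\<bar>" by (simp only: norm_of_real)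
    also have "\<bar>?d\<bar> = (exp (1 - 1 / cut_weight m x) * (1 / cut_weight m x)\<^sup>2) * (2 * \<bar>ln x\<bar> / (m\<^sup>2 * x))"
      using w x0 m by (simp add: abs_mult power2_eq_square)
    also have "\<dots> \<le> (4 * exp 1) * (2 * m / (m\<^sup>2 * x))"
    proof (rule mult_mono)
      have "(1 / cut_weight m x)\<^sup>2 \<le> 4 * exp (1 / cut_weight m x)"
        using power_le_exp[of "1 / cut_weight m x" 2] w by simp
      then have "exp (1 - 1 / cut_weight m x) * (1 / cut_weight m x)\<^sup>2
          \<le> exp (1 - 1 / cut_weight m x) * (4 * exp (1 / cut_weight m x))"
        by (intro mult_left_mono) auto
      also have "\<dots> = 4 * exp 1" by (simp flip: exp_add)
      finally show "exp (1 - 1 / cut_weight m x) * (1 / cut_weight m x)\<^sup>2 \<le> 4 * exp 1" .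
      show "2 * \<bar>ln x\<bar> / (m\<^sup>2 * x) \<le> 2 * m / (m\<^sup>2 * x)"
        using l m x0 by (intro divide_right_mono) auto
    qed (use x0 in auto)
    finally show ?thesis using True m x0 by (simp add: power2_eq_square)
  next
    case False
    \<comment> \<open>The cutoff is nonnegative and vanishes here, so this is a minimum and the
      derivative is zero. The end points of the interval are covered together with its
      exterior.\<close>
    have "DERIV (log_cutoff m) x :> Re (vderiv (cutoff m) x)"
      and im: "DERIV (\<lambda>_. 0) x :> Im (vderiv (cutoff m) x)"
      using d[of x] by (simp_all add: has_vector_derivative_complex_iff)
    moreover have "log_cutoff m x = 0" using False by (auto simp: log_cutoff_def)
    ultimately have "Re (vderiv (cutoff m) x) = 0"
      using DERIV_local_min[of "log_cutoff m" _ x 1] log_cutoff_bounds(1) by auto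
    moreover have "Im (vderiv (cutoff m) x) = 0" using DERIV_unique[OF im DERIV_const] .
    ultimately have "vderiv (cutoff m) x = 0" by (simp add: complex_eq_iff)
    moreover have "0 \<le> indicator {exp (- m)..exp m} x * (8 * exp 1 / (m * x))"
      using m less_le_trans[OF exp_gt_zero, of "- m" x] by (auto simp: indicator_def)
    ultimately show ?thesis by simp
  qed
qed

text \<open>The square of 1/(m x) against |g|^2 of order x leaves 1/(m^2 x), whose integral over
  [exp (- m), exp m] is 2/m. When |g|^2 is comparable with x near 0, a linearly rescaled cutoff
  would instead leave an energy of order one.\<close>

lemma vderiv_cutoff_times_tendsto_0:
  fixes g :: "real \<Rightarrow> complex"
  assumes g: "g \<in> borel_measurable half_line" and K: "\<And>x. x > 0 \<Longrightarrow> (cmod (g x))\<^sup>2 \<le> K * x"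
  shows "(\<lambda>x. vderiv (cutoff (real (Suc n))) x * g x) \<in> L2"
    "(\<lambda>n. abs_l2 (\<lambda>x. vderiv (cutoff (real (Suc n))) x * g x)) \<longlonglongrightarrow> 0"
proof -
  define C where "C = 64 * (exp 1)\<^sup>2 * K"
  have K0: "K \<ge> 0" using order_trans[OF zero_le_power2 K[of 1]] by simp
  have "(\<lambda>x. vderiv (cutoff m) x * g x) \<in> L2 \<and>
      (norm (abs_l2 (\<lambda>x. vderiv (cutoff m) x * g x)))\<^sup>2 \<le> 2 * C / m" if m: "m > 0" for m
  proof -
    let ?I = "{exp (- m)..exp m}"
    let ?w = "\<lambda>x. C / m\<^sup>2 * (1 / x * indicator ?I x)"
    have I0: "x > 0" if "x \<in> ?I" for x using that less_le_trans[OF exp_gt_zero, of "- m" x] by simp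
    have hb: "has_bochner_integral lborel (\<lambda>x. 1 / x * indicator ?I x) (ln (exp m) - ln (exp (- m)))"
    proof (rule has_bochner_integral_FTC_Icc_real)
      show "DERIV ln x :> 1 / x" if "exp (- m) \<le> x" "x \<le> exp m" for x
        using I0[of x] that by (auto intro!: derivative_eq_intros)
      show "isCont (\<lambda>x. 1 / x) x" if "exp (- m) \<le> x" "x \<le> exp m" for x
        using I0[of x] that by (intro continuous_intros) auto
    qed (use m in auto)
    have ind: "indicator {0<..} x *\<^sub>R (1 / x * indicator ?I x) = 1 / x * indicator ?I x" for x :: real
      using I0[of x] by (auto simp: indicator_def)
    have wi: "integrable half_line (\<lambda>x. 1 / x * indicator ?I x)"
      using hb unfolding integrable_half_line_iff ind by (simp add: has_bochner_integral_iff)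
    have wi': "integrable half_line ?w" by (intro Bochner_Integration.integrable_mult_right wi)
    have wI: "(LINT x|half_line. 1 / x * indicator ?I x) = 2 * m"
      using has_bochner_integral_integral_eq[OF hb] unfolding integral_half_line ind by simp
    have bound: "(cmod (vderiv (cutoff m) x * g x))\<^sup>2 \<le> ?w x" if x: "x > 0" for x
    proof -
      have "(cmod (vderiv (cutoff m) x * g x))\<^sup>2 = (cmod (vderiv (cutoff m) x))\<^sup>2 * (cmod (g x))\<^sup>2"
        by (simp add: norm_mult power_mult_distrib)
      also have "\<dots> \<le> (indicator ?I x * (8 * exp 1 / (m * x)))\<^sup>2 * (K * x)"
        by (intro mult_mono power_mono vderiv_cutoff_bound K m x) auto
      also have "\<dots> = ?w x"
        using x m by (simp add: C_def indicator_def power2_eq_square field_simps)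
      finally show ?thesis .
    qed
    have L: "(\<lambda>x. vderiv (cutoff m) x * g x) \<in> L2"
    proof (rule L2_dominated[OF _ _ bound])
      have "vderiv (cutoff m) \<in> borel_measurable half_line"
        by (rule measurable_half_line_continuous[OF test_function_derivs(4)[OF cutoff_test_function[OF m]]])
      with g show "(\<lambda>x. vderiv (cutoff m) x * g x) \<in> borel_measurable half_line" by measurable
      show "integrable half_line ?w" by (rule wi')
    qed
    have "(norm (abs_l2 (\<lambda>x. vderiv (cutoff m) x * g x)))\<^sup>2 \<le> (LINT x|half_line. ?w x)"
      unfolding norm_abs_l2_square[OF L]
      by (rule integral_mono_AE[OF L2_integrable[OF L]]) (use wi' bound in \<open>auto intro: AE_half_lineI\<close>)
    also have "\<dots> = 2 * C / m" using m unfolding integral_mult_right_zero wI by (simp add: power2_eq_square)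
    finally show ?thesis using L by blast
  qed
  note * = this[of "real (Suc n)" for n, simplified of_nat_0_less_iff zero_less_Suc simp_thms]
  show "(\<lambda>x. vderiv (cutoff (real (Suc n))) x * g x) \<in> L2" using * by blast
  have "(\<lambda>n. (norm (abs_l2 (\<lambda>x. vderiv (cutoff (real (Suc n))) x * g x)))\<^sup>2) \<longlonglongrightarrow> 0"
  proof (rule real_tendsto_sandwich[OF _ _ tendsto_const])
    show "(\<lambda>n. 2 * C / real (Suc n)) \<longlonglongrightarrow> 0"
      by (intro real_tendsto_divide_at_top[OF tendsto_const] filterlim_compose[OF filterlim_real_sequentially filterlim_Suc])
  qed (use * in auto)
  then show "(\<lambda>n. abs_l2 (\<lambda>x. vderiv (cutoff (real (Suc n))) x * g x)) \<longlonglongrightarrow> 0"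
    using tendsto_real_sqrt[of _ 0] by (fastforce simp: tendsto_norm_zero_iff)
qed

section \<open>The Bessel operator and its Gaussian solutions\<close>

locale bessel =
  fixes \<nu> :: real
  assumes \<nu>_nonneg: "\<nu> \<ge> 0"
begin

definition bessel_op :: "(real \<Rightarrow> complex) \<Rightarrow> real \<Rightarrow> complex" where
  "bessel_op \<phi> x = - vderiv (vderiv \<phi>) x + of_real ((\<nu>\<^sup>2 - 1/4) * (1 / x\<^sup>2)) * \<phi> x"

text \<open>
  The operator factors as \<open>A\<^sup>* A\<close> with \<open>A = d/dx - (\<nu> + 1/2) / x\<close>.
\<close>

definition ladder :: "(real \<Rightarrow> complex) \<Rightarrow> real \<Rightarrow> complex" where
  "ladder \<phi> x = vderiv \<phi> x - of_real ((\<nu> + 1/2) / x) * \<phi> x"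

lemma bessel_minimal_eq: "bessel_minimal \<nu> = {(\<phi>, bessel_op \<phi>) | \<phi>. \<phi> \<in> test_functions}"
  by (simp add: bessel_minimal_def bessel_op_def[abs_def])

lemma test_function_ops:
  assumes "\<phi> \<in> test_functions"
  obtains c d where "0 < c" "\<And>x. x \<notin> {c..d} \<Longrightarrow> \<phi> x = 0" "\<And>x. x \<notin> {c..d} \<Longrightarrow> vderiv \<phi> x = 0"
    "\<And>x. x \<notin> {c..d} \<Longrightarrow> ladder \<phi> x = 0"
    "\<And>x. x \<notin> {c..d} \<Longrightarrow> bessel_op \<phi> x = 0"
    "continuous_on {0<..} (ladder \<phi>)" "continuous_on {0<..} (bessel_op \<phi>)"
proof -
  obtain c d where *: "0 < c" "\<And>x. x \<notin> {c..d} \<Longrightarrow> \<phi> x = 0" "\<And>x. x \<notin> {c..d} \<Longrightarrow> vderiv \<phi> x = 0"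
    "\<And>x. x \<notin> {c..d} \<Longrightarrow> vderiv (vderiv \<phi>) x = 0" using test_function_support[OF assms] by blast
  note c = test_function_derivs(3-5)[OF assms]
  show thesis
  proof (rule that[OF *(1-3)])
    show "continuous_on {0<..} (ladder \<phi>)" unfolding ladder_def[abs_def]
      by (intro continuous_intros c) auto
    show "continuous_on {0<..} (bessel_op \<phi>)" unfolding bessel_op_def[abs_def]
      by (intro continuous_intros c) auto
  qed (use *(2-) in \<open>auto simp: ladder_def bessel_op_def\<close>)
qed

lemma ladder_L2: "\<phi> \<in> test_functions \<Longrightarrow> ladder \<phi> \<in> L2"
  and bessel_op_L2: "\<phi> \<in> test_functions \<Longrightarrow> bessel_op \<phi> \<in> L2"
  by (metis test_function_ops compact_support_L2)+

text \<open>Write A for \<open>ladder\<close> and G for A g. The integrands of the two differences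
  are the derivatives of - (A \<phi>) cnj g and of \<phi> cnj G, and both functions vanish off the
  support of \<phi>, so there are no boundary terms.\<close>

lemma integration_by_parts:
  assumes \<phi>: "\<phi> \<in> test_functions"
    and g: "\<And>x. x > 0 \<Longrightarrow> (g has_vector_derivative g1 x) (at x)"
      "\<And>x. x > 0 \<Longrightarrow> (g1 has_vector_derivative g2 x) (at x)" "continuous_on {0<..} g2"
  shows "l2_inner (bessel_op \<phi>) g = l2_inner (ladder \<phi>) (\<lambda>x. g1 x - of_real ((\<nu> + 1/2) / x) * g x)"
    "l2_inner (ladder \<phi>) (\<lambda>x. g1 x - of_real ((\<nu> + 1/2) / x) * g x) =
      l2_inner \<phi> (\<lambda>x. - g2 x + of_real ((\<nu>\<^sup>2 - 1/4) * (1 / x\<^sup>2)) * g x)"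
proof -
  define a where "a = \<nu> + 1/2"
  define G where "G x = g1 x - of_real (a / x) * g x" for x
  define L where "L x = - g2 x + of_real ((\<nu>\<^sup>2 - 1/4) * (1 / x\<^sup>2)) * g x" for x
  \<comment> \<open>The potential is a (a - 1) / x^2 for a = \<nu> + 1/2, the form in which the
    factorization is visible.\<close>
  have a: "(\<nu>\<^sup>2 - 1/4) * (1 / x\<^sup>2) = (a\<^sup>2 - a) * (1 / x * (1 / x))" for x
    by (simp add: a_def power2_eq_square algebra_simps)
  have bo: "bessel_op \<phi> x = - vderiv (vderiv \<phi>) x + of_real ((a\<^sup>2 - a) * (1 / x * (1 / x))) * \<phi> x"
    and La: "L x = - g2 x + of_real ((a\<^sup>2 - a) * (1 / x * (1 / x))) * g x"
    and la: "ladder \<phi> x = vderiv \<phi> x - of_real (a / x) * \<phi> x" for x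
    by (simp_all only: bessel_op_def L_def ladder_def a a_def)
  have cg: "continuous_on {0<..} g" "continuous_on {0<..} g1"
    using g(1,2) by (meson continuous_at_imp_continuous_on greaterThan_iff has_vector_derivative_continuous)+
  have cG: "continuous_on {0<..} G" "continuous_on {0<..} L"
    unfolding G_def L_def using cg g(3) by (auto intro!: continuous_intros)
  obtain c d where c: "0 < c" and z: "\<And>x. x \<notin> {c..d} \<Longrightarrow> \<phi> x = 0" "\<And>x. x \<notin> {c..d} \<Longrightarrow> vderiv \<phi> x = 0"
    "\<And>x. x \<notin> {c..d} \<Longrightarrow> ladder \<phi> x = 0" "\<And>x. x \<notin> {c..d} \<Longrightarrow> bessel_op \<phi> x = 0"
    and co: "continuous_on {0<..} (ladder \<phi>)" "continuous_on {0<..} (bessel_op \<phi>)"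
    using test_function_ops[OF \<phi>] by blast
  note d\<phi> = test_function_derivs[OF \<phi>]
  have int: "integrable half_line (\<lambda>x. u x * cnj (v x))"
    if "continuous_on {0<..} u" "continuous_on {0<..} v" "\<And>x. x \<notin> {c..d} \<Longrightarrow> u x = 0" for u v
    using that c by (intro compact_support_integrable[of _ c d] continuous_intros) auto
  have inv: "((\<lambda>x. complex_of_real (a / x)) has_vector_derivative of_real (- a * (1 / x * (1 / x)))) (at x)"
    if "x > 0" for x
    using that by (intro has_vector_derivative_of_real)
      (auto simp: has_real_derivative_iff_has_vector_derivative[symmetric] intro!: derivative_eq_intros)
  let ?f1 = "\<lambda>x. bessel_op \<phi> x * cnj (g x) - ladder \<phi> x * cnj (G x)"
  have "integral\<^sup>L half_line ?f1 = 0"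
  proof (rule integral_derivative_compact_support[where c=c and d=d])
    let ?F = "\<lambda>x. - (vderiv \<phi> x * cnj (g x)) + of_real (a / x) * (\<phi> x * cnj (g x))"
    show "(?F has_vector_derivative ?f1 x) (at x)" if x: "x > 0" for x
      by (rule has_vector_derivative_eq_rhs)
        (rule has_vector_derivative_add has_vector_derivative_minus has_vector_derivative_mult
          has_vector_derivative_cnj d\<phi> g inv x |
         simp add: G_def bo la algebra_simps power2_eq_square diff_divide_distrib)+
    show "continuous_on {0<..} ?f1" by (intro continuous_intros co cg cG)
  qed (use z c in auto)
  then show "l2_inner (bessel_op \<phi>) g = l2_inner (ladder \<phi>) (\<lambda>x. g1 x - of_real ((\<nu> + 1/2) / x) * g x)"
    unfolding l2_inner_def a_def[symmetric] G_def[symmetric]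
    by (subst (asm) Bochner_Integration.integral_diff) (auto intro!: int co cg cG z)
  let ?f2 = "\<lambda>x. ladder \<phi> x * cnj (G x) - \<phi> x * cnj (L x)"
  have "integral\<^sup>L half_line ?f2 = 0"
  proof (rule integral_derivative_compact_support[where c=c and d=d])
    let ?F = "\<lambda>x. \<phi> x * cnj (g1 x) + - (of_real (a / x) * (\<phi> x * cnj (g x)))"
    show "(?F has_vector_derivative ?f2 x) (at x)" if x: "x > 0" for x
      by (rule has_vector_derivative_eq_rhs)
        (rule has_vector_derivative_add has_vector_derivative_minus has_vector_derivative_mult
          has_vector_derivative_cnj d\<phi> g inv x |
         simp add: G_def La la algebra_simps power2_eq_square diff_divide_distrib)+
    show "continuous_on {0<..} ?f2" by (intro continuous_intros co d\<phi> cg cG)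
  qed (use z c in auto)
  then show "l2_inner (ladder \<phi>) (\<lambda>x. g1 x - of_real ((\<nu> + 1/2) / x) * g x) =
      l2_inner \<phi> (\<lambda>x. - g2 x + of_real ((\<nu>\<^sup>2 - 1/4) * (1 / x\<^sup>2)) * g x)"
    unfolding l2_inner_def a_def[symmetric] G_def[symmetric] L_def[symmetric]
    by (subst (asm) Bochner_Integration.integral_diff) (auto intro!: int co d\<phi> cg cG z)
qed

text \<open>For \<psi> = \<phi> this makes the quadratic form the squared norm of
  \<open>ladder \<phi>\<close>. Convergence in the form thus becomes convergence of the
  \<open>ladder\<close> values.\<close>

lemma test_function_form:
  assumes "\<phi> \<in> test_functions" "\<psi> \<in> test_functions"
  shows "l2_inner (bessel_op \<phi>) \<psi> = l2_inner (ladder \<phi>) (ladder \<psi>)"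
  using integration_by_parts(1)[OF assms(1) test_function_derivs(1,2,5)[OF assms(2)]]
  by (simp add: ladder_def[abs_def])

end

lemma vderiv_add_cmult:
  assumes "\<And>x. f differentiable (at x)" "\<And>x. g differentiable (at x)"
  shows "vderiv (\<lambda>x. f x + c * g x) = (\<lambda>x. vderiv f x + c * vderiv g x)"
proof
  fix x
  have "(f has_vector_derivative vderiv f x) (at x)" "(g has_vector_derivative vderiv g x) (at x)"
    using assms by (simp_all add: vderiv_def flip: vector_derivative_works)
  from has_vector_derivative_add[OF this(1) has_vector_derivative_mult_right[OF this(2)]]
  show "vderiv (\<lambda>x. f x + c * g x) x = vderiv f x + c * vderiv g x"
    by (simp add: vderiv_def vector_derivative_at)
qed

lemma test_functions_add_cmult:
  assumes f: "f \<in> test_functions" and g: "g \<in> test_functions"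
  shows "(\<lambda>x. f x + c * g x) \<in> test_functions"
proof -
  have df: "(vderiv ^^ n) f differentiable (at x)" and dg: "(vderiv ^^ n) g differentiable (at x)" for n x
    using f g by (simp_all add: test_functions_def)
  have eq: "(vderiv ^^ n) (\<lambda>x. f x + c * g x) = (\<lambda>x. (vderiv ^^ n) f x + c * (vderiv ^^ n) g x)" for n
    by (induction n) (simp_all add: vderiv_add_cmult df dg)
  have "(\<lambda>x. (vderiv ^^ n) f x + c * (vderiv ^^ n) g x) differentiable (at x)" for n x
    by (intro differentiable_add differentiable_mult differentiable_const df dg)
  moreover obtain K L where "compact K" "K \<subseteq> {0<..}" "\<And>x. x \<notin> K \<Longrightarrow> f x = 0"
    "compact L" "L \<subseteq> {0<..}" "\<And>x. x \<notin> L \<Longrightarrow> g x = 0"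
    using f g unfolding test_functions_def by blast
  then have "compact (K \<union> L) \<and> K \<union> L \<subseteq> {0<..} \<and> (\<forall>x. x \<notin> K \<union> L \<longrightarrow> f x + c * g x = 0)" by auto
  ultimately show ?thesis
    unfolding test_functions_def mem_Collect_eq eq by blast
qed

lemma zero_test_function: "(\<lambda>_. 0) \<in> test_functions"
proof -
  have "(vderiv ^^ n) (\<lambda>_. 0 :: complex) = (\<lambda>_. 0)" for n
    by (induction n) (auto simp: vderiv_def)
  then show ?thesis by (auto simp: test_functions_def intro: exI[of _ "{}"])
qed

lemma test_functions_cmult: "f \<in> test_functions \<Longrightarrow> (\<lambda>x. c * f x) \<in> test_functions"
  using test_functions_add_cmult[OF zero_test_function, of f c] by simp

text \<open>Difference quotients are what defines \<open>group_generator\<close>, what isometries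
  can be applied to, and what dominated convergence along sequences can handle.\<close>

lemma has_vector_derivative_iff_quotient:
  fixes F :: "real \<Rightarrow> 'a::real_normed_vector"
  shows "(F has_vector_derivative D) (at x) \<longleftrightarrow> ((\<lambda>h. (F (x + h) - F x) /\<^sub>R h) \<longlongrightarrow> D) (at 0)"
proof -
  have "norm (F (x + h) - F x - h *\<^sub>R D) / norm h = norm ((F (x + h) - F x) /\<^sub>R h - D)" if "h \<noteq> 0" for h
  proof -
    have "(F (x + h) - F x) /\<^sub>R h - D = (F (x + h) - F x - h *\<^sub>R D) /\<^sub>R h"
      using that by (simp add: scaleR_diff_right)
    then show ?thesis by (simp add: divide_inverse mult.commute)
  qed
  then have "(F has_vector_derivative D) (at x) \<longleftrightarrow>
      ((\<lambda>h. norm ((F (x + h) - F x) /\<^sub>R h - D)) \<longlongrightarrow> 0) (at 0)"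
    unfolding has_vector_derivative_def has_derivative_at
    by (auto simp: bounded_linear_scaleR_left intro!: Lim_cong_within elim!: Lim_transform_eventually simp: eventually_at_filter)
  then show ?thesis by (simp add: tendsto_norm_zero_iff LIM_zero_iff)
qed

section \<open>The Gaussian family: closed formulas, bounds and membership in the form
  domain\<close>

context bessel
begin

text \<open>
  With this normalization the evolution by time \<open>t\<close> is the translation \<open>p \<mapsto> p + 4 \<i> t\<close>. It stays in the
  half plane \<open>Re p > 0\<close>, so that the principal logarithm causes no branch problem.
\<close>

definition gauss :: "complex \<Rightarrow> real \<Rightarrow> complex" where
  "gauss p x = exp (- of_real (\<nu> + 1) * Ln p) * of_real (x powr (\<nu> + 1/2)) * exp (- of_real (x\<^sup>2) / p)"

text \<open>The value of \<open>ladder\<close> at \<open>gauss p\<close> on the half line: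
  differentiating the power of x gives exactly the term that \<open>ladder\<close> subtracts, and
  only the derivative of the exponential remains.\<close>

definition gauss_ladder :: "complex \<Rightarrow> real \<Rightarrow> complex" where
  "gauss_ladder p x = - 2 * of_real x / p * gauss p x"

text \<open>The value of the Bessel operator at \<open>gauss p\<close> on the half line;
  \<open>gauss_test_function_pairing\<close> is the weak form of this.\<close>

definition gauss_op :: "complex \<Rightarrow> real \<Rightarrow> complex" where
  "gauss_op p x = (4 * of_real (\<nu> + 1) / p - 4 * of_real (x\<^sup>2) / p\<^sup>2) * gauss p x"

lemma continuous_on_gauss: "continuous_on {0<..} (gauss p)"
  unfolding gauss_def by (cases "p = 0"; auto intro!: continuous_intros)

lemma gauss_measurable [measurable]: "gauss p \<in> borel_measurable half_line"
  "gauss_ladder p \<in> borel_measurable half_line" "gauss_op p \<in> borel_measurable half_line"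
proof -
  \<comment> \<open>At p = 0 both quotients are constantly 0 by the convention for division, so
    measurability holds for every parameter.\<close>
  have c: "continuous_on {0<..} (\<lambda>x::real. of_real x / p)" "continuous_on {0<..} (\<lambda>x::real. of_real (x\<^sup>2) / p\<^sup>2)"
    by (cases "p = 0"; auto intro!: continuous_intros)+
  note g = continuous_on_gauss
  show "gauss p \<in> borel_measurable half_line" by (rule measurable_half_line_continuous[OF g])
  have "continuous_on {0<..} (\<lambda>x. - 2 * (of_real x / p) * gauss p x)"
    by (intro continuous_intros g c)
  from measurable_half_line_continuous[OF this] show "gauss_ladder p \<in> borel_measurable half_line"
    by (simp add: gauss_ladder_def[abs_def])
  have "continuous_on {0<..} (\<lambda>x. (4 * of_real (\<nu> + 1) * (1 / p) - 4 * (of_real (x\<^sup>2) / p\<^sup>2)) * gauss p x)"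
    by (rule continuous_on_mult[OF continuous_on_diff[OF continuous_on_const continuous_on_mult_left[OF c(2)]] g])
  from measurable_half_line_continuous[OF this] show "gauss_op p \<in> borel_measurable half_line"
    by (simp add: gauss_op_def[abs_def])
qed

lemma cmod_gauss:
  assumes "Re p > 0"
  shows "cmod (gauss p x) = cmod p powr - (\<nu> + 1) * (x powr (\<nu> + 1/2) * exp (- (Re p / (cmod p)\<^sup>2) * x\<^sup>2))"
proof -
  have p: "p \<noteq> 0" using assms by auto
  have "Re (- of_real (x\<^sup>2) / p) = - (Re p / (cmod p)\<^sup>2) * x\<^sup>2"
    by (simp add: Re_divide cmod_power2 del: of_real_power)
  moreover have "Re (- of_real (\<nu> + 1) * Ln p) = - (\<nu> + 1) * ln (cmod p)"
    using p by simp
  moreover have "exp (- (\<nu> + 1) * ln (cmod p)) = cmod p powr - (\<nu> + 1)"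
    using p by (simp add: powr_def)
  ultimately show ?thesis
    by (simp only: gauss_def norm_mult norm_exp_eq_Re norm_of_real) (simp add: mult.assoc)
qed

text \<open>Uniform in p on a truncated half plane, as needed for dominated convergence in the
  parameter. The term \<open>0 * x\<close> puts the bound into the shape of
  \<open>gaussian_dominated_square\<close>.\<close>

lemma gauss_bound:
  assumes "0 < r" "r \<le> Re p" "cmod p \<le> K"
  shows "cmod (gauss p x) \<le> r powr - (\<nu> + 1) * (x powr (\<nu> + 1/2) * exp (0 * x - r / K\<^sup>2 * x\<^sup>2))"
proof -
  have p: "r \<le> cmod p" using assms complex_Re_le_cmod[of p] by linarith
  have "r / K\<^sup>2 \<le> Re p / (cmod p)\<^sup>2"
    using assms p by (intro frac_le power_mono) auto
  then have "r / K\<^sup>2 * x\<^sup>2 \<le> Re p / (cmod p)\<^sup>2 * x\<^sup>2"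
    by (rule mult_right_mono) simp
  moreover have "cmod p powr - (\<nu> + 1) \<le> r powr - (\<nu> + 1)"
    using assms p \<nu>_nonneg by (intro powr_mono2') auto
  ultimately show ?thesis
    using assms by (subst cmod_gauss) (auto intro!: mult_mono)
qed

lemma powers_le_exp: "x \<ge> 0 \<Longrightarrow> x \<le> exp x" "x \<ge> 0 \<Longrightarrow> x\<^sup>2 \<le> 2 * exp x" for x :: real
  subgoal using exp_ge_add_one_self[of x] by linarith
  subgoal using exp_lower_Taylor_quadratic[of x] by simp
  done

text \<open>The polynomial factors of \<open>gauss_ladder\<close> and \<open>gauss_op\<close> are
  absorbed into exp x, for which the linear coefficient in the quadratic bounds leaves room.\<close>

lemma gauss_poly_bound:
  assumes "0 < r" "r \<le> Re p" "cmod p \<le> K" "cmod c \<le> A * exp x"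
  shows "cmod (c * gauss p x) \<le>
    A * r powr - (\<nu> + 1) * (x powr (\<nu> + 1/2) * exp (1 * x - r / K\<^sup>2 * x\<^sup>2))"
proof -
  have "cmod (c * gauss p x) \<le> A * exp x * (r powr - (\<nu> + 1) * (x powr (\<nu> + 1/2) * exp (0 * x - r / K\<^sup>2 * x\<^sup>2)))"
    unfolding norm_mult using assms(4) order_trans[OF norm_ge_zero assms(4)]
    by (intro mult_mono gauss_bound assms) auto
  also have "\<dots> = A * r powr - (\<nu> + 1) * (x powr (\<nu> + 1/2) * exp (1 * x - r / K\<^sup>2 * x\<^sup>2))"
    by (simp add: exp_diff exp_minus field_simps)
  finally show ?thesis .
qed

lemma gauss_ladder_bound:
  assumes "0 < r" "r \<le> Re p" "cmod p \<le> K" "x > 0"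
  shows "cmod (gauss_ladder p x) \<le>
    2 / r * r powr - (\<nu> + 1) * (x powr (\<nu> + 1/2) * exp (1 * x - r / K\<^sup>2 * x\<^sup>2))"
  unfolding gauss_ladder_def
proof (rule gauss_poly_bound[OF assms(1-3)])
  have p: "r \<le> cmod p" using assms complex_Re_le_cmod[of p] by linarith
  have "cmod (- 2 * of_real x / p) = 2 * x / cmod p" using assms by (simp add: norm_divide norm_mult)
  also have "\<dots> \<le> 2 * exp x / r"
    using p assms powers_le_exp(1)[of x] by (intro frac_le) auto
  finally show "cmod (- 2 * of_real x / p) \<le> 2 / r * exp x" by simp
qed

lemma gauss_op_bound:
  assumes "0 < r" "r \<le> Re p" "cmod p \<le> K" "x > 0"
  shows "cmod (gauss_op p x) \<le>
    (4 * (\<nu> + 1) / r + 8 / r\<^sup>2) * r powr - (\<nu> + 1) * (x powr (\<nu> + 1/2) * exp (1 * x - r / K\<^sup>2 * x\<^sup>2))"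
  unfolding gauss_op_def
proof (rule gauss_poly_bound[OF assms(1-3)])
  have p: "r \<le> cmod p" using assms complex_Re_le_cmod[of p] by linarith
  have "cmod (4 * of_real (\<nu> + 1) / p) = 4 * (\<nu> + 1) / cmod p"
    using \<nu>_nonneg by (simp add: norm_divide norm_mult del: of_real_add)
  also have "\<dots> \<le> 4 * (\<nu> + 1) / r * 1"
    using p assms \<nu>_nonneg unfolding mult_1_right by (intro frac_le) auto
  also have "\<dots> \<le> 4 * (\<nu> + 1) / r * exp x"
    using assms \<nu>_nonneg by (intro mult_left_mono) auto
  finally have 1: "cmod (4 * of_real (\<nu> + 1) / p) \<le> 4 * (\<nu> + 1) / r * exp x" .
  have "cmod (4 * of_real (x\<^sup>2) / p\<^sup>2) = 4 * x\<^sup>2 / (cmod p)\<^sup>2"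
    by (simp add: norm_divide norm_mult norm_power)
  also have "\<dots> \<le> 4 * (2 * exp x) / r\<^sup>2"
    using p assms powers_le_exp(2)[of x] by (intro frac_le power_mono mult_left_mono) auto
  finally have 2: "cmod (4 * of_real (x\<^sup>2) / p\<^sup>2) \<le> 8 / r\<^sup>2 * exp x" by simp
  show "cmod (4 * of_real (\<nu> + 1) / p - 4 * of_real (x\<^sup>2) / p\<^sup>2) \<le> (4 * (\<nu> + 1) / r + 8 / r\<^sup>2) * exp x"
    using norm_triangle_ineq4[of "4 * of_real (\<nu> + 1) / p" "4 * of_real (x\<^sup>2) / p\<^sup>2"] 1 2
    by (simp only: distrib_right)
qed

lemma gauss_L2: "Re p > 0 \<Longrightarrow> gauss p \<in> L2"
  and gauss_ladder_L2: "Re p > 0 \<Longrightarrow> gauss_ladder p \<in> L2"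
  and gauss_op_L2: "Re p > 0 \<Longrightarrow> gauss_op p \<in> L2"
proof -
  assume p: "Re p > 0"
  then have "p \<noteq> 0" by auto
  with p have s: "Re p / (cmod p)\<^sup>2 > 0" and a: "\<nu> + 1/2 \<ge> 0" using \<nu>_nonneg by auto
  show "gauss p \<in> L2"
    by (rule gaussian_dominated_L2[OF gauss_measurable(1) a s gauss_bound[OF p order_refl order_refl]])
  show "gauss_ladder p \<in> L2"
    by (rule gaussian_dominated_L2[OF gauss_measurable(2) a s gauss_ladder_bound[OF p order_refl order_refl]])
  show "gauss_op p \<in> L2"
    by (rule gaussian_dominated_L2[OF gauss_measurable(3) a s gauss_op_bound[OF p order_refl order_refl]])
qed

text \<open>This is the Schroedinger equation: along the translation of p with velocity 4 i the time
  derivative is 4 i times - 1/4, that is, - i times \<open>gauss_op p\<close>.\<close>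

lemma gauss_has_field_derivative:
  assumes "Re p > 0"
  shows "((\<lambda>p. gauss p x) has_field_derivative (- gauss_op p x / 4)) (at p within A)"
proof -
  have p: "p \<notin> \<real>\<^sub>\<le>\<^sub>0" "p \<noteq> 0" using assms by (auto simp: complex_nonpos_Reals_iff)
  show ?thesis
    unfolding gauss_def gauss_op_def
    by (rule derivative_eq_intros p refl | use p in \<open>simp add: field_simps power2_eq_square\<close>)+
qed

lemma gauss_has_vector_derivative:
  assumes p: "Re p > 0" and "x > 0"
  shows "(gauss p has_vector_derivative (of_real (\<nu> + 1/2) * of_real (1 / x) - 2 * of_real x / p) * gauss p x) (at x)"
proof -
  have 1: "((\<lambda>x. x powr (\<nu> + 1/2)) has_real_derivative (\<nu> + 1/2) * (1 / x) * x powr (\<nu> + 1/2)) (at x)"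
  proof -
    have "x powr (\<nu> + 1/2 - 1) = 1 / x * x powr (\<nu> + 1/2)"
      using \<open>x > 0\<close> by (simp only: powr_diff) simp
    then show ?thesis
      using has_real_derivative_powr[OF \<open>x > 0\<close>, of "\<nu> + 1/2"] by simp
  qed
  have 2: "((\<lambda>x. complex_of_real (x\<^sup>2)) has_vector_derivative of_real (2 * x)) (at x)"
    by (intro has_vector_derivative_of_real) (auto intro!: derivative_eq_intros)
  have 3: "((\<lambda>x. exp (- of_real (x\<^sup>2) / p)) has_vector_derivative of_real (2 * x) * (- (1 / p) * exp (- of_real (x\<^sup>2) / p))) (at x)"
  proof -
    have "((\<lambda>z. exp (- z / p)) has_field_derivative - (1 / p) * exp (- of_real (x\<^sup>2) / p)) (at (of_real (x\<^sup>2)))"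
      using p by (auto intro!: derivative_eq_intros)
    from field_vector_diff_chain_at[OF 2 this] show ?thesis by (simp only: o_def)
  qed
  show ?thesis unfolding gauss_def
    by (rule has_vector_derivative_eq_rhs, (rule has_vector_derivative_mult has_vector_derivative_const
          has_vector_derivative_of_real 1 3)+) (simp add: algebra_simps diff_divide_distrib)
qed

text \<open>The growth condition of \<open>vderiv_cutoff_times_tendsto_0\<close>. Near 0 the square
  is of order x^(2 \<nu> + 1), which for \<nu> = 0 meets the condition with equality of
  orders.\<close>

lemma gauss_square_le:
  assumes "Re p > 0"
  obtains K where "\<And>x. x > 0 \<Longrightarrow> (cmod (gauss p x))\<^sup>2 \<le> K * x"
proof
  define s where "s = Re p / (cmod p)\<^sup>2"
  have "p \<noteq> 0" using assms by auto
  then have s: "s > 0" using assms by (simp add: s_def)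
  define C where "C = Re p powr - (\<nu> + 1)"
  fix x :: real assume x: "x > 0"
  have "(cmod (gauss p x))\<^sup>2 \<le> C\<^sup>2 * (x powr (2 * (\<nu> + 1/2)) * exp (2 * 0 * x - 2 * s * x\<^sup>2))"
    unfolding s_def C_def
    by (rule gaussian_dominated_square[OF x gauss_bound]) (use assms in auto)
  also have "x powr (2 * (\<nu> + 1/2)) = x powr (2 * \<nu>) * x"
    using x by (simp add: powr_add distrib_left)
  also have "C\<^sup>2 * (x powr (2 * \<nu>) * x * exp (2 * 0 * x - 2 * s * x\<^sup>2)) =
      C\<^sup>2 * (x powr (2 * \<nu>) * exp (0 * x - 2 * s * x\<^sup>2)) * x" by simp
  also have "\<dots> \<le> C\<^sup>2 * (exp ((2 * \<nu> + 0 + 1)\<^sup>2 / (4 * (2 * s))) * exp (- x)) * x"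
    using x s \<nu>_nonneg by (intro mult_right_mono mult_left_mono powr_exp_quadratic_le) auto
  also have "\<dots> \<le> C\<^sup>2 * (exp ((2 * \<nu> + 0 + 1)\<^sup>2 / (4 * (2 * s))) * 1) * x"
    using x by (intro mult_right_mono mult_left_mono) auto
  finally show "(cmod (gauss p x))\<^sup>2 \<le> (C\<^sup>2 * exp ((2 * \<nu> + 1)\<^sup>2 / (8 * s))) * x" by simp
qed

text \<open>The pointwise derivative is known, so it remains to dominate the difference quotients.
  The mean value inequality in p does this by a bound on \<open>gauss_op\<close> that is uniform
  over the parameters involved.\<close>

lemma has_vector_derivative_gauss_l2:
  assumes p: "Re p > 0"
  shows "((\<lambda>t. abs_l2 (gauss (p + 4 * \<i> * of_real t))) has_vector_derivative
    cscale (- \<i>) (abs_l2 (gauss_op p))) (at 0)"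
  unfolding has_vector_derivative_iff_quotient
proof (subst tendsto_at_iff_sequentially, intro allI impI)
  fix h :: "nat \<Rightarrow> real" assume h0: "\<forall>i. h i \<in> UNIV - {0}" and h: "h \<longlonglongrightarrow> 0"
  obtain K where K: "\<And>n. \<bar>h n\<bar> \<le> K"
    using convergent_imp_Bseq[OF convergentI[OF h]] unfolding Bseq_def by auto
  define r where "r = Re p"
  define L where "L = cmod p + 4 * K"
  have r: "r > 0" using p by (simp add: r_def)
  define q where "q n = p + 4 * \<i> * of_real (h n)" for n
  have q: "Re (q n) = r" for n by (simp add: q_def r_def)
  have "cmod (q n) \<le> L" for n
    using norm_triangle_ineq[of p "4 * \<i> * of_real (h n)"] K[of n] by (simp add: q_def L_def norm_mult)
  moreover have "cmod p \<le> L" using K[of 0] by (simp add: L_def)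
  \<comment> \<open>A convex set containing p and all q n, as the mean value inequality requires; it
    stays away from the boundary of the right half plane because the translation preserves Re
    p.\<close>
  moreover define S where "S = {z. r \<le> Re z} \<inter> cball 0 L"
  ultimately have S: "q n \<in> S" "p \<in> S" for n using q by (auto simp: r_def)
  have cS: "convex S" unfolding S_def by (intro convex_Int convex_halfspace_Re_ge convex_cball)
  define C where "C = (4 * (\<nu> + 1) / r + 8 / r\<^sup>2) * r powr - (\<nu> + 1)"
  define s where "s = r / L\<^sup>2"
  have L0: "L > 0" using S(2) r by (auto simp: S_def r_def) (metis \<open>cmod p \<le> L\<close> complex_Re_le_cmod le_less_trans less_le_trans not_less)
  define E where "E x = x powr (\<nu> + 1/2) * exp (1 * x - s * x\<^sup>2)" for x
  define D where "D n x = (gauss (q n) x - gauss p x) / of_real (h n)" for n x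
  have bound: "cmod (D n x) \<le> C * E x" if x: "x > 0" for n x
  proof -
    have "norm (gauss (q n) x - gauss p x) \<le> (C * E x / 4) * norm (q n - p)"
    proof (rule field_differentiable_bound[OF cS gauss_has_field_derivative _ S(1) S(2)])
      show "Re z > 0" if "z \<in> S" for z using that r by (auto simp: S_def)
      show "norm (- gauss_op z x / 4) \<le> C * E x / 4" if "z \<in> S" for z
        using gauss_op_bound[OF r, of z L x] that x by (auto simp: S_def C_def E_def s_def)
    qed
    also have "norm (q n - p) = 4 * \<bar>h n\<bar>" by (simp add: q_def norm_mult)
    finally show ?thesis using h0 by (simp add: D_def norm_divide divide_le_eq)
  qed
  have lim: "(\<lambda>n. D n x) \<longlonglongrightarrow> - \<i> * gauss_op p x" for x
  proof -
    have "((\<lambda>z. (gauss z x - gauss p x) / (z - p)) \<longlongrightarrow> - gauss_op p x / 4) (at p)"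
      using gauss_has_field_derivative[OF p] by (simp add: has_field_derivative_iff)
    moreover have "filterlim q (at p) sequentially"
      unfolding filterlim_at
    proof
      have "(\<lambda>n. p + 4 * \<i> * of_real (h n)) \<longlonglongrightarrow> p + 4 * \<i> * of_real 0" by (intro tendsto_intros h)
      then show "q \<longlonglongrightarrow> p" by (simp add: q_def[abs_def])
    qed (use h0 in \<open>auto simp: q_def\<close>)
    ultimately have "(\<lambda>n. (gauss (q n) x - gauss p x) / (q n - p)) \<longlonglongrightarrow> - gauss_op p x / 4"
      by (rule filterlim_compose)
    then have "(\<lambda>n. 4 * \<i> * ((gauss (q n) x - gauss p x) / (q n - p))) \<longlonglongrightarrow> 4 * \<i> * (- gauss_op p x / 4)"
      by (rule tendsto_mult[OF tendsto_const])
    moreover have "4 * \<i> * ((gauss (q n) x - gauss p x) / (q n - p)) = D n x" for n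
      using h0 by (simp add: D_def q_def field_simps)
    ultimately show ?thesis by simp
  qed
  have DL: "(\<lambda>n. abs_l2 (D n)) \<longlonglongrightarrow> abs_l2 (\<lambda>x. - \<i> * gauss_op p x)"
  proof (rule abs_l2_dominated_convergence(2))
    show "integrable half_line (\<lambda>x. C\<^sup>2 * (x powr (2 * (\<nu> + 1/2)) * exp (2 * 1 * x - 2 * s * x\<^sup>2)))"
      using r L0 \<nu>_nonneg by (intro Bochner_Integration.integrable_mult_right integrable_powr_exp_quadratic) (auto simp: s_def)
    show "(cmod (D n x))\<^sup>2 \<le> C\<^sup>2 * (x powr (2 * (\<nu> + 1/2)) * exp (2 * 1 * x - 2 * s * x\<^sup>2))" if "x > 0" for n x
      using gaussian_dominated_square[OF that bound[OF that, unfolded E_def]] .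
    show "D n \<in> borel_measurable half_line" for n unfolding D_def by measurable
    show "(\<lambda>x. - \<i> * gauss_op p x) \<in> borel_measurable half_line" by measurable
  qed (use lim in auto)
  have "abs_l2 (D n) = (abs_l2 (gauss (q n)) - abs_l2 (gauss p)) /\<^sub>R h n" for n
  proof -
    have "D n = (\<lambda>x. inverse (h n) *\<^sub>R (gauss (q n) x - gauss p x))"
      by (simp add: D_def fun_eq_iff scaleR_conv_of_real divide_inverse mult.commute)
    moreover have "gauss (q n) \<in> L2" "gauss p \<in> L2" using q r p by (auto intro!: gauss_L2)
    ultimately show ?thesis by (simp add: abs_l2_scaleR abs_l2_diff L2_diff)
  qed
  then show "((\<lambda>h. (abs_l2 (gauss (p + 4 * \<i> * of_real (0 + h))) - abs_l2 (gauss (p + 4 * \<i> * of_real 0))) /\<^sub>R h) \<circ> h)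
      \<longlonglongrightarrow> cscale (- \<i>) (abs_l2 (gauss_op p))"
    using DL unfolding abs_l2_cmult[OF gauss_op_L2[OF p]] by (simp add: o_def q_def)
qed

text \<open>The domain of this relation is the form domain of \<open>bessel_minimal \<nu>\<close>.\<close>

definition form_graph :: "(l2 \<times> l2) set" where
  "form_graph = closure {(abs_l2 \<phi>, abs_l2 (ladder \<phi>)) | \<phi>. \<phi> \<in> test_functions}"

lemma form_graph_iff:
  "(f, b) \<in> form_graph \<longleftrightarrow> (\<exists>\<phi>. (\<forall>n::nat. \<phi> n \<in> test_functions) \<and>
     (\<lambda>n. abs_l2 (\<phi> n)) \<longlonglongrightarrow> f \<and> (\<lambda>n. abs_l2 (ladder (\<phi> n))) \<longlonglongrightarrow> b)" (is "?L \<longleftrightarrow> ?R")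
proof
  assume ?L
  then obtain u where u: "\<And>n. u n \<in> {(abs_l2 \<phi>, abs_l2 (ladder \<phi>)) | \<phi>. \<phi> \<in> test_functions}" "u \<longlonglongrightarrow> (f, b)"
    unfolding form_graph_def closure_sequential by blast
  then have "\<exists>\<phi>. \<phi> \<in> test_functions \<and> u n = (abs_l2 \<phi>, abs_l2 (ladder \<phi>))" for n by blast
  then obtain \<phi> where "\<And>n. \<phi> n \<in> test_functions" "\<And>n. u n = (abs_l2 (\<phi> n), abs_l2 (ladder (\<phi> n)))"
    by metis
  then show ?R using tendsto_fst[OF u(2)] tendsto_snd[OF u(2)] by auto
next
  assume ?R
  then obtain \<phi> where "\<And>n. \<phi> n \<in> test_functions" "(\<lambda>n. abs_l2 (\<phi> n)) \<longlonglongrightarrow> f"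
    "(\<lambda>n. abs_l2 (ladder (\<phi> n))) \<longlonglongrightarrow> b" by blast
  then show ?L unfolding form_graph_def closure_sequential
    by (intro exI[of _ "\<lambda>n. (abs_l2 (\<phi> n), abs_l2 (ladder (\<phi> n)))"]) (auto intro: tendsto_Pair)
qed

lemma form_graph_form:
  assumes "(f, b) \<in> form_graph" "\<phi> \<in> test_functions"
  shows "cinner (abs_l2 (bessel_op \<phi>)) f = cinner (abs_l2 (ladder \<phi>)) b"
proof -
  obtain \<psi> where \<psi>: "\<And>n. \<psi> n \<in> test_functions" "(\<lambda>n. abs_l2 (\<psi> n)) \<longlonglongrightarrow> f"
    "(\<lambda>n. abs_l2 (ladder (\<psi> n))) \<longlonglongrightarrow> b" using assms(1) unfolding form_graph_iff by blast
  have eq: "cinner (abs_l2 (bessel_op \<phi>)) (abs_l2 (\<psi> n)) = cinner (abs_l2 (ladder \<phi>)) (abs_l2 (ladder (\<psi> n)))" for n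
    using \<psi>(1)[of n] assms(2)
    by (simp add: cinner_abs_l2 test_function_L2 ladder_L2 bessel_op_L2 test_function_form)
  show ?thesis
    using tendsto_cinner[OF tendsto_const[of "abs_l2 (bessel_op \<phi>)"] \<psi>(2)]
      tendsto_cinner[OF tendsto_const[of "abs_l2 (ladder \<phi>)"] \<psi>(3)]
    unfolding eq by (rule LIMSEQ_unique)
qed

lemma form_graph_add_cscale:
  assumes "(f, b) \<in> form_graph" "(g, d) \<in> form_graph"
  shows "(f + cscale c g, b + cscale c d) \<in> form_graph"
proof -
  obtain \<phi> where \<phi>: "\<And>n. \<phi> n \<in> test_functions" "(\<lambda>n. abs_l2 (\<phi> n)) \<longlonglongrightarrow> f"
    "(\<lambda>n. abs_l2 (ladder (\<phi> n))) \<longlonglongrightarrow> b" using assms(1) unfolding form_graph_iff by blast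
  obtain \<psi> where \<psi>: "\<And>n. \<psi> n \<in> test_functions" "(\<lambda>n. abs_l2 (\<psi> n)) \<longlonglongrightarrow> g"
    "(\<lambda>n. abs_l2 (ladder (\<psi> n))) \<longlonglongrightarrow> d" using assms(2) unfolding form_graph_iff by blast
  let ?\<chi> = "\<lambda>n x. \<phi> n x + c * \<psi> n x"
  have "abs_l2 (?\<chi> n) = abs_l2 (\<phi> n) + cscale c (abs_l2 (\<psi> n))" for n
    using \<phi>(1)[of n] \<psi>(1)[of n] by (simp add: abs_l2_add abs_l2_cmult test_function_L2 L2_cmult)
  moreover have "abs_l2 (ladder (?\<chi> n)) = abs_l2 (ladder (\<phi> n)) + cscale c (abs_l2 (ladder (\<psi> n)))" for n
  proof -
    have "f differentiable (at x)" if "f \<in> test_functions" for f x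
      using that by (auto simp: test_functions_def dest: spec[of _ "0::nat"])
    then have v: "vderiv (?\<chi> n) = (\<lambda>x. vderiv (\<phi> n) x + c * vderiv (\<psi> n) x)"
      using \<phi>(1)[of n] \<psi>(1)[of n] by (intro vderiv_add_cmult)
    have "u + c * v - k * (a + c * b) = (u - k * a) + c * (v - k * b)" for u v k a b :: complex
      by (simp add: algebra_simps)
    then have "ladder (?\<chi> n) = (\<lambda>x. ladder (\<phi> n) x + c * ladder (\<psi> n) x)"
      unfolding ladder_def[abs_def] v by blast
    then show ?thesis
      using \<phi>(1)[of n] \<psi>(1)[of n] by (simp add: abs_l2_add abs_l2_cmult ladder_L2 L2_cmult)
  qed
  ultimately show ?thesis
    unfolding form_graph_iff
    using tendsto_add[OF \<phi>(2) tendsto_cscale[OF \<psi>(2), of c]] tendsto_add[OF \<phi>(3) tendsto_cscale[OF \<psi>(3), of c]]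
    by (intro exI[of _ ?\<chi>]) (simp add: test_functions_add_cmult \<phi>(1) \<psi>(1))
qed

lemma cutoff_gauss_test_function:
  assumes "m > 0" "Re p > 0" shows "(\<lambda>x. cutoff m x * gauss p x) \<in> test_functions"
proof (rule log_cutoff_test_function[OF assms(1) _ gauss_has_vector_derivative[OF assms(2)]])
  have "(\<lambda>x. (of_real (\<nu> + 1/2) * of_real (1 / x) + of_real x * (- 2 / p)) * gauss p x) \<in> cut_coeffs m (gauss p)"
    by (intro cut_coeffs.intros)
  then show "(\<lambda>x. (of_real (\<nu> + 1/2) * of_real (1 / x) - 2 * of_real x / p) * gauss p x) \<in> cut_coeffs m (gauss p)"
    by (simp add: mult.commute)
qed

lemma cutoff_times_tendsto:
  assumes "g \<in> L2"
  shows "(\<lambda>n. abs_l2 (\<lambda>x. cutoff (real (Suc n)) x * g x)) \<longlonglongrightarrow> abs_l2 g"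
    "(\<lambda>x. cutoff m x * g x) \<in> L2"
proof -
  have [measurable]: "g \<in> borel_measurable half_line" by (rule L2_measurable[OF assms])
  have [measurable]: "log_cutoff m \<in> borel_measurable half_line" for m
    by (rule borel_measurable_half_line) measurable
  have b: "(cmod (cutoff m x * g x))\<^sup>2 \<le> (cmod (g x))\<^sup>2" for m x
    using mult_left_le_one_le[of "cmod (g x)" "log_cutoff m x"] log_cutoff_bounds[of m x]
    by (intro power_mono) (auto simp: norm_mult)
  show "(\<lambda>n. abs_l2 (\<lambda>x. cutoff (real (Suc n)) x * g x)) \<longlonglongrightarrow> abs_l2 g"
  proof (rule abs_l2_dominated_convergence(2)[OF _ _ L2_integrable[OF assms] b])
    have "(\<lambda>n. cutoff (real (Suc n)) x * g x) \<longlonglongrightarrow> of_real 1 * g x" if "x > 0" for x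
      by (intro tendsto_intros log_cutoff_tendsto that)
    then show "AE x in half_line. (\<lambda>n. cutoff (real (Suc n)) x * g x) \<longlonglongrightarrow> g x"
      by (intro AE_half_lineI) simp
  qed measurable
  show "(\<lambda>x. cutoff m x * g x) \<in> L2"
    by (rule L2_dominated[OF _ L2_integrable[OF assms] b]) measurable
qed

text \<open>By the product rule, \<open>ladder\<close> of the cut Gaussian is the cut
  \<open>gauss_ladder p\<close> plus the derivative of the cutoff times \<open>gauss p\<close>. The
  second term tends to 0 in norm because the cutoffs are logarithmic.\<close>

lemma gauss_form_graph:
  assumes p: "Re p > 0"
  shows "(abs_l2 (gauss p), abs_l2 (gauss_ladder p)) \<in> form_graph"
proof -
  let ?c = "\<lambda>n. cutoff (real (Suc n))"
  let ?\<phi> = "\<lambda>n x. ?c n x * gauss p x"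
  obtain K where K: "\<And>x. x > 0 \<Longrightarrow> (cmod (gauss p x))\<^sup>2 \<le> K * x" using gauss_square_le[OF p] by blast
  note v = vderiv_cutoff_times_tendsto_0[OF gauss_measurable(1) K]
  have "abs_l2 (ladder (?\<phi> n)) = abs_l2 (\<lambda>x. vderiv (?c n) x * gauss p x) + abs_l2 (\<lambda>x. ?c n x * gauss_ladder p x)" for n
  proof -
    have "(?\<phi> n has_vector_derivative ?c n x * ((of_real (\<nu> + 1/2) * of_real (1 / x) - 2 * of_real x / p) * gauss p x) + vderiv (?c n) x * gauss p x) (at x)"
      if "x > 0" for x
      by (intro has_vector_derivative_mult gauss_has_vector_derivative that p
          test_function_derivs(1)[OF cutoff_test_function]) simp
    from vector_derivative_at[OF this]
    have vd: "vderiv (?\<phi> n) x = ?c n x * ((of_real (\<nu> + 1/2) * of_real (1 / x) - 2 * of_real x / p) * gauss p x) + vderiv (?c n) x * gauss p x"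
      if "x > 0" for x using that by (simp only: vderiv_def)
    have k: "complex_of_real ((\<nu> + 1/2) / x) = of_real (\<nu> + 1/2) * of_real (1 / x)" for x
      by (simp flip: of_real_mult)
    have "c * ((k - 2 * y / p) * g) + d * g - k * (c * g) = d * g + c * (- 2 * y / p * g)" for c k y g d :: complex
      by (simp add: algebra_simps)
    then have e: "ladder (?\<phi> n) x = vderiv (?c n) x * gauss p x + ?c n x * gauss_ladder p x" if "x > 0" for x
      unfolding ladder_def vd[OF that] gauss_ladder_def k by blast
    have "(\<lambda>x. vderiv (?c n) x * gauss p x + ?c n x * gauss_ladder p x) \<in> L2"
      by (intro L2_add v cutoff_times_tendsto(2) gauss_ladder_L2 p)
    note abs_l2_eqI(2)[OF this e[symmetric] L2_measurable[OF ladder_L2[OF cutoff_gauss_test_function[OF _ p]]]]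
    then have "abs_l2 (ladder (?\<phi> n)) = abs_l2 (\<lambda>x. vderiv (?c n) x * gauss p x + ?c n x * gauss_ladder p x)"
      by simp
    also have "\<dots> = abs_l2 (\<lambda>x. vderiv (?c n) x * gauss p x) + abs_l2 (\<lambda>x. ?c n x * gauss_ladder p x)"
      by (intro abs_l2_add v cutoff_times_tendsto(2) gauss_ladder_L2 p)
    finally show ?thesis .
  qed
  then have "(\<lambda>n. abs_l2 (ladder (?\<phi> n))) \<longlonglongrightarrow> 0 + abs_l2 (gauss_ladder p)"
    using tendsto_add[OF v(2) cutoff_times_tendsto(1)[OF gauss_ladder_L2[OF p]]] by simp
  then show ?thesis
    unfolding form_graph_iff using cutoff_times_tendsto(1)[OF gauss_L2[OF p]]
    by (intro exI[of _ ?\<phi>]) (auto intro!: cutoff_gauss_test_function p)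
qed

text \<open>The integration by parts moves both derivatives onto the Gaussian, whose first and
  second derivatives are explicit; boundary terms are excluded by the support of \<phi>.\<close>

lemma gauss_test_function_pairing:
  assumes p: "Re p > 0" and \<phi>: "\<phi> \<in> test_functions"
  shows "cinner (abs_l2 (ladder \<phi>)) (abs_l2 (gauss_ladder p)) = cinner (abs_l2 \<phi>) (abs_l2 (gauss_op p))"
proof -
  let ?a = "complex_of_real (\<nu> + 1/2)"
  let ?u = "\<lambda>x. ?a * complex_of_real (1 / x) - 2 * of_real x / p"
  let ?g1 = "\<lambda>x. ?u x * gauss p x"
  let ?g2 = "\<lambda>x. ?u x * (?u x * gauss p x) + (?a * of_real (- (1 / x * (1 / x))) - 2 / p) * gauss p x"
  have pn: "p \<noteq> 0" using p by auto
  have d2: "(?g1 has_vector_derivative ?g2 x) (at x)" if x: "x > 0" for x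
  proof (rule has_vector_derivative_mult[OF _ gauss_has_vector_derivative[OF p x]])
    have "((\<lambda>x. 1 / x) has_real_derivative - (1 / x * (1 / x))) (at x)"
      using x by (auto intro!: derivative_eq_intros)
    then have "((\<lambda>x. complex_of_real (1 / x)) has_vector_derivative of_real (- (1 / x * (1 / x)))) (at x)"
      by (rule has_vector_derivative_of_real)
    moreover have "((\<lambda>x. 2 * complex_of_real x / p) has_vector_derivative 2 / p) (at x)"
      using has_vector_derivative_mult_right[OF has_vector_derivative_of_real[OF DERIV_ident], of "2 / p"] by simp
    ultimately show "(?u has_vector_derivative ?a * of_real (- (1 / x * (1 / x))) - 2 / p) (at x)"
      by (intro has_vector_derivative_diff has_vector_derivative_mult_right)
  qed
  note c = continuous_on_gauss
  have c2: "continuous_on {0<..} ?g2" using pn by (intro continuous_intros c) auto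
  have e1: "?g1 x - of_real ((\<nu> + 1/2) / x) * gauss p x = gauss_ladder p x" for x
    by (simp add: gauss_ladder_def algebra_simps add_divide_distrib)
  \<comment> \<open>With a = \<nu> + 1/2 the terms in 1/x^2 cancel, since the potential is (a^2 -
    a)/x^2. The constant term is (4 a + 2)/p = 4 (\<nu> + 1)/p.\<close>
  have e2: "- ?g2 x + of_real ((\<nu>\<^sup>2 - 1/4) * (1 / x\<^sup>2)) * gauss p x = gauss_op p x" if x: "x > 0" for x
  proof -
    have "- (?u x * ?u x) - (?a * of_real (- (1 / x * (1 / x))) - 2 / p) + of_real ((\<nu>\<^sup>2 - 1/4) * (1 / x\<^sup>2))
        = 4 * of_real (\<nu> + 1) / p - 4 * of_real (x\<^sup>2) / p\<^sup>2"
      using x pn by (simp add: power2_eq_square field_simps)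
    moreover have "- (u * (u * g) + d * g) + w * g = (- (u * u) - d + w) * g" for u d w g :: complex
      by (simp add: algebra_simps)
    ultimately show ?thesis by (simp only: gauss_op_def)
  qed
  have "l2_inner (ladder \<phi>) (gauss_ladder p) = l2_inner \<phi> (\<lambda>x. - ?g2 x + of_real ((\<nu>\<^sup>2 - 1/4) * (1 / x\<^sup>2)) * gauss p x)"
    using integration_by_parts(2)[OF \<phi> gauss_has_vector_derivative[OF p] d2 c2] unfolding e1 .
  also have "\<dots> = l2_inner \<phi> (gauss_op p)"
    unfolding l2_inner_def
  proof (rule Bochner_Integration.integral_cong[OF refl])
    fix x assume "x \<in> space half_line"
    then have "x > 0" by (simp add: space_restrict_space)
    then show "\<phi> x * cnj (- ?g2 x + of_real ((\<nu>\<^sup>2 - 1/4) * (1 / x\<^sup>2)) * gauss p x) = \<phi> x * cnj (gauss_op p x)"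
      by (simp only: e2)
  qed
  finally show ?thesis
    using \<phi> p by (simp add: cinner_abs_l2 ladder_L2 gauss_ladder_L2 test_function_L2 gauss_op_L2)
qed

end

section \<open>Strongly continuous groups of isometries\<close>

lemma tendsto_if_norm_diff_less_inverse:
  fixes f :: "'a::real_normed_vector"
  assumes "\<And>n. norm (f - g n) < inverse (real (Suc n))"
  shows "g \<longlonglongrightarrow> f"
proof -
  have "(\<lambda>n. f - g n) \<longlonglongrightarrow> 0"
    by (rule Lim_null_comparison[OF _ LIMSEQ_inverse_real_of_nat])
      (use assms in \<open>auto simp del: of_nat_Suc intro!: always_eventually less_imp_le\<close>)
  from tendsto_diff[OF tendsto_const[of f] this] show ?thesis by simp
qed

lemma norm_diff_square_orthogonal:
  "inner a b = 0 \<Longrightarrow> (norm (a - b))\<^sup>2 = (norm a)\<^sup>2 + (norm b)\<^sup>2"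
  by (simp add: power2_norm_eq_inner inner_diff inner_commute)

text \<open>Both the evolution built from Gaussians and the group selected by the choice operator
  become instances. Only real linearity is recorded, in keeping with the real inner product; complex
  linearity is established where \<open>unitary_group\<close> asks for it.\<close>

locale isometry_group =
  fixes U :: "real \<Rightarrow> 'a::real_inner \<Rightarrow> 'a"
  assumes U_add: "U t (f + g) = U t f + U t g"
    and U_scaleR: "U t (r *\<^sub>R f) = r *\<^sub>R U t f"
    and norm_U: "norm (U t f) = norm f"
    and U_0: "U 0 f = f"
    and U_plus: "U (s + t) f = U s (U t f)"
    and U_continuous_0: "((\<lambda>t. U t f) \<longlongrightarrow> f) (at 0)"
begin

lemma bounded_linear_U: "bounded_linear (U t)"
  by (rule bounded_linear_intro[where K=1]) (auto simp: U_add U_scaleR norm_U)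

lemmas U_diff = bounded_linear.linear[OF bounded_linear_U, THEN linear_diff]
lemmas tendsto_U = bounded_linear.tendsto[OF bounded_linear_U]

lemma U_minus_cancel [simp]: "U (- t) (U t f) = f" "U t (U (- t) f) = f"
  using U_plus[of "- t" t f] U_plus[of t "- t" f] by (simp_all add: U_0)

lemma inner_U: "inner (U t f) (U t g) = inner f g"
proof -
  have "(norm (f + g))\<^sup>2 = (norm (U t f + U t g))\<^sup>2" by (simp add: norm_U flip: U_add)
  then show ?thesis
    by (simp add: power2_norm_eq_inner inner_add inner_commute)
      (simp add: norm_U flip: power2_norm_eq_inner)
qed

lemma inner_U_left: "inner (U t f) g = inner f (U (- t) g)"
  using inner_U[of t f "U (- t) g"] by simp

definition generates :: "'a \<Rightarrow> 'a \<Rightarrow> bool" where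
  "generates f k \<longleftrightarrow> ((\<lambda>t. U t f) has_vector_derivative k) (at 0)"

lemma generates_at:
  assumes "generates f k"
  shows "((\<lambda>t. U t f) has_vector_derivative U t k) (at t)"
proof -
  have "((\<lambda>h. U t ((U (0 + h) f - U 0 f) /\<^sub>R h)) \<longlongrightarrow> U t k) (at 0)"
    using assms unfolding generates_def has_vector_derivative_iff_quotient by (rule tendsto_U)
  moreover have "U t ((U (0 + h) f - U 0 f) /\<^sub>R h) = (U (t + h) f - U t f) /\<^sub>R h" for h
    by (simp add: U_scaleR U_diff U_0 U_plus)
  ultimately show ?thesis unfolding has_vector_derivative_iff_quotient by simp
qed

lemma generates_diff: "generates f k \<Longrightarrow> generates g l \<Longrightarrow> generates (f - g) (k - l)"
  unfolding generates_def U_diff by (rule has_vector_derivative_diff)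

text \<open>The inner product of two orbits is constant in time, and the left side is its derivative
  at 0.\<close>

lemma generates_skew:
  assumes "generates f k" "generates g l"
  shows "inner k g + inner f l = 0"
proof -
  have "((\<lambda>t. inner (U t f) (U t g)) has_derivative
      (\<lambda>h. inner (U 0 f) (h *\<^sub>R l) + inner (h *\<^sub>R k) (U 0 g))) (at 0)"
    using assms unfolding generates_def has_vector_derivative_def by (rule has_derivative_inner)
  then have "((\<lambda>h. 0) :: real \<Rightarrow> real) = (\<lambda>h. inner f (h *\<^sub>R l) + inner (h *\<^sub>R k) g)"
    unfolding inner_U U_0 using has_derivative_unique[OF has_derivative_const] by blast
  from fun_cong[OF this, of 1] show ?thesis by simp
qed

text \<open>Uniqueness of strong solutions: \<open>U (- t) (w t)\<close> has derivative zero.\<close>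

lemma solution_unique:
  assumes w: "\<And>t. (w has_vector_derivative D t) (at t)" and D: "\<And>t. generates (w t) (D t)"
  shows "U t (w 0) = w t"
proof -
  have "((\<lambda>t. U (- t) (w t)) has_vector_derivative 0) (at t)" for t
    unfolding has_vector_derivative_iff_quotient
  proof (rule Lim_null_comparison)
    \<comment> \<open>The difference quotients of w and of the orbit that starts at w t both tend to
      D t. Since the group acts by isometries, the quotient to be estimated has the same norm as
      their difference.\<close>
    let ?e = "\<lambda>h. (w (t + h) - w t) /\<^sub>R h - (U h (w t) - w t) /\<^sub>R h"
    have "((\<lambda>h. (U (0 + h) (w t) - U 0 (w t)) /\<^sub>R h) \<longlongrightarrow> D t) (at 0)"
      using D[of t] unfolding generates_def has_vector_derivative_iff_quotient .
    then have "(?e \<longlongrightarrow> D t - D t) (at 0)"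
      using w[of t] unfolding has_vector_derivative_iff_quotient by (intro tendsto_diff) (auto simp: U_0)
    then show "((\<lambda>h. norm (?e h)) \<longlongrightarrow> 0) (at 0)" by (simp add: tendsto_norm_zero)
    have "norm ((U (- (t + h)) (w (t + h)) - U (- t) (w t)) /\<^sub>R h) = norm (?e h)" for h
    proof -
      have "U (- (t + h)) g = U (- t) (U (- h) g)" for g using U_plus[of "- t" "- h" g] by simp
      moreover have "?e h = (w (t + h) - U h (w t)) /\<^sub>R h"
        unfolding scaleR_diff_right[symmetric] by simp
      ultimately have "(U (- (t + h)) (w (t + h)) - U (- t) (w t)) /\<^sub>R h = U (- t) (U (- h) (?e h))"
        by (simp only: U_diff U_scaleR U_minus_cancel)
      then show ?thesis by (simp only: norm_U)
    qed
    then show "\<forall>\<^sub>F h in at 0. norm ((U (- (t + h)) (w (t + h)) - U (- t) (w t)) /\<^sub>R h) \<le> norm (?e h)" by simp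
  qed
  then obtain c where c: "\<And>t. U (- t) (w t) = c"
    by (rule has_vector_derivative_zero_constant[OF convex_UNIV]) auto
  then have "U (- t) (w t) = U (- 0) (w 0)" by (simp only: c)
  then have "U t (U (- t) (w t)) = U t (w 0)" by (simp add: U_0)
  then show ?thesis by simp
qed

end

text \<open>S is the graph of the generator on a dense subspace that the group leaves invariant. The
  invariance is what makes this subspace a core, as \<open>core_approximates\<close> shows.\<close>

locale group_with_core = isometry_group U for U :: "real \<Rightarrow> 'a::real_inner \<Rightarrow> 'a" +
  fixes S :: "('a \<times> 'a) set"
  assumes core_generates: "(g, l) \<in> S \<Longrightarrow> generates g l"
    and core_U: "(g, l) \<in> S \<Longrightarrow> (U t g, U t l) \<in> S"
    and core_subspace: "subspace S"
    and core_dense: "e > 0 \<Longrightarrow> \<exists>(g, l)\<in>S. norm (f - g) < e"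
begin

text \<open>For g in the core, inner (U t f - f - t h) g has derivative inner (U t h - h) g, which
  is small relative to the norm of g for small t. The resulting bound depends on g only through its
  norm, so density turns it into a bound for the norm of U t f - f - t h.\<close>

lemma weakly_generates:
  assumes weak: "\<And>g l. (g, l) \<in> S \<Longrightarrow> inner h g = - inner f l"
  shows "generates f h"
  unfolding generates_def has_vector_derivative_iff_quotient
proof (rule LIM_I)
  fix r :: real assume r: "r > 0"
  from LIM_D[OF U_continuous_0[of h], of "r/2"] r
  obtain s where s: "s > 0" "\<And>t. t \<noteq> 0 \<Longrightarrow> \<bar>t\<bar> < s \<Longrightarrow> norm (U t h - h) < r/2" by auto
  have s': "norm (U t h - h) \<le> r/2" if "\<bar>t\<bar> < s" for t
    using s(2)[of t] that r by (cases "t = 0") (auto simp: U_0)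
  have est: "\<bar>inner (U t f - f - t *\<^sub>R h) g\<bar> \<le> r/2 * norm g * \<bar>t\<bar>"
    if S: "(g, l) \<in> S" and t: "\<bar>t\<bar> < s" for g l t
  proof -
    let ?m = "\<lambda>t. inner (U t f - f - t *\<^sub>R h) g"
    have m: "(?m has_field_derivative inner (U t h - h) g) (at t within A)" for t A
    proof -
      have g: "((\<lambda>t. U (- t) g) has_vector_derivative - U (- t) l) (at t)"
        using vector_diff_chain_at[OF has_vector_derivative_minus[OF has_vector_derivative_id], of "\<lambda>t. U t g" "U (- t) l" t]
          generates_at[OF core_generates[OF S], of "- t"] by (simp add: o_def)
      have eq: "?m t = inner f (U (- t) g) - inner f g - t * inner h g" for t
        by (simp add: inner_diff_left inner_U_left)
      \<comment> \<open>The weak relation is applied not to g but to its translate, which is again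
        in the core.\<close>
      have w: "inner h (U (- t) g) = - inner f (U (- t) l)" using weak[OF core_U[OF S]] .
      have "((\<lambda>t. inner f (U (- t) g)) has_vector_derivative inner f (- U (- t) l)) (at t)"
        using bounded_linear.has_vector_derivative[OF bounded_linear_inner_right g] .
      then have "((\<lambda>t. inner f (U (- t) g)) has_field_derivative inner f (- U (- t) l)) (at t within A)"
        by (simp add: has_real_derivative_iff_has_vector_derivative has_vector_derivative_at_within)
      then have "((\<lambda>t. inner f (U (- t) g) - inner f g - t * inner h g) has_field_derivative
          inner f (- U (- t) l) - 0 - 1 * inner h g) (at t within A)"
        by (auto intro!: derivative_eq_intros)
      then show ?thesis unfolding eq
        by (simp add: inner_diff_left inner_U_left w)
    qed
    have "norm (?m t - ?m 0) \<le> (r/2 * norm g) * norm (t - 0)"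
    proof (rule field_differentiable_bound[where S="{- \<bar>t\<bar>..\<bar>t\<bar>}", OF _ m])
      fix u assume "u \<in> {- \<bar>t\<bar>..\<bar>t\<bar>}"
      then have "\<bar>u\<bar> < s" using t by auto
      then show "norm (inner (U u h - h) g) \<le> r/2 * norm g"
        using order_trans[OF Cauchy_Schwarz_ineq2 mult_right_mono[OF s']] by simp
    qed auto
    then show ?thesis by (simp add: U_0)
  qed
  have "norm ((U (0 + t) f - U 0 f) /\<^sub>R t - h) < r" if "t \<noteq> 0" "norm (t - 0) < s" for t
  proof -
    have t: "\<bar>t\<bar> < s" using that by simp
    define y where "y = U t f - f - t *\<^sub>R h"
    have "\<exists>g. (\<exists>l. (g, l) \<in> S) \<and> norm (y - g) < inverse (real (Suc n))" for n
      using core_dense[of "inverse (real (Suc n))" y] by fastforce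
    then obtain g where g: "\<And>n. \<exists>l. (g n, l) \<in> S" "\<And>n. norm (y - g n) < inverse (real (Suc n))" by metis
    have gy: "g \<longlonglongrightarrow> y" by (rule tendsto_if_norm_diff_less_inverse) fact
    \<comment> \<open>The bound on core vectors passes to the limit g = y, which makes the left side
      the squared norm of y.\<close>
    have "\<bar>inner y y\<bar> \<le> r/2 * norm y * \<bar>t\<bar>"
    proof (rule LIMSEQ_le)
      show "(\<lambda>n. \<bar>inner y (g n)\<bar>) \<longlonglongrightarrow> \<bar>inner y y\<bar>" by (intro tendsto_intros gy)
      show "(\<lambda>n. r/2 * norm (g n) * \<bar>t\<bar>) \<longlonglongrightarrow> r/2 * norm y * \<bar>t\<bar>" by (intro tendsto_intros gy)
      show "\<exists>N. \<forall>n\<ge>N. \<bar>inner y (g n)\<bar> \<le> r/2 * norm (g n) * \<bar>t\<bar>"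
        using est[OF _ t] g(1) unfolding y_def by blast
    qed
    then have "norm y * norm y \<le> r/2 * \<bar>t\<bar> * norm y"
      by (simp add: mult_ac flip: power2_norm_eq_inner power2_eq_square)
    then have "norm y \<le> r/2 * \<bar>t\<bar>" using r by (cases "y = 0") auto
    moreover have "(U (0 + t) f - U 0 f) /\<^sub>R t - h = y /\<^sub>R t"
      using that by (simp add: y_def U_0 scaleR_diff_right)
    moreover have "r/2 * \<bar>t\<bar> < r * \<bar>t\<bar>" using that r by simp
    ultimately have "norm y < r * \<bar>t\<bar>" "(U (0 + t) f - U 0 f) /\<^sub>R t - h = y /\<^sub>R t" by simp_all
    then show ?thesis using that by (simp add: divide_simps mult.commute)
  qed
  then show "\<exists>s>0. \<forall>x. x \<noteq> 0 \<and> norm (x - 0) < s \<longrightarrow> norm ((U (0 + x) f - U 0 f) /\<^sub>R x - h) < r"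
    using s(1) by blast
qed

text \<open>
  Riemann sums of the resolvent integral \<open>\<integral>\<^sub>0\<^sup>\<infinity> exp (- t) U t g dt\<close> show that the range of
  \<open>A - 1\<close> on the core is dense, without completeness.
\<close>

lemma core_range_dense:
  assumes e: "e > 0"
  shows "\<exists>(g, l)\<in>S. norm (f - (l - g)) < e"
proof -
  obtain g l where gl: "(g, l) \<in> S" "norm (f - g) < e/2" using core_dense[of "e/2" f] e by auto
  \<comment> \<open>The error of one Euler step for the damped orbit exp (- s) U s g, whose
    derivative at 0 is l - g.\<close>
  define F where "F d = exp (- d) *\<^sub>R U d g - g - d *\<^sub>R (l - g)" for d
  have "((\<lambda>d. exp (- d) *\<^sub>R U d g) has_vector_derivative exp (- 0) *\<^sub>R l + (- exp (- 0)) *\<^sub>R U 0 g) (at 0)"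
    by (rule has_vector_derivative_scaleR)
      (use core_generates[OF gl(1)] in \<open>auto simp: generates_def intro!: derivative_eq_intros\<close>)
  then have "((\<lambda>d. (exp (- (0 + d)) *\<^sub>R U (0 + d) g - exp (- 0) *\<^sub>R U 0 g) /\<^sub>R d) \<longlongrightarrow> l - g) (at 0)"
    unfolding has_vector_derivative_iff_quotient by (simp add: U_0)
  from LIM_D[OF this, of "e/8"] e obtain s where s: "s > 0"
    "\<And>d. d \<noteq> 0 \<Longrightarrow> \<bar>d\<bar> < s \<Longrightarrow> norm ((exp (- d) *\<^sub>R U d g - g) /\<^sub>R d - (l - g)) < e/8"
    by (auto simp: U_0)
  \<comment> \<open>Below s for the Euler error, and at most 1 so that exp (- d) is at most 1 -
    d/2.\<close>
  define d where "d = min 1 (s/2)"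
  have d: "0 < d" "d \<le> 1" "\<bar>d\<bar> < s" using s(1) by (auto simp: d_def)
  have "F d = d *\<^sub>R ((exp (- d) *\<^sub>R U d g - g) /\<^sub>R d - (l - g))"
    using d by (simp add: F_def scaleR_diff_right)
  then have Fd: "norm (F d) \<le> e/8 * d" using s(2)[of d] d by (simp add: mult.commute)
  have "(\<lambda>N. exp (- d) ^ N * norm g) \<longlonglongrightarrow> 0 * norm g"
    using d by (intro tendsto_mult tendsto_const LIMSEQ_power_zero) auto
  then have "\<exists>N. exp (- d) ^ N * norm g < e/8"
    using e by (metis (no_types, lifting) eventually_sequentially mult_zero_left order_refl order_tendstoD(2) zero_less_divide_iff zero_less_numeral)
  then obtain N where N: "exp (- d) ^ N * norm g < e/8" by blast
  define T where "T j = exp (- d) ^ j *\<^sub>R U (real j * d) g" for j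
  \<comment> \<open>The Riemann sum with step d of the damped orbit of the pair (g, l). It stays in
    S because S is an invariant subspace.\<close>
  define R where "R = (\<Sum>j<N. (d * exp (- d) ^ j) *\<^sub>R (U (real j * d) g, U (real j * d) l))"
  have RS: "R \<in> S" unfolding R_def
    by (intro subspace_sum[OF core_subspace] subspace_scale[OF core_subspace] core_U gl)
  \<comment> \<open>The Euler error transported to time j d is a term of a telescoping sum minus the
    corresponding term of the Riemann sum.\<close>
  have step: "exp (- d) ^ j *\<^sub>R U (real j * d) (F d) = T (Suc j) - T j - (d * exp (- d) ^ j) *\<^sub>R (U (real j * d) l - U (real j * d) g)" for j
  proof -
    have "U (real j * d) (U d g) = U (real (Suc j) * d) g"
      by (simp add: U_plus[symmetric] algebra_simps)
    then show ?thesis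
      by (simp add: F_def T_def U_diff U_scaleR scaleR_diff_right mult.commute)
  qed
  have "snd R - fst R = (\<Sum>j<N. (d * exp (- d) ^ j) *\<^sub>R (U (real j * d) l - U (real j * d) g))"
    by (simp add: R_def fst_sum snd_sum scaleR_diff_right sum_subtractf)
  then have sum: "(\<Sum>j<N. exp (- d) ^ j *\<^sub>R U (real j * d) (F d)) = T N - T 0 - (snd R - fst R)"
    by (simp only: step sum_subtractf[of "\<lambda>j. T (Suc j) - T j"] sum_lessThan_telescope)
  have "norm (\<Sum>j<N. exp (- d) ^ j *\<^sub>R U (real j * d) (F d)) \<le> (\<Sum>j<N. exp (- d) ^ j * norm (F d))"
    by (rule order_trans[OF norm_sum]) (simp add: norm_U)
  also have "\<dots> = (\<Sum>j<N. exp (- d) ^ j) * norm (F d)" by (simp add: sum_distrib_right)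
  \<comment> \<open>The geometric weights sum to at most 2/d, which the factor d in the Euler error
    cancels.\<close>
  also have "\<dots> \<le> 2 / d * (e/8 * d)"
  proof (rule mult_mono[OF _ Fd])
    have q: "exp (- d) \<le> 1 - d/2"
    proof -
      have "exp (- d) \<le> 1 / (1 + d)"
        using exp_ge_add_one_self[of d] d by (simp add: exp_minus divide_inverse le_imp_inverse_le)
      also have "\<dots> \<le> 1 - d/2" using d mult_left_mono[OF d(2), of d] by (simp add: field_simps)
      finally show ?thesis .
    qed
    have "(\<Sum>j<N. exp (- d) ^ j) = (1 - exp (- d) ^ N) / (1 - exp (- d))"
      using d by (simp add: sum_gp_strict)
    also have "\<dots> \<le> 1 / (d/2)" using q d by (intro frac_le) auto
    finally show "(\<Sum>j<N. exp (- d) ^ j) \<le> 2 / d" by simp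
  qed (use d in auto)
  also have "\<dots> = e/4" using d by simp
  finally have le: "norm (T N - T 0 - (snd R - fst R)) \<le> e/4" unfolding sum .
  have "norm (T N) < e/8" using N by (simp add: T_def norm_U)
  moreover have "T 0 = g" by (simp add: T_def U_0)
  moreover have "norm (g - (fst R - snd R)) \<le> norm (T N) + norm (T N - g - (snd R - fst R))"
    using norm_triangle_ineq4[of "T N" "T N - g - (snd R - fst R)"] by (simp add: algebra_simps)
  ultimately have "norm (g - (fst R - snd R)) < e/2" using le e by simp
  then have "norm ((f - g) + (g - (fst R - snd R))) < e"
    using gl(2) by (intro norm_triangle_lt) simp
  then have "norm (f - (fst R - snd R)) < e" by (simp only: add_diff_eq diff_add_cancel)
  \<comment> \<open>The telescoping sum runs from g to almost 0, so snd R - fst R is near - g, and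
    the pair sought is - R.\<close>
  moreover have "(- fst R, - snd R) \<in> S"
    using subspace_neg[OF core_subspace RS] by (metis prod.collapse uminus_Pair)
  ultimately show ?thesis by (intro bexI[of _ "(- fst R, - snd R)"]) auto
qed

text \<open>Density of the range gives a core pair with l - g near k - f. The generator being skew,
  k - l is orthogonal to f - g, so by Pythagoras each of them is at most as long as their
  difference.\<close>

lemma core_approximates:
  assumes f: "generates f k" and e: "e > 0"
  shows "\<exists>(g, l)\<in>S. norm (f - g) < e \<and> norm (k - l) < e"
proof -
  obtain g l where gl: "(g, l) \<in> S" "norm ((k - f) - (l - g)) < e"
    using core_range_dense[OF e, of "k - f"] by auto
  have "generates (f - g) (k - l)" using generates_diff[OF f core_generates[OF gl(1)]] .
  from generates_skew[OF this this] have 0: "inner (k - l) (f - g) = 0"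
    by (simp add: inner_commute)
  have "(norm ((k - f) - (l - g)))\<^sup>2 = (norm ((k - l) - (f - g)))\<^sup>2" by (simp add: algebra_simps)
  also have "\<dots> = (norm (k - l))\<^sup>2 + (norm (f - g))\<^sup>2"
    using 0 by (rule norm_diff_square_orthogonal)
  finally have *: "(norm (k - l))\<^sup>2 + (norm (f - g))\<^sup>2 = (norm ((k - f) - (l - g)))\<^sup>2" ..
  have "norm (k - l) \<le> norm ((k - f) - (l - g))"
    by (rule power2_le_imp_le) (use * in \<open>simp_all flip: *\<close>)
  moreover have "norm (f - g) \<le> norm ((k - f) - (l - g))"
    by (rule power2_le_imp_le) (use * in \<open>simp_all flip: *\<close>)
  ultimately have "norm (k - l) \<le> norm ((k - f) - (l - g))" "norm (f - g) \<le> norm ((k - f) - (l - g))" .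
  with gl show ?thesis by force
qed

end

section \<open>Extending an evolution from a dense subspace\<close>

text \<open>\<open>shift\<close> acts on labels of explicit solutions and \<open>w\<close> gives
  their velocities. Skewness makes the norm of every linear combination of solutions constant in
  time; this is what allows the extension from the dense span to the whole space.\<close>

locale dense_evolution =
  fixes v w :: "'b \<Rightarrow> 'a::{real_inner, complete_space}" and shift :: "real \<Rightarrow> 'b \<Rightarrow> 'b" and P :: "'b set"
  assumes shift_0: "shift 0 a = a"
    and shift_shift: "shift s (shift t a) = shift (s + t) a"
    and shift_P: "a \<in> P \<Longrightarrow> shift t a \<in> P"
    and deriv: "a \<in> P \<Longrightarrow> ((\<lambda>t. v (shift t a)) has_vector_derivative w a) (at 0)"
    and skew: "a \<in> P \<Longrightarrow> b \<in> P \<Longrightarrow> inner (w a) (v b) + inner (v a) (w b) = 0"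
    and dense: "closure (span (v ` P)) = UNIV"
begin

text \<open>Formal combinations, because nothing is assumed about linear relations among the vectors
  \<open>v a\<close>. The shift is defined on lists, and \<open>norm_combo_shift_diff\<close> shows
  that lists with equal sums keep equal sums.\<close>

definition combo :: "('b \<Rightarrow> 'a) \<Rightarrow> (real \<times> 'b) list \<Rightarrow> 'a" where
  "combo u xs = (\<Sum>(r, a)\<leftarrow>xs. r *\<^sub>R u a)"

definition shift_list :: "real \<Rightarrow> (real \<times> 'b) list \<Rightarrow> (real \<times> 'b) list" where
  "shift_list t xs = map (\<lambda>(r, a). (r, shift t a)) xs"

definition neg_list :: "(real \<times> 'b) list \<Rightarrow> (real \<times> 'b) list" where
  "neg_list xs = map (\<lambda>(r, a). (- r, a)) xs"

definition valid :: "(real \<times> 'b) list \<Rightarrow> bool" where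
  "valid xs \<longleftrightarrow> (\<forall>(r, a)\<in>set xs. a \<in> P)"

lemma combo_simps [simp]:
  "combo u [] = 0" "combo u ((r, a) # xs) = r *\<^sub>R u a + combo u xs"
  "combo u (xs @ ys) = combo u xs + combo u ys"
  "combo u (neg_list xs) = - combo u xs"
  by (simp_all add: combo_def neg_list_def) (induction xs, auto)

lemma shift_list_simps [simp]:
  "shift_list t [] = []" "shift_list t ((r, a) # xs) = (r, shift t a) # shift_list t xs"
  "shift_list t (xs @ ys) = shift_list t xs @ shift_list t ys"
  "shift_list t (neg_list xs) = neg_list (shift_list t xs)"
  "shift_list 0 xs = xs" "shift_list s (shift_list t xs) = shift_list (s + t) xs"
  by (auto simp: shift_list_def neg_list_def shift_0 shift_shift intro!: map_idI)

lemma valid_simps [simp]: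
  "valid []" "valid ((r, a) # xs) \<longleftrightarrow> a \<in> P \<and> valid xs"
  "valid (xs @ ys) \<longleftrightarrow> valid xs \<and> valid ys" "valid (neg_list xs) \<longleftrightarrow> valid xs"
  by (auto simp: valid_def neg_list_def)

lemma valid_shift_list [simp]: "valid xs \<Longrightarrow> valid (shift_list t xs)"
  by (induction xs) (auto simp: shift_P)

lemma combo_deriv:
  assumes "valid xs"
  shows "((\<lambda>t. combo v (shift_list t xs)) has_vector_derivative combo w (shift_list t xs)) (at t)"
proof -
  have "((\<lambda>t. combo v (shift_list t ys)) has_vector_derivative combo w ys) (at 0)" if "valid ys" for ys
    using that
  proof (induction ys)
    case (Cons x xs)
    obtain r a where x: "x = (r, a)" by force
    have "((\<lambda>t. r *\<^sub>R v (shift t a)) has_vector_derivative r *\<^sub>R w a) (at 0)"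
      using Cons.prems x by (intro bounded_linear.has_vector_derivative[OF bounded_linear_scaleR_right] deriv) auto
    with Cons x show ?case by (auto intro: has_vector_derivative_add)
  qed simp
  from this[of "shift_list t xs"] assms show ?thesis
    by (simp add: has_vector_derivative_iff_quotient add.commute)
qed

lemma combo_skew:
  assumes "valid xs" "valid ys"
  shows "inner (combo w xs) (combo v ys) + inner (combo v xs) (combo w ys) = 0"
  using assms(1)
proof (induction xs)
  case (Cons x xs)
  obtain r a where x: "x = (r, a)" by force
  have "inner (w a) (combo v ys) + inner (v a) (combo w ys) = 0"
    using assms(2)
  proof (induction ys)
    case (Cons y ys)
    obtain s b where y: "y = (s, b)" by force
    have "s * inner (w a) (v b) + s * inner (v a) (w b) = s * 0"
      using skew[of a b] \<open>valid (x # xs)\<close> Cons.prems x y by (simp flip: distrib_left)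
    with Cons y show ?case by (simp add: inner_add_right)
  qed simp
  then have "r * inner (w a) (combo v ys) + r * inner (v a) (combo w ys) = r * 0"
    by (simp flip: distrib_left)
  with Cons x show ?case by (simp add: inner_add_left)
qed simp

text \<open>The squared norm has derivative zero at every time, by skewness applied to the shifted
  list.\<close>

lemma norm_combo_shift:
  assumes "valid xs"
  shows "norm (combo v (shift_list t xs)) = norm (combo v xs)"
proof -
  let ?V = "\<lambda>t. combo v (shift_list t xs)" and ?W = "\<lambda>t. combo w (shift_list t xs)"
  have "((\<lambda>t. inner (?V t) (?V t)) has_derivative (\<lambda>h. inner (?V t) (h *\<^sub>R ?W t) + inner (h *\<^sub>R ?W t) (?V t))) (at t)" for t
    using combo_deriv[OF assms, of t] unfolding has_vector_derivative_def by (intro has_derivative_inner)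
  moreover have "inner (?V t) (h *\<^sub>R ?W t) + inner (h *\<^sub>R ?W t) (?V t) = h * 0" for h t
    using combo_skew[of "shift_list t xs" "shift_list t xs"] assms
    by (simp add: inner_commute flip: distrib_left)
  ultimately have "((\<lambda>t. inner (?V t) (?V t)) has_real_derivative 0) (at t)" for t
    by (simp add: has_field_derivative_def lambda_zero[symmetric])
  then have "inner (?V t) (?V t) = inner (?V 0) (?V 0)"
    using DERIV_isconst_all[of "\<lambda>t. inner (?V t) (?V t)"] by blast
  then show ?thesis by (simp add: norm_eq_sqrt_inner)
qed

lemma norm_combo_shift_diff:
  assumes "valid xs" "valid ys"
  shows "norm (combo v (shift_list t xs) - combo v (shift_list t ys)) = norm (combo v xs - combo v ys)"
  using norm_combo_shift[of "xs @ neg_list ys" t] assms by simp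

lemma combo_dense:
  assumes e: "e > 0"
  shows "\<exists>xs. valid xs \<and> norm (f - combo v xs) < e"
proof -
  have "f \<in> closure (span (v ` P))" using dense by simp
  then obtain y where y: "y \<in> span (v ` P)" "dist y f < e" using e closure_approachable by blast
  from y(1) have "\<exists>xs. valid xs \<and> y = combo v xs"
  proof (induction rule: span_induct_alt)
    case base then show ?case by (intro exI[of _ "[]"]) simp
  next
    case (step r u z)
    then obtain a xs where "a \<in> P" "u = v a" "valid xs" "z = combo v xs" by blast
    then show ?case by (intro exI[of _ "(r, a) # xs"]) simp
  qed
  with y(2) show ?thesis by (metis dist_norm norm_minus_commute)
qed

definition approx :: "'a \<Rightarrow> nat \<Rightarrow> (real \<times> 'b) list" where
  "approx f n = (SOME xs. valid xs \<and> norm (f - combo v xs) < inverse (real (Suc n)))"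

definition evolve :: "real \<Rightarrow> 'a \<Rightarrow> 'a" where
  "evolve t f = lim (\<lambda>n. combo v (shift_list t (approx f n)))"

lemma approx: "valid (approx f n)" "norm (f - combo v (approx f n)) < inverse (real (Suc n))"
  using someI_ex[OF combo_dense[of "inverse (real (Suc n))" f]] unfolding approx_def[symmetric] by auto

lemma approx_tendsto: "(\<lambda>n. combo v (approx f n)) \<longlonglongrightarrow> f"
  by (rule tendsto_if_norm_diff_less_inverse) (rule approx)

lemma evolve_tendsto: "(\<lambda>n. combo v (shift_list t (approx f n))) \<longlonglongrightarrow> evolve t f"
proof -
  have "Cauchy (\<lambda>n. combo v (approx f n))" using approx_tendsto by (rule LIMSEQ_imp_Cauchy)
  then have "Cauchy (\<lambda>n. combo v (shift_list t (approx f n)))"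
    by (simp add: Cauchy_def dist_norm norm_combo_shift_diff approx)
  then show ?thesis unfolding evolve_def
    by (simp add: Cauchy_convergent convergent_LIMSEQ_iff[symmetric])
qed

text \<open>The isometry property in a mixed form, comparing an arbitrary vector with a formal
  combination. Preservation of norms, the value on combinations and independence of the
  approximating sequence are read off from it.\<close>

lemma evolve_dist:
  assumes "valid xs"
  shows "norm (evolve t f - combo v (shift_list t xs)) = norm (f - combo v xs)"
proof (rule LIMSEQ_unique)
  show "(\<lambda>n. norm (combo v (shift_list t (approx f n)) - combo v (shift_list t xs)))
      \<longlonglongrightarrow> norm (evolve t f - combo v (shift_list t xs))"
    by (intro tendsto_intros evolve_tendsto)
  show "(\<lambda>n. norm (combo v (shift_list t (approx f n)) - combo v (shift_list t xs)))
      \<longlonglongrightarrow> norm (f - combo v xs)"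
    unfolding norm_combo_shift_diff[OF approx(1) assms] by (intro tendsto_intros approx_tendsto)
qed

lemma evolve_limit:
  assumes X: "\<And>n. valid (X n)" "(\<lambda>n. combo v (X n)) \<longlonglongrightarrow> f"
  shows "(\<lambda>n. combo v (shift_list t (X n))) \<longlonglongrightarrow> evolve t f"
proof -
  have "(\<lambda>n. norm (f - combo v (X n))) \<longlonglongrightarrow> norm (f - f)" by (intro tendsto_intros X)
  then have "(\<lambda>n. norm (evolve t f - combo v (shift_list t (X n)))) \<longlonglongrightarrow> 0"
    by (simp add: evolve_dist[OF X(1)])
  then have "(\<lambda>n. evolve t f - combo v (shift_list t (X n))) \<longlonglongrightarrow> 0" by (simp only: tendsto_norm_zero_iff)
  from tendsto_diff[OF tendsto_const[of "evolve t f"] this] show ?thesis by simp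
qed

lemma evolve_combo: "valid xs \<Longrightarrow> evolve t (combo v xs) = combo v (shift_list t xs)"
  using evolve_dist[of xs t "combo v xs"] by simp

text \<open>An operator realized on formal combinations and commuting with the shift passes to the
  limit. It is used for real scalars, which act on the coefficients, and through
  \<open>evolve_commute\<close> for complex scalars, which act on the labels.\<close>

lemma evolve_commute_list:
  assumes J: "bounded_linear J"
    and j: "\<And>xs. valid xs \<Longrightarrow> valid (j xs)" "\<And>xs. valid xs \<Longrightarrow> combo v (j xs) = J (combo v xs)"
      "\<And>t xs. shift_list t (j xs) = j (shift_list t xs)"
  shows "evolve t (J f) = J (evolve t f)"
proof (rule LIMSEQ_unique)
  have "(\<lambda>n. combo v (j (approx f n))) \<longlonglongrightarrow> J f"
    using bounded_linear.tendsto[OF J approx_tendsto[of f]] by (simp add: j approx)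
  from evolve_limit[OF j(1)[OF approx(1)] this]
  show "(\<lambda>n. combo v (j (shift_list t (approx f n)))) \<longlonglongrightarrow> evolve t (J f)" by (simp only: j(3))
  show "(\<lambda>n. combo v (j (shift_list t (approx f n)))) \<longlonglongrightarrow> J (evolve t f)"
    using bounded_linear.tendsto[OF J evolve_tendsto[of t f]] by (simp add: j(2) approx)
qed

lemma evolve_commute:
  assumes J: "bounded_linear J" and j: "\<And>a. a \<in> P \<Longrightarrow> j a \<in> P"
    and vj: "\<And>a. a \<in> P \<Longrightarrow> v (j a) = J (v a)" and sj: "\<And>t a. shift t (j a) = j (shift t a)"
  shows "evolve t (J f) = J (evolve t f)"
proof (rule evolve_commute_list[OF J])
  let ?j = "map (\<lambda>(r, a). (r, j a))"
  have lin: "J (r *\<^sub>R x) = r *\<^sub>R J x" "J (x + y) = J x + J y" "J 0 = 0" for r x y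
    using bounded_linear.linear[OF J] by (auto simp: linear_add linear_scale linear_0)
  show "valid (?j xs)" "combo v (?j xs) = J (combo v xs)" if "valid xs" for xs
    using that by (induction xs) (auto simp: j vj lin)
  show "shift_list t (?j xs) = ?j (shift_list t xs)" for t xs
    by (induction xs) (auto simp: sj)
qed

lemma norm_evolve: "norm (evolve t f) = norm f"
  using evolve_dist[of "[]" t f] by simp

sublocale isometry_group evolve
proof
  fix t s r :: real and f g :: 'a
  show "evolve t (r *\<^sub>R f) = r *\<^sub>R evolve t f"
  proof (rule evolve_commute_list[OF bounded_linear_scaleR_right])
    let ?r = "map (\<lambda>(q, a). (r * q, a))"
    show "valid xs \<Longrightarrow> valid (?r xs)" "combo v (?r xs) = r *\<^sub>R combo v xs"
      "shift_list t (?r xs) = ?r (shift_list t xs)" for t xs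
      by (induction xs) (auto simp: scaleR_add_right)
  qed
  show "evolve t (f + g) = evolve t f + evolve t g"
  proof (rule LIMSEQ_unique)
    show "(\<lambda>n. combo v (shift_list t (approx f n @ approx g n))) \<longlonglongrightarrow> evolve t f + evolve t g"
      using tendsto_add[OF evolve_tendsto evolve_tendsto] by simp
    show "(\<lambda>n. combo v (shift_list t (approx f n @ approx g n))) \<longlonglongrightarrow> evolve t (f + g)"
      using tendsto_add[OF approx_tendsto approx_tendsto] by (intro evolve_limit) (simp_all add: approx)
  qed
  show "norm (evolve t f) = norm f" by (rule norm_evolve)
  show "evolve 0 f = f"
    using LIMSEQ_unique[OF evolve_tendsto[of 0 f]] approx_tendsto[of f] by simp
  show "evolve (s + t) f = evolve s (evolve t f)"
  proof (rule LIMSEQ_unique)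
    show "(\<lambda>n. combo v (shift_list (s + t) (approx f n))) \<longlonglongrightarrow> evolve (s + t) f"
      by (rule evolve_tendsto)
    show "(\<lambda>n. combo v (shift_list (s + t) (approx f n))) \<longlonglongrightarrow> evolve s (evolve t f)"
      using evolve_limit[OF valid_shift_list[OF approx(1)] evolve_tendsto, of s t f] by simp
  qed
  show "((\<lambda>t. evolve t f) \<longlongrightarrow> f) (at 0)"
  proof (rule LIM_I)
    fix r :: real assume r: "r > 0"
    then obtain xs where xs: "valid xs" "norm (f - combo v xs) < r/3" using combo_dense[of "r/3" f] by auto
    have "isCont (\<lambda>t. combo v (shift_list t xs)) 0"
      by (rule has_vector_derivative_continuous[OF combo_deriv[OF xs(1)]])
    then have "((\<lambda>t. combo v (shift_list t xs)) \<longlongrightarrow> combo v xs) (at 0)" by (simp add: isCont_def)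
    from LIM_D[OF this, of "r/3"] r obtain s where s: "s > 0"
      "\<And>t. t \<noteq> 0 \<Longrightarrow> norm (t - 0) < s \<Longrightarrow> norm (combo v (shift_list t xs) - combo v xs) < r/3" by auto
    have "norm (evolve t f - f) < r" if "t \<noteq> 0" "norm (t - 0) < s" for t
    proof -
      have "norm (evolve t f - f) \<le> norm (evolve t f - combo v (shift_list t xs)) +
          norm (combo v (shift_list t xs) - combo v xs) + norm (f - combo v xs)"
        using norm_triangle_ineq[of "evolve t f - combo v (shift_list t xs)" "combo v (shift_list t xs) - combo v xs"]
          norm_triangle_ineq4[of "evolve t f - combo v xs" "f - combo v xs"] by (simp add: algebra_simps)
      then show ?thesis using s(2)[OF that] xs evolve_dist[OF xs(1), of t f] by simp
    qed
    then show "\<exists>s>0. \<forall>t. t \<noteq> 0 \<and> norm (t - 0) < s \<longrightarrow> norm (evolve t f - f) < r" using s(1) by blast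
  qed
qed

sublocale group_with_core evolve "{(combo v xs, combo w xs) | xs. valid xs}"
proof
  fix g l f :: 'a and t e :: real
  have dE: "generates (combo v xs) (combo w xs)" if "valid xs" for xs
    using combo_deriv[OF that, of 0] that by (simp add: generates_def evolve_combo)
  then show "(g, l) \<in> {(combo v xs, combo w xs) |xs. valid xs} \<Longrightarrow> generates g l" by blast
  \<comment> \<open>Applying \<open>evolve t\<close> to the orbit of the sum gives the orbit of the
    shifted list, so the two derivatives at 0 agree.\<close>
  have wE: "evolve t (combo w xs) = combo w (shift_list t xs)" if "valid xs" for xs
  proof -
    have "((\<lambda>s. evolve t (evolve s (combo v xs))) has_vector_derivative evolve t (combo w xs)) (at 0)"
      using bounded_linear.has_vector_derivative[OF bounded_linear_U dE[OF that, unfolded generates_def]] .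
    moreover have "evolve t (evolve s (combo v xs)) = combo v (shift_list s (shift_list t xs))" for s
      using that by (simp add: evolve_combo add.commute)
    moreover have "((\<lambda>s. combo v (shift_list s (shift_list t xs))) has_vector_derivative combo w (shift_list t xs)) (at 0)"
      using combo_deriv[of "shift_list t xs" 0] that by simp
    ultimately show ?thesis using vector_derivative_unique_at by fastforce
  qed
  show "(g, l) \<in> {(combo v xs, combo w xs) |xs. valid xs} \<Longrightarrow>
      (evolve t g, evolve t l) \<in> {(combo v xs, combo w xs) |xs. valid xs}"
    using wE evolve_combo valid_shift_list by blast
  show "subspace {(combo v xs, combo w xs) |xs. valid xs}"
    unfolding subspace_def
  proof (intro conjI ballI allI)
    show "0 \<in> {(combo v xs, combo w xs) |xs. valid xs}"
      by (auto simp: zero_prod_def intro!: exI[of _ "[]"])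
  next
    fix x y assume "x \<in> {(combo v xs, combo w xs) |xs. valid xs}" "y \<in> {(combo v xs, combo w xs) |xs. valid xs}"
    then obtain xs ys where "x = (combo v xs, combo w xs)" "y = (combo v ys, combo w ys)" "valid xs" "valid ys" by blast
    then show "x + y \<in> {(combo v xs, combo w xs) |xs. valid xs}"
      by (auto intro!: exI[of _ "xs @ ys"])
  next
    fix c :: real and x assume "x \<in> {(combo v xs, combo w xs) |xs. valid xs}"
    then obtain xs where xs: "x = (combo v xs, combo w xs)" "valid xs" by blast
    let ?r = "map (\<lambda>(q, a). (c * q, a)) :: _ \<Rightarrow> (real \<times> 'b) list"
    have "valid (?r xs) = valid xs" "combo u (?r xs) = c *\<^sub>R combo u xs" for u and xs
      by (induction xs) (auto simp: scaleR_add_right)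
    with xs show "c *\<^sub>R x \<in> {(combo v xs, combo w xs) |xs. valid xs}"
      by (auto intro!: exI[of _ "?r xs"])
  qed
  show "e > 0 \<Longrightarrow> \<exists>(g, l)\<in>{(combo v xs, combo w xs) |xs. valid xs}. norm (f - g) < e"
    using combo_dense[of e f] by blast
qed

end

section \<open>Density of the Gaussian span\<close>

lemma AE_half_line_iff: "(AE x in half_line. P x) \<longleftrightarrow> (AE x in lborel. x > 0 \<longrightarrow> P x)"
  by (subst AE_restrict_space_iff) auto

lemma real_measurable_AE_limit_continuous:
  fixes r :: "real \<Rightarrow> real"
  assumes "r \<in> borel_measurable half_line"
  obtains g where "\<And>n. continuous_on UNIV (g n)" "AE x in half_line. (\<lambda>n. g n x) \<longlonglongrightarrow> r x"
proof -
  have "(\<lambda>x. indicator {0<..} x *\<^sub>R r x) \<in> borel_measurable lborel"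
    using assms by (subst (asm) borel_measurable_restrict_space_iff) auto
  then have "(\<lambda>x. indicator {0<..} x *\<^sub>R r x) \<in> borel_measurable lebesgue"
    by (rule measurable_completion)
  then have "(\<lambda>x. indicator {0<..} x *\<^sub>R r x) measurable_on UNIV"
    by (rule lebesgue_measurable_imp_measurable_on_real) auto
  then obtain N g where N: "negligible N" and g: "\<And>n. continuous_on UNIV (g n)"
    "\<And>x. x \<notin> N \<Longrightarrow> (\<lambda>n. g n x) \<longlonglongrightarrow> indicator {0<..} x *\<^sub>R r x"
    unfolding measurable_on_def by auto
  have "AE x in lebesgue. x \<notin> N" using N by (simp add: negligible_iff_null_sets AE_not_in)
  then have "AE x in lborel. x \<notin> N" by (simp add: AE_completion_iff)
  then have "AE x in half_line. (\<lambda>n. g n x) \<longlonglongrightarrow> r x"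
    unfolding AE_half_line_iff
  proof eventually_elim
    case (elim x)
    show ?case using g(2)[OF elim] by (cases "x > 0") auto
  qed
  with g(1) show thesis using that by blast
qed

text \<open>Three reductions, each a dominated convergence: to real and imaginary parts, from these
  to bounded functions supported in a compact interval by truncation, and from those to continuous
  functions, of which measurable functions are limits almost everywhere.\<close>

lemma l2_closed_subspace_eq_UNIV:
  fixes W :: "l2 set"
  assumes W: "closed W" "subspace W"
    and cont: "\<And>r c d z. continuous_on UNIV r \<Longrightarrow> 0 < c \<Longrightarrow> (\<And>x. x \<notin> {c..d} \<Longrightarrow> r x = 0) \<Longrightarrow>
      abs_l2 (\<lambda>x. z * of_real (r x :: real)) \<in> W"
  shows "W = UNIV"
proof -
  have bounded: "abs_l2 (\<lambda>x. z * of_real (r x)) \<in> W"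
    if r: "r \<in> borel_measurable half_line" and cd: "0 < c" "c < d" "\<And>x. x \<notin> {c..d} \<Longrightarrow> r x = 0"
      and K: "\<And>x. \<bar>r x\<bar> \<le> K" "K > 0" for r :: "real \<Rightarrow> real" and z c d K
  proof -
    obtain g where g: "\<And>n. continuous_on UNIV (g n)" and lim: "AE x in half_line. (\<lambda>n. g n x) \<longlonglongrightarrow> r x"
      using real_measurable_AE_limit_continuous[OF r] by blast
    \<comment> \<open>A trapezoid that is 1 on [c, d] and 0 off [c/2, d + 1]. It gives the
      approximants compact support, as \<open>clip\<close> gives them the common bound K.\<close>
    define e where "e x = max 0 (min 1 (min (2 * x / c - 1) (d + 1 - x)))" for x
    have e: "e x = 1" if "x \<in> {c..d}" for x using that cd(1) by (auto simp: e_def field_simps)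
    have e0: "e x = 0" if "x \<notin> {c/2..d+1}" for x
    proof -
      have "2 * x / c - 1 \<le> 0 \<or> d + 1 - x \<le> 0" using that cd(1) by (auto simp: divide_le_eq)
      then show ?thesis by (auto simp: e_def)
    qed
    have e01: "0 \<le> e x" "e x \<le> 1" for x by (auto simp: e_def)
    define clip where "clip y = max (- K) (min K y)" for y
    define h where "h n x = e x * clip (g n x)" for n x
    have ch: "continuous_on UNIV (h n)" for n
      unfolding h_def e_def clip_def by (intro continuous_intros continuous_on_max continuous_on_min g) (use cd in auto)
    have hW: "abs_l2 (\<lambda>x. z * of_real (h n x)) \<in> W" for n
      using cd(1) by (intro cont[of _ "c/2" "d+1"] ch) (auto simp: h_def e0)
    have hb: "(cmod (z * of_real (h n x)))\<^sup>2 \<le> (cmod z * K)\<^sup>2 * indicator {c/2..d+1} x" for n x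
    proof (cases "x \<in> {c/2..d+1}")
      case True
      have "\<bar>h n x\<bar> \<le> 1 * K"
        unfolding h_def abs_mult using e01[of x] K(2) by (intro mult_mono) (auto simp: clip_def)
      then have "cmod z * \<bar>h n x\<bar> \<le> cmod z * K" by (intro mult_left_mono) auto
      then have "(cmod z * \<bar>h n x\<bar>)\<^sup>2 \<le> (cmod z * K)\<^sup>2" by (intro power_mono) auto
      then show ?thesis using True by (simp add: norm_mult)
    qed (simp add: h_def e0)
    have "(\<lambda>n. abs_l2 (\<lambda>x. z * of_real (h n x))) \<longlonglongrightarrow> abs_l2 (\<lambda>x. z * of_real (r x))"
    proof (rule abs_l2_dominated_convergence(2)[OF _ _ _ hb])
      have "h n \<in> borel_measurable half_line" for n
        by (intro measurable_half_line_continuous continuous_on_subset[OF ch]) auto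
      then show "(\<lambda>x. z * of_real (h n x)) \<in> borel_measurable half_line" for n by measurable
      show "(\<lambda>x. z * of_real (r x)) \<in> borel_measurable half_line" using r by measurable
      have "(\<lambda>x. indicator {0<..} x *\<^sub>R indicator {c/2..d+1} x) = (indicator {c/2..d+1} :: real \<Rightarrow> real)"
        using cd(1) by (auto simp: indicator_def fun_eq_iff)
      moreover have "integrable lborel (indicator {c/2..d+1} :: real \<Rightarrow> real)"
        by (rule integrable_real_indicator) (auto simp: emeasure_lborel_Icc_eq)
      ultimately have "integrable half_line (indicator {c/2..d+1} :: real \<Rightarrow> real)"
        by (simp only: integrable_half_line_iff)
      then show "integrable half_line (\<lambda>x. (cmod z * K)\<^sup>2 * indicator {c/2..d+1} x)" by simp
      show "AE x in half_line. (\<lambda>n. z * of_real (h n x)) \<longlonglongrightarrow> z * of_real (r x)"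
        using lim
      proof eventually_elim
        case (elim x)
        have "clip (r x) = r x" using K(1)[of x] by (auto simp: clip_def)
        moreover have "(\<lambda>n. z * of_real (e x * clip (g n x))) \<longlonglongrightarrow> z * of_real (e x * clip (r x))"
          unfolding clip_def by (intro tendsto_intros tendsto_max tendsto_min elim)
        moreover have "e x * r x = r x" using e[of x] cd(3)[of x] by (cases "x \<in> {c..d}") auto
        ultimately show ?case by (simp add: h_def)
      qed
    qed
    from closed_sequentially[OF W(1) hW this] show ?thesis .
  qed
  have real_part: "abs_l2 (\<lambda>x. z * of_real (r x)) \<in> W"
    if r: "r \<in> borel_measurable half_line" "integrable half_line (\<lambda>x. (r x)\<^sup>2)" for r :: "real \<Rightarrow> real" and z
  proof -
    \<comment> \<open>The shift by 2 keeps the interval nondegenerate at n = 0, as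
      \<open>bounded\<close> requires c < d.\<close>
    let ?I = "\<lambda>n. {inverse (real (n + 2))..real (n + 2)}"
    define h where "h n x = indicator (?I n) x * (if \<bar>r x\<bar> \<le> real (n + 2) then r x else 0)" for n x
    have hm: "h n \<in> borel_measurable half_line" for n
    proof -
      have [measurable]: "(indicator (?I n) :: real \<Rightarrow> real) \<in> borel_measurable half_line"
        by (rule borel_measurable_half_line) simp
      show ?thesis unfolding h_def using r(1) by measurable
    qed
    have hW: "abs_l2 (\<lambda>x. z * of_real (h n x)) \<in> W" for n
    proof (rule bounded[OF hm])
      have "inverse (real (n + 2)) \<le> 1" by (rule inverse_le_1_iff[THEN iffD2]) simp
      then show "inverse (real (n + 2)) < real (n + 2)" by simp
      show "h n x = 0" if "x \<notin> ?I n" for x using that unfolding h_def by (subst indicator_simps(2)) simp_all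
      show "\<bar>h n x\<bar> \<le> real (n + 2)" for x by (cases "x \<in> ?I n") (simp_all add: h_def)
    qed auto
    have "(\<lambda>n. abs_l2 (\<lambda>x. z * of_real (h n x))) \<longlonglongrightarrow> abs_l2 (\<lambda>x. z * of_real (r x))"
    proof (rule abs_l2_dominated_convergence(2))
      show "(\<lambda>x. z * of_real (h n x)) \<in> borel_measurable half_line" for n using hm by measurable
      show "(\<lambda>x. z * of_real (r x)) \<in> borel_measurable half_line" using r by measurable
      show "integrable half_line (\<lambda>x. (cmod z)\<^sup>2 * (r x)\<^sup>2)" using r(2) by simp
      show "(cmod (z * of_real (h n x)))\<^sup>2 \<le> (cmod z)\<^sup>2 * (r x)\<^sup>2" for n x
        by (auto simp: norm_mult power_mult_distrib h_def indicator_def)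
      show "AE x in half_line. (\<lambda>n. z * of_real (h n x)) \<longlonglongrightarrow> z * of_real (r x)"
      proof (rule AE_half_lineI)
        fix x :: real assume x: "x > 0"
        obtain N where N: "max (max x (inverse x)) \<bar>r x\<bar> < real N" using reals_Archimedean2 by blast
        have "h n x = r x" if "n \<ge> N" for n
        proof -
          have n: "x \<le> real (n + 2)" "inverse x \<le> real (n + 2)" "\<bar>r x\<bar> \<le> real (n + 2)" using N that by auto
          have "inverse (real (n + 2)) \<le> inverse (inverse x)"
            using x n(2) by (intro le_imp_inverse_le) auto
          then show ?thesis using n by (simp add: h_def)
        qed
        then have "\<forall>\<^sub>F n in sequentially. z * of_real (r x) = z * of_real (h n x)"
          by (intro eventually_sequentiallyI[of N]) simp
        then show "(\<lambda>n. z * of_real (h n x)) \<longlonglongrightarrow> z * of_real (r x)"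
          by (rule Lim_transform_eventually[OF tendsto_const])
      qed
    qed
    from closed_sequentially[OF W(1) hW this] show ?thesis .
  qed
  have "u \<in> W" for u
  proof -
    obtain f where f: "f \<in> L2" "u = abs_l2 f" by (rule abs_l2_cases)
    have [measurable]: "f \<in> borel_measurable half_line" by (rule L2_measurable[OF f(1)])
    have int: "integrable half_line (\<lambda>x. (Re (f x))\<^sup>2)" "integrable half_line (\<lambda>x. (Im (f x))\<^sup>2)"
      by (auto intro!: Bochner_Integration.integrable_bound[OF L2_integrable[OF f(1)]] simp: cmod_power2)
    have L: "(\<lambda>x. 1 * complex_of_real (Re (f x))) \<in> L2" "(\<lambda>x. \<i> * complex_of_real (Im (f x))) \<in> L2"
      using int by (auto intro!: L2_I simp: norm_mult)
    have "f = (\<lambda>x. 1 * complex_of_real (Re (f x)) + \<i> * complex_of_real (Im (f x)))"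
      by (simp add: complex_eq fun_eq_iff)
    then have "u = abs_l2 (\<lambda>x. 1 * complex_of_real (Re (f x)) + \<i> * complex_of_real (Im (f x)))"
      using f(2) by simp
    also have "\<dots> = abs_l2 (\<lambda>x. 1 * of_real (Re (f x))) + abs_l2 (\<lambda>x. \<i> * of_real (Im (f x)))"
      by (rule abs_l2_add[OF L])
    also have "\<dots> \<in> W"
      by (intro subspace_add[OF W(2)] real_part int) measurable
    finally show ?thesis .
  qed
  then show ?thesis by auto
qed

lemma subspace_closure:
  fixes S :: "'a::real_normed_vector set"
  assumes S: "subspace S"
  shows "subspace (closure S)"
  unfolding subspace_def
proof (intro conjI ballI allI)
  show "0 \<in> closure S" using subspace_0[OF S] closure_subset by blast
next
  fix x y assume "x \<in> closure S" "y \<in> closure S"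
  then obtain X Y where "\<And>n. X n \<in> S" "X \<longlonglongrightarrow> x" "\<And>n. Y n \<in> S" "Y \<longlonglongrightarrow> y"
    unfolding closure_sequential by blast
  then show "x + y \<in> closure S"
    unfolding closure_sequential
    by (intro exI[of _ "\<lambda>n. X n + Y n"]) (auto intro: tendsto_add subspace_add[OF S])
next
  fix c :: real and x assume "x \<in> closure S"
  then obtain X where "\<And>n. X n \<in> S" "X \<longlonglongrightarrow> x" unfolding closure_sequential by blast
  then show "c *\<^sub>R x \<in> closure S"
    unfolding closure_sequential
    by (intro exI[of _ "\<lambda>n. c *\<^sub>R X n"]) (auto intro: tendsto_intros subspace_scale[OF S])
qed

context bessel
begin

text \<open>The complex coefficient belongs to the label, since formal combinations have real
  coefficients only.\<close>

definition gauss_vec :: "complex \<times> complex \<Rightarrow> l2" where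
  "gauss_vec = (\<lambda>(c, p). cscale c (abs_l2 (gauss p)))"

definition gauss_gen :: "complex \<times> complex \<Rightarrow> l2" where
  "gauss_gen = (\<lambda>(c, p). cscale c (cscale (- \<i>) (abs_l2 (gauss_op p))))"

definition gauss_ladder_vec :: "complex \<times> complex \<Rightarrow> l2" where
  "gauss_ladder_vec = (\<lambda>(c, p). cscale c (abs_l2 (gauss_ladder p)))"

definition gauss_shift :: "real \<Rightarrow> complex \<times> complex \<Rightarrow> complex \<times> complex" where
  "gauss_shift t = (\<lambda>(c, p). (c, p + 4 * \<i> * of_real t))"

definition gauss_params :: "(complex \<times> complex) set" where
  "gauss_params = {(c, p). Re p > 0}"

lemma real_gauss_in_span:
  "abs_l2 (\<lambda>x. z * of_real (x powr (\<nu> + 1/2) * exp (- (x\<^sup>2)) * (\<Sum>i\<le>n. a i * exp (- (x\<^sup>2)) ^ i)))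
    \<in> span (gauss_vec ` gauss_params)"
proof -
  \<comment> \<open>For p = 1/(i + 1) the exponential is the power i + 1 of exp (- x^2), so these
    Gaussians realize all monomials in exp (- x^2).\<close>
  define p :: "nat \<Rightarrow> complex" where "p i = 1 / of_nat (Suc i)" for i
  have p: "Re (p i) > 0" for i
  proof -
    have "p i = of_real (1 / real (Suc i))" by (simp add: p_def)
    then show ?thesis by (simp del: of_nat_Suc)
  qed
  define k where "k i = exp (- of_real (\<nu> + 1) * Ln (p i))" for i
  have monom: "z * of_real (x powr (\<nu> + 1/2) * exp (- (x\<^sup>2)) * (a i * exp (- (x\<^sup>2)) ^ i)) =
      a i *\<^sub>R (z / k i * gauss (p i) x)" for i x
  proof -
    have k: "k i \<noteq> 0" by (simp add: k_def)
    have "exp (- of_real (x\<^sup>2) / p i) = complex_of_real (exp (- (x\<^sup>2)) * exp (- (x\<^sup>2)) ^ i)"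
    proof -
      have "- complex_of_real (x\<^sup>2) / p i = of_real (real (Suc i) * - (x\<^sup>2))" by (simp add: p_def)
      then show ?thesis
        by (simp only: exp_of_real exp_of_nat_mult power_Suc)
    qed
    then have "gauss (p i) x = k i * of_real (x powr (\<nu> + 1/2)) * of_real (exp (- (x\<^sup>2)) * exp (- (x\<^sup>2)) ^ i)"
      by (simp only: gauss_def k_def)
    then have "z / k i * gauss (p i) x = z * of_real (x powr (\<nu> + 1/2)) * of_real (exp (- (x\<^sup>2)) * exp (- (x\<^sup>2)) ^ i)"
      using k by simp
    then show ?thesis by (simp add: scaleR_conv_of_real mult_ac)
  qed
  have L: "(\<lambda>x. a i *\<^sub>R (z / k i * gauss (p i) x)) \<in> L2" for i
    by (intro L2_scaleR L2_cmult gauss_L2 p)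
  have "abs_l2 (\<lambda>x. z * of_real (x powr (\<nu> + 1/2) * exp (- (x\<^sup>2)) * (\<Sum>i\<le>n. a i * exp (- (x\<^sup>2)) ^ i)))
      = abs_l2 (\<lambda>x. \<Sum>i\<le>n. a i *\<^sub>R (z / k i * gauss (p i) x))"
    by (simp only: monom[symmetric] sum_distrib_left of_real_sum)
  also have "\<dots> = (\<Sum>i\<le>n. a i *\<^sub>R gauss_vec (z / k i, p i))"
    by (simp only: abs_l2_sum[OF L] abs_l2_scaleR[OF L2_cmult[OF gauss_L2[OF p]]]
        abs_l2_cmult[OF gauss_L2[OF p]] gauss_vec_def prod.case)
  also have "\<dots> \<in> span (gauss_vec ` gauss_params)"
    by (intro span_sum span_scale span_base imageI) (simp add: gauss_params_def p)
  finally show ?thesis .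
qed

text \<open>In the variable y = exp (- x^2) this is the Weierstrass theorem on [0, 1]. One factor
  exp (- x^2) is kept in the weight \<open>E\<close>: it admits polynomials with constant term, and
  it dominates the approximants.\<close>

lemma gauss_span_dense: "closure (span (gauss_vec ` gauss_params)) = UNIV"
proof (rule l2_closed_subspace_eq_UNIV)
  fix r :: "real \<Rightarrow> real" and c d :: real and z :: complex
  assume r: "continuous_on UNIV r" and c: "0 < c" and r0: "\<And>x. x \<notin> {c..d} \<Longrightarrow> r x = 0"
  define E where "E x = x powr (\<nu> + 1/2) * exp (- (x\<^sup>2))" for x
  define F where "F x = r x * (x powr - (\<nu> + 1/2) * exp (x\<^sup>2))" for x
  have EF: "E x * F x = r x" if "x > 0" for x
    using that by (simp add: E_def F_def powr_minus exp_minus field_simps)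
  have F0: "F x = 0" if "x \<notin> {c..d}" for x using r0[OF that] by (simp add: F_def)
  define D where "D = max c d + 1"
  have D: "D > 0" "d < D" "c < D" using c by (auto simp: D_def)
  \<comment> \<open>Undoing y = exp (- x^2) with two clamps: the inner one keeps the logarithm
    finite at y = 0, the outer one keeps the argument of F away from 0. Both act only where F
    vanishes, since D > d and c/2 < c.\<close>
  define H where "H y = F (max (c/2) (sqrt (- ln (max y (exp (- (D\<^sup>2)))))))" for y
  have cF: "continuous_on {c/2..} F"
    unfolding F_def using c by (intro continuous_intros continuous_on_subset[OF r]) auto
  have cH: "continuous_on {0..1} H"
  proof -
    have "continuous_on {0..1} (\<lambda>y. max (c/2) (sqrt (- ln (max y (exp (- (D\<^sup>2)))))))"
      by (intro continuous_intros continuous_on_max) (auto simp: max_def dest: less_le_trans[OF exp_gt_zero])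
    then show ?thesis unfolding H_def
      by (rule continuous_on_compose2[OF cF]) auto
  qed
  have HF: "H (exp (- (x\<^sup>2))) = F x" if x: "x > 0" for x
  proof -
    have m: "max (exp (- (x\<^sup>2))) (exp (- (D\<^sup>2))) = exp (- ((min x D)\<^sup>2))"
      using x D by (cases "x \<le> D") (auto simp: max_def min_def power2_le_iff_abs_le abs_le_square_iff[symmetric])
    have "sqrt ((min x D)\<^sup>2) = min x D" using x D by simp
    then have h: "H (exp (- (x\<^sup>2))) = F (max (c/2) (min x D))" unfolding H_def m by simp
    show ?thesis
    proof (cases "c/2 \<le> x \<and> x \<le> D")
      case True then show ?thesis using h by (simp add: max_def)
    next
      case False
      then have "max (c/2) (min x D) \<notin> {c..d}" "x \<notin> {c..d}" using c D by (auto simp: max_def min_def)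
      then show ?thesis using h F0 by simp
    qed
  qed
  obtain B where B: "\<And>y. y \<in> {0..1} \<Longrightarrow> \<bar>H y\<bar> \<le> B"
    using compact_imp_bounded[OF compact_continuous_image[OF cH compact_Icc]]
    unfolding bounded_iff by (metis image_eqI real_norm_def)
  have "\<exists>g. real_polynomial_function g \<and> (\<forall>y\<in>{0..1}. \<bar>H y - g y\<bar> < inverse (real (Suc n)))" for n
    using Stone_Weierstrass_real_polynomial_function[OF compact_Icc cH, of "inverse (real (Suc n))"]
    by (metis inverse_positive_iff_positive of_nat_0_less_iff zero_less_Suc)
  then obtain g where g: "\<And>n. real_polynomial_function (g n)"
    "\<And>n y. y \<in> {0..1} \<Longrightarrow> \<bar>H y - g n y\<bar> < inverse (real (Suc n))" by metis
  define h where "h n x = z * of_real (E x * g n (exp (- (x\<^sup>2))))" for n x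
  have hW: "abs_l2 (h n) \<in> closure (span (gauss_vec ` gauss_params))" for n
  proof -
    obtain a N where "g n = (\<lambda>y. \<Sum>i\<le>N. a i * y ^ i)"
      using g(1)[of n] unfolding real_polynomial_function_iff_sum by blast
    then have "abs_l2 (h n) \<in> span (gauss_vec ` gauss_params)"
      using real_gauss_in_span[where z=z and n=N and a=a] by (simp only: h_def[abs_def] E_def)
    then show ?thesis using closure_subset by blast
  qed
  have "(\<lambda>n. abs_l2 (h n)) \<longlonglongrightarrow> abs_l2 (\<lambda>x. z * of_real (r x))"
  proof (rule abs_l2_dominated_convergence(2))
    show "integrable half_line (\<lambda>x. (cmod z * (B + 1))\<^sup>2 * (x powr (2 * (\<nu> + 1/2)) * exp (2 * 0 * x - 2 * 1 * x\<^sup>2)))"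
      using \<nu>_nonneg by (intro Bochner_Integration.integrable_mult_right integrable_powr_exp_quadratic) auto
    show "(cmod (h n x))\<^sup>2 \<le> (cmod z * (B + 1))\<^sup>2 * (x powr (2 * (\<nu> + 1/2)) * exp (2 * 0 * x - 2 * 1 * x\<^sup>2))"
      if x: "x > 0" for n x
    proof (rule gaussian_dominated_square[OF x])
      have y: "exp (- (x\<^sup>2)) \<in> {0..1}" by simp
      have "inverse (real (Suc n)) \<le> 1" by (simp add: inverse_le_1_iff)
      then have "\<bar>g n (exp (- (x\<^sup>2)))\<bar> \<le> B + 1" using B[OF y] g(2)[OF y, of n] by linarith
      then have "cmod z * (E x * \<bar>g n (exp (- (x\<^sup>2)))\<bar>) \<le> cmod z * (E x * (B + 1))"
        by (intro mult_left_mono) (auto simp: E_def)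
      moreover have "E x \<ge> 0" by (simp add: E_def)
      then have "cmod (h n x) = cmod z * (E x * \<bar>g n (exp (- (x\<^sup>2)))\<bar>)"
        by (simp only: h_def norm_mult norm_of_real abs_mult abs_of_nonneg)
      moreover have "cmod z * (E x * (B + 1)) = cmod z * (B + 1) * (x powr (\<nu> + 1/2) * exp (0 * x - 1 * x\<^sup>2))"
        by (simp add: E_def)
      ultimately show "cmod (h n x) \<le> cmod z * (B + 1) * (x powr (\<nu> + 1/2) * exp (0 * x - 1 * x\<^sup>2))"
        by linarith
    qed
    have "continuous_on UNIV (g n)" for n
      using g(1)[of n] by (simp add: continuous_on_polymonial_function real_polynomial_function_eq)
    then have "continuous_on {0<..} (\<lambda>x. g n (exp (- (x\<^sup>2))))" for n
      by (rule continuous_on_compose2) (auto intro!: continuous_intros)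
    then have "continuous_on {0<..} (h n)" for n
      unfolding h_def E_def by (intro continuous_intros) auto
    then show "h n \<in> borel_measurable half_line" for n by (rule measurable_half_line_continuous)
    show "(\<lambda>x. z * of_real (r x)) \<in> borel_measurable half_line"
      by (intro measurable_half_line_continuous continuous_intros continuous_on_subset[OF r]) auto
    show "AE x in half_line. (\<lambda>n. h n x) \<longlonglongrightarrow> z * of_real (r x)"
    proof (rule AE_half_lineI)
      fix x :: real assume x: "x > 0"
      let ?y = "exp (- (x\<^sup>2))"
      have "(\<lambda>n. g n ?y) \<longlonglongrightarrow> H ?y"
        using g(2)[of ?y] by (intro tendsto_if_norm_diff_less_inverse) simp
      then have "(\<lambda>n. h n x) \<longlonglongrightarrow> z * of_real (E x * H ?y)"
        unfolding h_def by (intro tendsto_intros)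
      then show "(\<lambda>n. h n x) \<longlonglongrightarrow> z * of_real (r x)" by (simp only: HF[OF x] EF[OF x])
    qed
  qed
  from closed_sequentially[OF closed_closure hW this]
  show "abs_l2 (\<lambda>x. z * of_real (r x)) \<in> closure (span (gauss_vec ` gauss_params))" .
qed (auto intro!: subspace_closure subspace_span)

section \<open>The Schroedinger group\<close>

lemma form_graph_gauss:
  assumes "(f, b) \<in> form_graph" "Re p > 0"
  shows "cinner b (abs_l2 (gauss_ladder p)) = cinner f (abs_l2 (gauss_op p))"
proof -
  obtain \<psi> where \<psi>: "\<And>n. \<psi> n \<in> test_functions" "(\<lambda>n. abs_l2 (\<psi> n)) \<longlonglongrightarrow> f"
    "(\<lambda>n. abs_l2 (ladder (\<psi> n))) \<longlonglongrightarrow> b" using assms(1) unfolding form_graph_iff by blast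
  show ?thesis
    using tendsto_cinner[OF \<psi>(3) tendsto_const[of "abs_l2 (gauss_ladder p)"]]
      tendsto_cinner[OF \<psi>(2) tendsto_const[of "abs_l2 (gauss_op p)"]]
    unfolding gauss_test_function_pairing[OF assms(2) \<psi>(1)] by (rule LIMSEQ_unique)
qed

sublocale gauss: dense_evolution gauss_vec gauss_gen gauss_shift gauss_params
proof
  fix a b :: "complex \<times> complex" and s t :: real
  obtain c p where a: "a = (c, p)" by force
  obtain d q where b: "b = (d, q)" by force
  show "gauss_shift 0 a = a" "gauss_shift s (gauss_shift t a) = gauss_shift (s + t) a"
    by (simp_all add: gauss_shift_def a algebra_simps)
  show "a \<in> gauss_params \<Longrightarrow> gauss_shift t a \<in> gauss_params"
    by (simp add: gauss_shift_def gauss_params_def a)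
  show "((\<lambda>t. gauss_vec (gauss_shift t a)) has_vector_derivative gauss_gen a) (at 0)" if "a \<in> gauss_params"
    using bounded_linear.has_vector_derivative[OF bounded_linear_cscale has_vector_derivative_gauss_l2[of p], of c] that
    by (simp add: gauss_vec_def gauss_gen_def gauss_shift_def gauss_params_def a)
  show "inner (gauss_gen a) (gauss_vec b) + inner (gauss_vec a) (gauss_gen b) = 0"
    if "a \<in> gauss_params" "b \<in> gauss_params"
  proof -
    have p: "Re p > 0" "Re q > 0" using that by (auto simp: gauss_params_def a b)
    \<comment> \<open>Both pairings of a Gaussian with the image of the other equal the form value
      of the two, which is symmetric; the factors - i and their conjugates then give the opposite
      signs.\<close>
    have 1: "cinner (abs_l2 (gauss p)) (abs_l2 (gauss_op q)) = cinner (abs_l2 (gauss_ladder p)) (abs_l2 (gauss_ladder q))"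
      using form_graph_gauss[OF gauss_form_graph[OF p(1)] p(2)] by simp
    have "cinner (abs_l2 (gauss_op p)) (abs_l2 (gauss q)) = cnj (cinner (abs_l2 (gauss q)) (abs_l2 (gauss_op p)))"
      by (simp add: cinner_cnj)
    also have "\<dots> = cinner (abs_l2 (gauss_ladder p)) (abs_l2 (gauss_ladder q))"
      using form_graph_gauss[OF gauss_form_graph[OF p(2)] p(1)] by (metis cinner_cnj)
    finally show ?thesis
      by (simp only: a b inner_l2_def gauss_gen_def gauss_vec_def prod.case cinner_cscale_left cinner_cscale_right 1)
        (simp add: algebra_simps)
  qed
qed (rule gauss_span_dense)

end

section \<open>Passage between groups on representatives and groups on classes\<close>

lemma norm_abs_l2_quotient:
  assumes "u \<in> L2" "f \<in> L2" "g \<in> L2"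
  shows "l2_norm (\<lambda>x. (u x - f x) / of_real t - g x) = norm ((abs_l2 u - abs_l2 f) /\<^sub>R t - abs_l2 g)"
proof -
  have "(\<lambda>x. (u x - f x) / of_real t - g x) = (\<lambda>x. inverse t *\<^sub>R (u x - f x) - g x)"
    by (simp add: scaleR_conv_of_real divide_inverse mult.commute)
  then show ?thesis
    using assms by (simp add: L2_diff L2_scaleR abs_l2_diff abs_l2_scaleR flip: norm_abs_l2)
qed

text \<open>That U respects equality almost everywhere is not part of \<open>unitary_group\<close>.
  It follows from linearity and preservation of norms: the images of two representatives differ by
  the image of a function of norm 0.\<close>

lemma unitary_group_imp_isometry_group:
  assumes U: "unitary_group U"
  obtains X where "isometry_group X"
    "\<And>t f. f \<in> L2 \<Longrightarrow> U t f \<in> L2" "\<And>t f. f \<in> L2 \<Longrightarrow> abs_l2 (U t f) = X t (abs_l2 f)"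
    "\<And>f g. (f, g) \<in> group_generator U \<longleftrightarrow>
      f \<in> L2 \<and> g \<in> L2 \<and> isometry_group.generates X (abs_l2 f) (abs_l2 g)"
proof -
  define X where "X t u = abs_l2 (U t (rep_l2 u))" for t u
  have UL: "U t f \<in> L2" and Un: "l2_norm (U t f) = l2_norm f" if "f \<in> L2" for t f
    using U that unfolding unitary_group_def by blast+
  have lin: "abs_l2 (U t (\<lambda>y. f y + c * g y)) = abs_l2 (U t f) + cscale c (abs_l2 (U t g))"
    if "f \<in> L2" "g \<in> L2" for t c f g
  proof -
    have "AE x in half_line. U t (\<lambda>y. f y + c * g y) x = U t f x + c * U t g x"
      using U that unfolding unitary_group_def by blast
    then have "abs_l2 (U t (\<lambda>y. f y + c * g y)) = abs_l2 (\<lambda>x. U t f x + c * U t g x)"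
      using that UL by (subst abs_l2_eq_iff) (auto intro!: L2_add L2_cmult)
    then show ?thesis using that UL by (simp add: abs_l2_add abs_l2_cmult L2_cmult)
  qed
  have UX: "abs_l2 (U t f) = X t (abs_l2 f)" if f: "f \<in> L2" for t f
  proof -
    let ?r = "rep_l2 (abs_l2 f)"
    have "abs_l2 (U t f) - X t (abs_l2 f) = abs_l2 (U t (\<lambda>y. f y + (- 1) * ?r y))"
      using lin[OF f, of ?r t "- 1"] cscale_of_real[of "- 1"] by (simp add: X_def)
    also have "norm \<dots> = l2_norm (\<lambda>y. f y + (- 1) * ?r y)"
      using f by (subst norm_abs_l2) (auto intro!: UL Un L2_add L2_cmult)
    also have "\<dots> = norm (abs_l2 (\<lambda>y. f y + (- 1) * ?r y))"
      using f by (subst norm_abs_l2) (auto intro!: L2_add L2_cmult)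
    also have "abs_l2 (\<lambda>y. f y + (- 1) * ?r y) = 0"
      using abs_l2_diff[OF f rep_l2_L2[of "abs_l2 f"]] by simp
    finally show ?thesis by simp
  qed
  have X: "isometry_group X"
  proof
    fix t s r :: real and u v :: l2
    show "X t (u + v) = X t u + X t v"
    proof -
      have "X t (u + v) = X t (abs_l2 (\<lambda>x. rep_l2 u x + 1 * rep_l2 v x))"
        by (simp add: abs_l2_add)
      also have "\<dots> = abs_l2 (U t (\<lambda>x. rep_l2 u x + 1 * rep_l2 v x))"
        by (rule UX[symmetric]) (auto intro!: L2_add)
      also have "\<dots> = X t u + X t v" by (subst lin) (simp_all add: UX)
      finally show ?thesis .
    qed
    show "X t (r *\<^sub>R u) = r *\<^sub>R X t u"
    proof -
      have "X t (r *\<^sub>R u + (0 :: l2)) = X t (abs_l2 (\<lambda>x. 0 + of_real r * rep_l2 u x))"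
        by (simp add: abs_l2_cmult cscale_of_real)
      also have "\<dots> = abs_l2 (U t (\<lambda>x. 0 + of_real r * rep_l2 u x))"
        by (rule UX[symmetric]) (auto intro!: L2_cmult)
      also have "\<dots> = abs_l2 (U t (\<lambda>_. 0)) + r *\<^sub>R X t u"
        by (subst lin) (simp_all add: UX cscale_of_real)
      also have "norm (abs_l2 (U t (\<lambda>_. 0))) = l2_norm (\<lambda>_. 0)"
        by (simp only: norm_abs_l2[OF UL[OF L2_zero]] Un[OF L2_zero])
      then have "norm (abs_l2 (U t (\<lambda>_. 0))) = 0" by (simp add: l2_norm_def)
      then have "abs_l2 (U t (\<lambda>_. 0)) = 0" by simp
      finally show ?thesis by simp
    qed
    show "norm (X t u) = norm u"
      unfolding X_def by (simp add: norm_abs_l2 UL Un) (simp flip: norm_abs_l2)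
    have "AE x in half_line. U 0 (rep_l2 u) x = rep_l2 u x" using U unfolding unitary_group_def by simp
    then show "X 0 u = u" unfolding X_def by (subst (2) abs_rep_l2[symmetric]) (simp add: abs_l2_eq_iff UL del: abs_rep_l2)
    have "AE x in half_line. U (s + t) (rep_l2 u) x = U s (U t (rep_l2 u)) x"
      using U unfolding unitary_group_def by simp
    then have "X (s + t) u = abs_l2 (U s (U t (rep_l2 u)))"
      unfolding X_def by (simp add: abs_l2_eq_iff UL)
    then show "X (s + t) u = X s (X t u)" by (simp add: UX UL)
    have "((\<lambda>t. l2_norm (\<lambda>x. U t (rep_l2 u) x - rep_l2 u x)) \<longlongrightarrow> 0) (at 0)"
      using U unfolding unitary_group_def by simp
    then have "((\<lambda>t. norm (X t u - u)) \<longlongrightarrow> 0) (at 0)"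
      by (simp add: UL L2_diff abs_l2_diff UX flip: norm_abs_l2)
    then show "((\<lambda>t. X t u) \<longlongrightarrow> u) (at 0)"
      by (simp add: tendsto_norm_zero_iff LIM_zero_iff)
  qed
  have "(f, g) \<in> group_generator U \<longleftrightarrow> f \<in> L2 \<and> g \<in> L2 \<and> isometry_group.generates X (abs_l2 f) (abs_l2 g)" for f g
  proof (cases "f \<in> L2 \<and> g \<in> L2")
    case True
    interpret isometry_group X by (rule X)
    have "l2_norm (\<lambda>x. (U t f x - f x) / of_real t - g x) = norm ((X (0 + t) (abs_l2 f) - X 0 (abs_l2 f)) /\<^sub>R t - abs_l2 g)" for t
      using True by (subst norm_abs_l2_quotient) (auto simp: UX UL U_0)
    then show ?thesis
      using True by (simp add: group_generator_def generates_def has_vector_derivative_iff_quotient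
          tendsto_norm_zero_iff LIM_zero_iff)
  qed (auto simp: group_generator_def)
  from that[OF X UL UX this] show thesis .
qed

text \<open>Choosing representatives of classes gives a unitary group in the sense of the
  definition. Commutation with complex scalars enters as a hypothesis because
  \<open>isometry_group\<close> records real linearity only.\<close>

lemma isometry_group_imp_unitary_group:
  fixes E :: "real \<Rightarrow> l2 \<Rightarrow> l2"
  assumes E: "isometry_group E" and c: "\<And>t c u. E t (cscale c u) = cscale c (E t u)"
  defines "U \<equiv> \<lambda>t f. rep_l2 (E t (abs_l2 f))"
  shows "unitary_group U"
    "(f, g) \<in> group_generator U \<longleftrightarrow> f \<in> L2 \<and> g \<in> L2 \<and> isometry_group.generates E (abs_l2 f) (abs_l2 g)"
proof -
  interpret isometry_group E by (rule E)
  show "unitary_group U"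
    unfolding unitary_group_def
  proof (intro conjI ballI allI)
    fix f g :: "real \<Rightarrow> complex" and t s :: real and c :: complex
    assume f: "f \<in> L2"
    show "U t f \<in> L2" by (simp add: U_def)
    show "l2_norm (U t f) = l2_norm f"
      using f by (simp add: U_def norm_U flip: norm_abs_l2)
    show "AE x in half_line. U 0 f x = f x"
      using rep_abs_l2[OF f] by (simp add: U_def U_0)
    show "AE x in half_line. U (s + t) f x = U s (U t f) x"
      by (simp add: U_def U_plus)
    have "l2_norm (\<lambda>x. U t f x - f x) = norm (E t (abs_l2 f) - abs_l2 f)" for t
      using f by (simp add: U_def L2_diff abs_l2_diff flip: norm_abs_l2)
    then show "((\<lambda>t. l2_norm (\<lambda>x. U t f x - f x)) \<longlongrightarrow> 0) (at 0)"
      using U_continuous_0[of "abs_l2 f"] by (simp add: tendsto_norm_zero_iff LIM_zero_iff)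
    assume g: "g \<in> L2"
    have "abs_l2 (U t (\<lambda>y. f y + c * g y)) = abs_l2 (\<lambda>x. U t f x + c * U t g x)"
      using f g by (simp add: U_def abs_l2_add abs_l2_cmult L2_cmult U_add assms(2))
    then show "AE x in half_line. U t (\<lambda>y. f y + c * g y) x = U t f x + c * U t g x"
      by (subst (asm) abs_l2_eq_iff) (auto simp: U_def intro!: L2_add L2_cmult)
  qed
  show "(f, g) \<in> group_generator U \<longleftrightarrow> f \<in> L2 \<and> g \<in> L2 \<and> generates (abs_l2 f) (abs_l2 g)"
  proof (cases "f \<in> L2 \<and> g \<in> L2")
    case True
    have "l2_norm (\<lambda>x. (U t f x - f x) / of_real t - g x) = norm ((E (0 + t) (abs_l2 f) - E 0 (abs_l2 f)) /\<^sub>R t - abs_l2 g)" for t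
      using True by (subst norm_abs_l2_quotient) (auto simp: U_def U_0)
    then show ?thesis
      using True by (simp add: group_generator_def generates_def has_vector_derivative_iff_quotient
          tendsto_norm_zero_iff LIM_zero_iff)
  qed (auto simp: group_generator_def)
qed

section \<open>The generator of the Gaussian evolution is - i times the Friedrichs extension\<close>

context bessel
begin

text \<open>The form of a difference of test functions is the squared distance of their
  \<open>ladder\<close> values. A form-Cauchy sequence therefore has convergent
  \<open>ladder\<close> values, by completeness, and the form domain is the domain of
  \<open>form_graph\<close>.\<close>

lemma H_bessel_iff:
  "(f, g) \<in> H_bessel \<nu> \<longleftrightarrow> f \<in> L2 \<and> g \<in> L2 \<and> (\<exists>b. (abs_l2 f, b) \<in> form_graph) \<and>
     (\<forall>\<phi>\<in>test_functions. cinner (abs_l2 (bessel_op \<phi>)) (abs_l2 f) = cinner (abs_l2 \<phi>) (abs_l2 g))"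
proof (cases "f \<in> L2 \<and> g \<in> L2")
  case True
  have adj: "(f, g) \<in> l2_adjoint (bessel_minimal \<nu>) \<longleftrightarrow>
      (\<forall>\<phi>\<in>test_functions. cinner (abs_l2 (bessel_op \<phi>)) (abs_l2 f) = cinner (abs_l2 \<phi>) (abs_l2 g))"
    using True by (auto simp: l2_adjoint_def bessel_minimal_eq cinner_abs_l2 test_function_L2 bessel_op_L2)
  have q: "l2_inner (\<lambda>x. bessel_op (\<phi> m) x - bessel_op (\<phi> n) x) (\<lambda>x. \<phi> m x - \<phi> n x) =
      of_real ((dist (abs_l2 (ladder (\<phi> m))) (abs_l2 (ladder (\<phi> n))))\<^sup>2)"
    if \<phi>: "\<And>n. \<phi> n \<in> test_functions" for \<phi> :: "nat \<Rightarrow> real \<Rightarrow> complex" and m n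
  proof -
    have s: "cinner (abs_l2 (bessel_op (\<phi> i))) (abs_l2 (\<phi> j)) = cinner (abs_l2 (ladder (\<phi> i))) (abs_l2 (ladder (\<phi> j)))" for i j
      using \<phi> by (simp add: cinner_abs_l2 test_function_L2 bessel_op_L2 ladder_L2 test_function_form)
    have d: "cinner (u - v) (w - z) = cinner u w - cinner u z - cinner v w + cinner v z" for u v w z
      using cinner_add_left[of "u - v" v] cinner_add_right[of _ "w - z" z] by (simp add: algebra_simps) 
    have "l2_inner (\<lambda>x. bessel_op (\<phi> m) x - bessel_op (\<phi> n) x) (\<lambda>x. \<phi> m x - \<phi> n x) =
        cinner (abs_l2 (bessel_op (\<phi> m)) - abs_l2 (bessel_op (\<phi> n))) (abs_l2 (\<phi> m) - abs_l2 (\<phi> n))"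
      using \<phi> by (simp add: test_function_L2 bessel_op_L2 L2_diff flip: abs_l2_diff cinner_abs_l2)
    also have "\<dots> = cinner (abs_l2 (ladder (\<phi> m)) - abs_l2 (ladder (\<phi> n))) (abs_l2 (ladder (\<phi> m)) - abs_l2 (ladder (\<phi> n)))"
      by (simp only: d s)
    also have "\<dots> = of_real ((dist (abs_l2 (ladder (\<phi> m))) (abs_l2 (ladder (\<phi> n))))\<^sup>2)"
      by (subst cinner_self_real) (simp only: dist_norm power2_norm_eq_inner inner_l2_def)
    finally show ?thesis .
  qed
  have form: "f \<in> form_domain (bessel_minimal \<nu>) \<longleftrightarrow> (\<exists>b. (abs_l2 f, b) \<in> form_graph)"
  proof
    assume "f \<in> form_domain (bessel_minimal \<nu>)"
    then obtain \<phi> \<psi> where "\<And>n::nat. (\<phi> n, \<psi> n) \<in> bessel_minimal \<nu>"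
      and lim: "(\<lambda>n. l2_norm (\<lambda>x. \<phi> n x - f x)) \<longlonglongrightarrow> 0"
      and C: "\<And>\<epsilon>. \<epsilon> > 0 \<Longrightarrow> \<exists>N. \<forall>m\<ge>N. \<forall>n\<ge>N.
        cmod (l2_inner (\<lambda>x. \<psi> m x - \<psi> n x) (\<lambda>x. \<phi> m x - \<phi> n x)) < \<epsilon>"
      unfolding form_domain_def by blast
    then have \<phi>: "\<And>n. \<phi> n \<in> test_functions" and \<psi>: "\<And>n. \<psi> n = bessel_op (\<phi> n)"
      by (auto simp: bessel_minimal_eq)
    have "Cauchy (\<lambda>n. abs_l2 (ladder (\<phi> n)))"
    proof (rule metric_CauchyI)
      fix e :: real assume e: "e > 0"
      then obtain N where N: "\<And>m n. m \<ge> N \<Longrightarrow> n \<ge> N \<Longrightarrow>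
          cmod (l2_inner (\<lambda>x. \<psi> m x - \<psi> n x) (\<lambda>x. \<phi> m x - \<phi> n x)) < e\<^sup>2"
        using C[of "e\<^sup>2"] by (metis zero_less_power)
      have "dist (abs_l2 (ladder (\<phi> m))) (abs_l2 (ladder (\<phi> n))) < e" if "m \<ge> N" "n \<ge> N" for m n
        using N[OF that] e unfolding \<psi> q[of \<phi>, OF \<phi>] norm_of_real by (intro power2_less_imp_less[of _ e]) auto
      then show "\<exists>M. \<forall>m\<ge>M. \<forall>n\<ge>M. dist (abs_l2 (ladder (\<phi> m))) (abs_l2 (ladder (\<phi> n))) < e" by blast
    qed
    then obtain b where "(\<lambda>n. abs_l2 (ladder (\<phi> n))) \<longlonglongrightarrow> b"
      using Cauchy_convergent convergent_def by blast
    moreover have "(\<lambda>n. abs_l2 (\<phi> n)) \<longlonglongrightarrow> abs_l2 f"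
    proof -
      have "(\<lambda>n. norm (abs_l2 (\<phi> n) - abs_l2 f)) \<longlonglongrightarrow> 0"
        using lim \<phi> True by (simp add: test_function_L2 L2_diff abs_l2_diff flip: norm_abs_l2)
      then show ?thesis by (simp add: tendsto_norm_zero_iff LIM_zero_iff)
    qed
    ultimately show "\<exists>b. (abs_l2 f, b) \<in> form_graph" unfolding form_graph_iff using \<phi> by blast
  next
    assume "\<exists>b. (abs_l2 f, b) \<in> form_graph"
    then obtain b \<phi> where \<phi>: "\<And>n::nat. \<phi> n \<in> test_functions" "(\<lambda>n. abs_l2 (\<phi> n)) \<longlonglongrightarrow> abs_l2 f"
      "(\<lambda>n. abs_l2 (ladder (\<phi> n))) \<longlonglongrightarrow> b" unfolding form_graph_iff by blast
    have "(\<lambda>n. norm (abs_l2 (\<phi> n) - abs_l2 f)) \<longlonglongrightarrow> 0"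
      using \<phi>(2) by (simp add: tendsto_norm_zero_iff LIM_zero_iff)
    then have 1: "(\<lambda>n. l2_norm (\<lambda>x. \<phi> n x - f x)) \<longlonglongrightarrow> 0"
      using \<phi>(1) True by (simp add: test_function_L2 L2_diff abs_l2_diff flip: norm_abs_l2)
    have 2: "\<exists>N. \<forall>m\<ge>N. \<forall>n\<ge>N. cmod (l2_inner (\<lambda>x. bessel_op (\<phi> m) x - bessel_op (\<phi> n) x) (\<lambda>x. \<phi> m x - \<phi> n x)) < e"
      if e: "e > 0" for e
    proof -
      obtain N where N: "\<And>m n. m \<ge> N \<Longrightarrow> n \<ge> N \<Longrightarrow> dist (abs_l2 (ladder (\<phi> m))) (abs_l2 (ladder (\<phi> n))) < sqrt e"
        using metric_CauchyD[OF LIMSEQ_imp_Cauchy[OF \<phi>(3)], of "sqrt e"] e by auto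
      have "cmod (l2_inner (\<lambda>x. bessel_op (\<phi> m) x - bessel_op (\<phi> n) x) (\<lambda>x. \<phi> m x - \<phi> n x)) < e"
        if "m \<ge> N" "n \<ge> N" for m n
      proof -
        have "(dist (abs_l2 (ladder (\<phi> m))) (abs_l2 (ladder (\<phi> n))))\<^sup>2 < (sqrt e)\<^sup>2"
          by (rule power_strict_mono[OF N[OF that]]) auto
        then show ?thesis using e unfolding q[of \<phi>, OF \<phi>(1)] norm_of_real by simp
      qed
      then show ?thesis by blast
    qed
    show "f \<in> form_domain (bessel_minimal \<nu>)"
      unfolding form_domain_def mem_Collect_eq
      by (rule conjI, use True in blast, rule exI[of _ \<phi>], rule exI[of _ "\<lambda>n. bessel_op (\<phi> n)"])
        (use 1 2 \<phi>(1) in \<open>auto simp: bessel_minimal_eq\<close>)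
  qed
  show ?thesis
    using adj form True by (auto simp: H_bessel_def friedrichs_extension_def)
qed (auto simp: H_bessel_def friedrichs_extension_def l2_adjoint_def)

lemma i_mult_mult_i: "\<i> * (z * (w * \<i>)) = - (z * w)"
  by (simp add: complex_eq_iff algebra_simps)

text \<open>The facts about single Gaussians, extended by linearity. Since \<open>gauss_gen\<close>
  stands for - i H, the image under H is i times its combination.\<close>

lemma gauss_combo_form:
  assumes "gauss.valid xs"
  shows "(gauss.combo gauss_vec xs, gauss.combo gauss_ladder_vec xs) \<in> form_graph"
    "(f, b) \<in> form_graph \<Longrightarrow>
      cinner b (gauss.combo gauss_ladder_vec xs) = cinner f (cscale \<i> (gauss.combo gauss_gen xs))"
    "\<phi> \<in> test_functions \<Longrightarrow>
      cinner (abs_l2 (bessel_op \<phi>)) (gauss.combo gauss_vec xs) = cinner (abs_l2 \<phi>) (cscale \<i> (gauss.combo gauss_gen xs))"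
proof -
  show "(gauss.combo gauss_vec xs, gauss.combo gauss_ladder_vec xs) \<in> form_graph" using assms
  proof (induction xs)
    case Nil
    have "(\<lambda>_. 0) = ladder (\<lambda>_. 0)" by (auto simp: ladder_def vderiv_def fun_eq_iff)
    then have "(0, 0) \<in> {(abs_l2 \<phi>, abs_l2 (ladder \<phi>)) | \<phi>. \<phi> \<in> test_functions}"
      using zero_test_function abs_l2_zero by fastforce
    then have "(0, 0) \<in> form_graph" unfolding form_graph_def by (rule subsetD[OF closure_subset])
    then show ?case by simp
  next
    case (Cons x xs)
    obtain r c p where x: "x = (r, c, p)" by (metis prod.exhaust)
    have "(c, p) \<in> gauss_params" using Cons.prems x by simp
    then have p: "Re p > 0" by (simp add: gauss_params_def)
    from form_graph_add_cscale[OF Cons.IH gauss_form_graph[OF p], of "r * c"] Cons.prems x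
    show ?case by (simp add: gauss_vec_def gauss_ladder_vec_def cscale_cscale add.commute flip: cscale_of_real)
  qed
  show "cinner b (gauss.combo gauss_ladder_vec xs) = cinner f (cscale \<i> (gauss.combo gauss_gen xs))"
    if fb: "(f, b) \<in> form_graph" using assms
  proof (induction xs)
    case Nil
    then show ?case using cinner_cscale_right[of b 0 0] cinner_cscale_right[of f 0 0] by simp
  next
    case (Cons x xs)
    obtain r c p where x: "x = (r, c, p)" by (metis prod.exhaust)
    have "(c, p) \<in> gauss_params" using Cons.prems x by simp
    then have p: "Re p > 0" by (simp add: gauss_params_def)
    show ?case using Cons x form_graph_gauss[OF fb p]
      by (simp add: gauss_gen_def gauss_ladder_vec_def cscale_cscale cinner_add_right cinner_cscale_right cscale_add_right
          i_mult_mult_i flip: cscale_of_real)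
  qed
  show "cinner (abs_l2 (bessel_op \<phi>)) (gauss.combo gauss_vec xs) = cinner (abs_l2 \<phi>) (cscale \<i> (gauss.combo gauss_gen xs))"
    if \<phi>: "\<phi> \<in> test_functions" using assms
  proof (induction xs)
    case Nil
    then show ?case using cinner_cscale_right[of _ 0 0] by simp
  next
    case (Cons x xs)
    obtain r c p where x: "x = (r, c, p)" by (metis prod.exhaust)
    have "(c, p) \<in> gauss_params" using Cons.prems x by simp
    then have p: "Re p > 0" by (simp add: gauss_params_def)
    have "cinner (abs_l2 (bessel_op \<phi>)) (abs_l2 (gauss p)) = cinner (abs_l2 \<phi>) (abs_l2 (gauss_op p))"
      using form_graph_form[OF gauss_form_graph[OF p] \<phi>] gauss_test_function_pairing[OF p \<phi>] by simp
    then show ?case using Cons x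
      by (simp add: gauss_gen_def gauss_vec_def cscale_cscale cinner_add_right cinner_cscale_right cscale_add_right
          i_mult_mult_i flip: cscale_of_real)
  qed
qed

text \<open>Core sums converge to the pair in the graph norm. This passes the adjoint relation to
  the limit, and the estimate \<open>d\<close> below makes the \<open>ladder\<close> values of the
  sums Cauchy, so that the limit is in the form domain.\<close>

lemma generates_imp_form:
  assumes "gauss.generates f k"
  shows "\<exists>b. (f, b) \<in> form_graph"
    "\<phi> \<in> test_functions \<Longrightarrow> cinner (abs_l2 (bessel_op \<phi>)) f = cinner (abs_l2 \<phi>) (cscale \<i> k)"
proof -
  have "\<exists>xs. gauss.valid xs \<and> norm (f - gauss.combo gauss_vec xs) < inverse (real (Suc n)) \<and>
      norm (k - gauss.combo gauss_gen xs) < inverse (real (Suc n))" for n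
    using gauss.core_approximates[OF assms, of "inverse (real (Suc n))"] by fastforce
  then obtain X where X: "\<And>n. gauss.valid (X n)"
    "\<And>n. norm (f - gauss.combo gauss_vec (X n)) < inverse (real (Suc n))"
    "\<And>n. norm (k - gauss.combo gauss_gen (X n)) < inverse (real (Suc n))" by metis
  let ?v = "\<lambda>n. gauss.combo gauss_vec (X n)" and ?w = "\<lambda>n. gauss.combo gauss_gen (X n)"
    and ?b = "\<lambda>n. gauss.combo gauss_ladder_vec (X n)"
  have v: "?v \<longlonglongrightarrow> f" and w: "?w \<longlonglongrightarrow> k"
    by (rule tendsto_if_norm_diff_less_inverse, rule X)+
  show "cinner (abs_l2 (bessel_op \<phi>)) f = cinner (abs_l2 \<phi>) (cscale \<i> k)" if \<phi>: "\<phi> \<in> test_functions"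
    using tendsto_cinner[OF tendsto_const[of "abs_l2 (bessel_op \<phi>)"] v]
      tendsto_cinner[OF tendsto_const[of "abs_l2 \<phi>"] tendsto_cscale[OF w, of \<i>]]
    unfolding gauss_combo_form(3)[OF X(1) \<phi>] by (rule LIMSEQ_unique)
  \<comment> \<open>The squared norm of the \<open>ladder\<close> sum is the pairing of a sum with
    its image under H; Cauchy-Schwarz is applied to the difference of two sums.\<close>
  have d: "(dist (?b m) (?b n))\<^sup>2 \<le> dist (?v m) (?v n) * dist (?w m) (?w n)" for m n
  proof -
    let ?xs = "X m @ gauss.neg_list (X n)"
    have val: "gauss.valid ?xs" using X(1) by simp
    have "(norm (gauss.combo gauss_ladder_vec ?xs))\<^sup>2 = Re (cinner (gauss.combo gauss_ladder_vec ?xs) (gauss.combo gauss_ladder_vec ?xs))"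
      by (simp only: power2_norm_eq_inner inner_l2_def)
    also have "\<dots> = inner (gauss.combo gauss_vec ?xs) (cscale \<i> (gauss.combo gauss_gen ?xs))"
      by (simp only: gauss_combo_form(2)[OF val gauss_combo_form(1)[OF val]] inner_l2_def)
    also have "\<dots> \<le> norm (gauss.combo gauss_vec ?xs) * norm (cscale \<i> (gauss.combo gauss_gen ?xs))"
      by (rule norm_cauchy_schwarz)
    finally show ?thesis by (simp add: dist_norm norm_cscale)
  qed
  have "Cauchy ?b"
  proof (rule metric_CauchyI)
    fix e :: real assume e: "e > 0"
    obtain N1 where N1: "\<And>m n. m \<ge> N1 \<Longrightarrow> n \<ge> N1 \<Longrightarrow> dist (?v m) (?v n) < e"
      using metric_CauchyD[OF LIMSEQ_imp_Cauchy[OF v] e] by blast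
    obtain N2 where N2: "\<And>m n. m \<ge> N2 \<Longrightarrow> n \<ge> N2 \<Longrightarrow> dist (?w m) (?w n) < e"
      using metric_CauchyD[OF LIMSEQ_imp_Cauchy[OF w] e] by blast
    have "dist (?b m) (?b n) < e" if "m \<ge> max N1 N2" "n \<ge> max N1 N2" for m n
    proof -
      have "dist (?v m) (?v n) * dist (?w m) (?w n) < e * e"
        using N1[of m n] N2[of m n] that by (intro mult_strict_mono') auto
      then have "(dist (?b m) (?b n))\<^sup>2 < e\<^sup>2" using d[of m n] by (simp add: power2_eq_square)
      then show ?thesis using e by (intro power2_less_imp_less[of _ e]) auto
    qed
    then show "\<exists>M. \<forall>m\<ge>M. \<forall>n\<ge>M. dist (?b m) (?b n) < e" by blast
  qed
  then obtain b where b: "?b \<longlonglongrightarrow> b" using Cauchy_convergent convergent_def by blast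
  have "closed form_graph" by (simp add: form_graph_def)
  from closed_sequentially[OF this gauss_combo_form(1)[OF X(1)] tendsto_Pair[OF v b]]
  show "\<exists>b. (f, b) \<in> form_graph" by blast
qed

text \<open>The adjoint relation against test functions extends by closure to all pairs of
  \<open>form_graph\<close>, in particular to Gaussian sums. Together with the symmetric relation
  for the sums this gives the hypothesis of \<open>weakly_generates\<close>.\<close>

lemma form_imp_generates:
  assumes fb: "(f, b) \<in> form_graph"
    and adj: "\<And>\<phi>. \<phi> \<in> test_functions \<Longrightarrow> cinner (abs_l2 (bessel_op \<phi>)) f = cinner (abs_l2 \<phi>) (cscale \<i> k)"
  shows "gauss.generates f k"
proof (rule gauss.weakly_generates, clarify)
  fix xs assume val: "gauss.valid xs"
  have lb: "cinner (abs_l2 (ladder \<phi>)) b = cinner (abs_l2 \<phi>) (cscale \<i> k)" if "\<phi> \<in> test_functions" for \<phi>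
    using form_graph_form[OF fb that] adj[OF that] by simp
  have lb': "cinner d b = cinner g (cscale \<i> k)" if "(g, d) \<in> form_graph" for g d
  proof -
    obtain \<psi> where \<psi>: "\<And>n. \<psi> n \<in> test_functions" "(\<lambda>n. abs_l2 (\<psi> n)) \<longlonglongrightarrow> g"
      "(\<lambda>n. abs_l2 (ladder (\<psi> n))) \<longlonglongrightarrow> d" using \<open>(g, d) \<in> form_graph\<close> unfolding form_graph_iff by blast
    show ?thesis
      using tendsto_cinner[OF \<psi>(3) tendsto_const[of b]] tendsto_cinner[OF \<psi>(2) tendsto_const[of "cscale \<i> k"]]
      unfolding lb[OF \<psi>(1)] by (rule LIMSEQ_unique)
  qed
  have "cinner f (cscale \<i> (gauss.combo gauss_gen xs)) = cnj (cinner (gauss.combo gauss_ladder_vec xs) b)"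
    using gauss_combo_form(2)[OF val fb] by (simp add: cinner_cnj)
  also have "\<dots> = cinner (cscale \<i> k) (gauss.combo gauss_vec xs)"
    using lb'[OF gauss_combo_form(1)[OF val]] by (simp add: cinner_cnj)
  finally have h: "- \<i> * cinner f (gauss.combo gauss_gen xs) = \<i> * cinner k (gauss.combo gauss_vec xs)"
    by (simp only: cinner_cscale_left cinner_cscale_right complex_cnj_i)
  have "cinner k (gauss.combo gauss_vec xs) = - cinner f (gauss.combo gauss_gen xs)"
    using arg_cong[OF h, of "\<lambda>z. \<i> * z"] by simp
  then show "inner k (gauss.combo gauss_vec xs) = - inner f (gauss.combo gauss_gen xs)"
    by (simp add: inner_l2_def)
qed

lemma H_bessel_generates:
  "(f, g) \<in> H_bessel \<nu> \<longleftrightarrow> f \<in> L2 \<and> g \<in> L2 \<and> gauss.generates (abs_l2 f) (cscale (- \<i>) (abs_l2 g))"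
proof -
  have "cscale \<i> (cscale (- \<i>) (abs_l2 g)) = abs_l2 g" by (simp add: cscale_cscale)
  then show ?thesis
    unfolding H_bessel_iff
    using generates_imp_form[of "abs_l2 f" "cscale (- \<i>) (abs_l2 g)"]
      form_imp_generates[of "abs_l2 f" _ "cscale (- \<i>) (abs_l2 g)"] by auto
qed

text \<open>The existence that gives the choice in \<open>schrodinger_group\<close> its
  content.\<close>

lemma ex_schrodinger_group:
  "\<exists>U. unitary_group U \<and> group_generator U = {(f, \<lambda>x. - \<i> * g x) | f g. (f, g) \<in> H_bessel \<nu>}"
proof -
  \<comment> \<open>Complex scalars multiply the coefficient in each label, while the shift moves
    only the width parameter, so the two commute.\<close>
  have c: "gauss.evolve t (cscale c u) = cscale c (gauss.evolve t u)" for t c u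
    by (rule gauss.evolve_commute[where j="\<lambda>(d, p). (c * d, p)"])
      (auto simp: bounded_linear_cscale gauss_params_def gauss_vec_def cscale_cscale gauss_shift_def)
  define U where "U = (\<lambda>t f. rep_l2 (gauss.evolve t (abs_l2 f)))"
  note U = isometry_group_imp_unitary_group[OF gauss.isometry_group_axioms c, folded U_def]
  have "(f, k) \<in> group_generator U \<longleftrightarrow> (\<exists>g. k = (\<lambda>x. - \<i> * g x) \<and> (f, g) \<in> H_bessel \<nu>)" for f k
  proof
    assume "(f, k) \<in> group_generator U"
    then have *: "f \<in> L2" "k \<in> L2" "gauss.generates (abs_l2 f) (abs_l2 k)" using U(2) by auto
    have "(f, \<lambda>x. \<i> * k x) \<in> H_bessel \<nu>"
      unfolding H_bessel_generates using * by (auto simp: abs_l2_cmult cscale_cscale)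
    then show "\<exists>g. k = (\<lambda>x. - \<i> * g x) \<and> (f, g) \<in> H_bessel \<nu>"
      by (intro exI[of _ "\<lambda>x. \<i> * k x"]) auto
  next
    assume "\<exists>g. k = (\<lambda>x. - \<i> * g x) \<and> (f, g) \<in> H_bessel \<nu>"
    then obtain g where g: "k = (\<lambda>x. - \<i> * g x)" "f \<in> L2" "g \<in> L2" "gauss.generates (abs_l2 f) (cscale (- \<i>) (abs_l2 g))"
      unfolding H_bessel_generates by blast
    then show "(f, k) \<in> group_generator U"
      unfolding U(2) g(1) abs_l2_cmult[OF g(3)] by (auto intro: L2_cmult)
  qed
  then have "group_generator U = {(f, \<lambda>x. - \<i> * g x) | f g. (f, g) \<in> H_bessel \<nu>}" by auto
  with U(1) show ?thesis by blast
qed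

text \<open>Of the chosen group only the generator is known. The translates of a Gaussian solve its
  evolution equation inside the domain of the generator, so uniqueness of solutions determines the
  group on Gaussians.\<close>

lemma schrodinger_group_isometry:
  obtains X where "isometry_group X"
    "\<And>t f. f \<in> L2 \<Longrightarrow> schrodinger_group (H_bessel \<nu>) t f \<in> L2"
    "\<And>t f. f \<in> L2 \<Longrightarrow> abs_l2 (schrodinger_group (H_bessel \<nu>) t f) = X t (abs_l2 f)"
    "\<And>t p. Re p > 0 \<Longrightarrow> X t (abs_l2 (gauss p)) = abs_l2 (gauss (p + 4 * \<i> * of_real t))"
proof -
  let ?U = "schrodinger_group (H_bessel \<nu>)"
  have U: "unitary_group ?U \<and> group_generator ?U = {(f, \<lambda>x. - \<i> * g x) | f g. (f, g) \<in> H_bessel \<nu>}"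
    unfolding schrodinger_group_def by (rule someI_ex[OF ex_schrodinger_group])
  obtain X where X: "isometry_group X" "\<And>t f. f \<in> L2 \<Longrightarrow> ?U t f \<in> L2"
    "\<And>t f. f \<in> L2 \<Longrightarrow> abs_l2 (?U t f) = X t (abs_l2 f)"
    "\<And>f g. (f, g) \<in> group_generator ?U \<longleftrightarrow> f \<in> L2 \<and> g \<in> L2 \<and> isometry_group.generates X (abs_l2 f) (abs_l2 g)"
    using unitary_group_imp_isometry_group[of ?U] U by blast
  interpret isometry_group X by (rule X(1))
  have der: "((\<lambda>t. abs_l2 (gauss (p + 4 * \<i> * of_real t))) has_vector_derivative
      cscale (- \<i>) (abs_l2 (gauss_op (p + 4 * \<i> * of_real t)))) (at t)" if p: "Re p > 0" for p t
  proof -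
    have "p + 4 * \<i> * of_real (t + h) = p + 4 * \<i> * of_real t + 4 * \<i> * of_real (0 + h)" for h
      by (simp add: distrib_left)
    moreover have "p + 4 * \<i> * of_real t = p + 4 * \<i> * of_real t + 4 * \<i> * of_real 0" by simp
    ultimately show ?thesis
      using has_vector_derivative_gauss_l2[of "p + 4 * \<i> * of_real t"] p
      unfolding has_vector_derivative_iff_quotient by (simp add: add.assoc)
  qed
  have gen: "generates (abs_l2 (gauss p)) (cscale (- \<i>) (abs_l2 (gauss_op p)))" if p: "Re p > 0" for p
  proof -
    have "(gauss p, gauss_op p) \<in> H_bessel \<nu>"
      unfolding H_bessel_iff
      using p gauss_form_graph[OF p] form_graph_form[OF gauss_form_graph[OF p]] gauss_test_function_pairing[OF p]
      by (auto simp: gauss_L2 gauss_op_L2)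
    then have "(gauss p, \<lambda>x. - \<i> * gauss_op p x) \<in> group_generator ?U" using U by blast
    then show ?thesis unfolding X(4) abs_l2_cmult[OF gauss_op_L2[OF p]] by blast
  qed
  have "X t (abs_l2 (gauss p)) = abs_l2 (gauss (p + 4 * \<i> * of_real t))" if p: "Re p > 0" for t p
    using solution_unique[of "\<lambda>t. abs_l2 (gauss (p + 4 * \<i> * of_real t))", OF der[OF p] gen, of t] p by simp
  from that[OF X(1-3) this] show thesis .
qed

end

text \<open>Compares the solution from cut data with the explicit Gaussian. Their distance at time T
  equals that of the data, since the group is isometric.\<close>

lemma set_integral_square_le:
  assumes f: "f \<in> L2" and g: "g \<in> L2" and A: "A \<in> sets half_line"
  shows "(LINT x:A|half_line. (cmod (f x))\<^sup>2) \<le>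
    2 * (LINT x:A|half_line. (cmod (g x))\<^sup>2) + 2 * (norm (abs_l2 f - abs_l2 g))\<^sup>2"
proof -
  have int: "set_integrable half_line A (\<lambda>x. (cmod (h x))\<^sup>2)" if "h \<in> L2" for h
    unfolding set_integrable_def using A L2_integrable[OF that] by (rule integrable_mult_indicator)
  have fg: "(\<lambda>x. f x - g x) \<in> L2" using f g by (rule L2_diff)
  have "(LINT x:A|half_line. (cmod (f x))\<^sup>2) \<le>
      (LINT x:A|half_line. 2 * (cmod (g x))\<^sup>2 + 2 * (cmod (f x - g x))\<^sup>2)"
  proof (rule set_integral_mono)
    show "(cmod (f x))\<^sup>2 \<le> 2 * (cmod (g x))\<^sup>2 + 2 * (cmod (f x - g x))\<^sup>2" for x
      using cmod_add_square_le[of "g x" "f x - g x"] by simp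
  qed (use int f g fg in \<open>auto intro!: set_integral_add(1) set_integrable_mult_right\<close>)
  also have "\<dots> = 2 * (LINT x:A|half_line. (cmod (g x))\<^sup>2) + 2 * (LINT x:A|half_line. (cmod (f x - g x))\<^sup>2)"
    using int[OF g] int[OF fg] by (subst set_integral_add(2)) (auto intro!: set_integrable_mult_right)
  also have "(LINT x:A|half_line. (cmod (f x - g x))\<^sup>2) \<le> (LINT x|half_line. (cmod (f x - g x))\<^sup>2)"
    unfolding set_lebesgue_integral_def
    by (rule integral_mono'[OF L2_integrable[OF fg]]) (auto simp: indicator_def)
  also have "\<dots> = (norm (abs_l2 f - abs_l2 g))\<^sup>2"
    using norm_abs_l2_square[OF fg] by (simp add: abs_l2_diff f g)
  finally show ?thesis by simp
qed

lemma set_integral_square_le_const: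
  assumes f: "f \<in> L2" and a: "0 < a1" "a1 < a2" and B: "\<And>x. x \<in> {a1..a2} \<Longrightarrow> cmod (f x) \<le> B"
  shows "(LINT x:{a1..a2}|half_line. (cmod (f x))\<^sup>2) \<le> (a2 - a1) * B\<^sup>2"
proof -
  have ind: "(\<lambda>x. indicator {0<..} x *\<^sub>R (indicator {a1..a2} x *\<^sub>R B\<^sup>2)) = (\<lambda>x. indicator {a1..a2} x *\<^sub>R B\<^sup>2)"
    using a(1) by (auto simp: indicator_def fun_eq_iff)
  have hb: "has_bochner_integral lborel (\<lambda>x. indicator {a1..a2} x *\<^sub>R B\<^sup>2) ((a2 - a1) * B\<^sup>2)"
    using has_bochner_integral_scaleR_left[OF has_bochner_integral_real_indicator[of "{a1..a2}" lborel], of "B\<^sup>2"] a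
    by (simp add: emeasure_lborel_Icc_eq)
  have "(LINT x:{a1..a2}|half_line. (cmod (f x))\<^sup>2) \<le> (LINT x|half_line. indicator {a1..a2} x *\<^sub>R B\<^sup>2)"
    unfolding set_lebesgue_integral_def
  proof (rule integral_mono')
    show "integrable half_line (\<lambda>x. indicator {a1..a2} x *\<^sub>R B\<^sup>2)"
      unfolding integrable_half_line_iff ind using hb by (simp add: has_bochner_integral_iff)
    show "indicator {a1..a2} x *\<^sub>R (cmod (f x))\<^sup>2 \<le> indicator {a1..a2} x *\<^sub>R B\<^sup>2" for x
      using B[of x] by (auto simp: indicator_def intro: power_mono)
  qed auto
  also have "\<dots> = (a2 - a1) * B\<^sup>2"
    unfolding integral_half_line ind using hb by (simp add: has_bochner_integral_iff)
  finally show ?thesis .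
qed

lemma norm_pos_of_pos:
  assumes "f \<in> L2" "\<And>x. x > 0 \<Longrightarrow> f x \<noteq> 0"
  shows "norm (abs_l2 f) > 0"
proof (rule ccontr)
  assume "\<not> norm (abs_l2 f) > 0"
  then have "abs_l2 f = abs_l2 (\<lambda>_. 0)" by (simp add: abs_l2_zero)
  then have "AE x in half_line. f x = 0" using assms(1) by (simp add: abs_l2_eq_iff)
  moreover have "AE x in half_line. f x \<noteq> 0" by (rule AE_half_lineI[OF assms(2)])
  ultimately have "AE x in half_line. False" by eventually_elim simp
  then have "emeasure half_line (space half_line) = 0" by (simp add: eventually_False ae_filter_eq_bot_iff)
  moreover have "emeasure half_line {0<..} \<ge> emeasure half_line {0<..<1::real}"
    by (rule emeasure_mono) (auto simp: sets_restrict_space)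
  moreover have "emeasure half_line {0<..<1::real} = 1"
    by (subst emeasure_restrict_space) auto
  ultimately show False by (simp add: space_restrict_space)
qed

text \<open>The tangent line of ln at 1, evaluated at d x / a. The growth rate d can be prescribed,
  at the expense of the constant.\<close>

lemma powr_le_exp_linear:
  fixes x a d :: real
  assumes "x > 0" "a > 0" "d > 0"
  shows "x powr a \<le> exp (- a - a * ln (d / a)) * exp (d * x)"
proof -
  have "ln (d * x / a) \<le> d * x / a - 1" using assms by (intro ln_le_minus_one) auto
  then have "a * ln (d * x / a) \<le> a * (d * x / a - 1)" using assms by (intro mult_left_mono) auto
  moreover have "ln (d * x / a) = ln (d / a) + ln x" using assms by (simp add: ln_mult ln_div)
  ultimately have "a * ln x \<le> (- a - a * ln (d / a)) + d * x" using assms by (simp add: algebra_simps)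
  then have "exp (a * ln x) \<le> exp ((- a - a * ln (d / a)) + d * x)" by simp
  then show ?thesis using assms by (simp only: powr_def exp_add) simp
qed

text \<open>Beyond some threshold \<alpha> lies below the line of slope e; before it, monotonicity
  bounds \<alpha> by its value at the threshold.\<close>

lemma sublinear_bound:
  fixes \<alpha> :: "real \<Rightarrow> real"
  assumes mono: "mono_on {0<..} \<alpha>" and lim: "((\<lambda>s. \<alpha> s / s) \<longlongrightarrow> 0) at_top" and e: "e > 0"
  obtains c where "\<And>x. x > 0 \<Longrightarrow> \<alpha> x \<le> e * x + c"
proof -
  have "\<forall>\<^sub>F s in at_top. \<alpha> s / s < e" using order_tendstoD(2)[OF lim e] .
  then obtain s0 where s0: "\<And>s. s \<ge> s0 \<Longrightarrow> \<alpha> s / s < e" unfolding eventually_at_top_linorder by blast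
  \<comment> \<open>The maximum with 1 puts the threshold into the half line, where \<alpha> is
    monotone.\<close>
  define s1 where "s1 = max s0 1"
  have "\<alpha> x \<le> e * x + \<bar>\<alpha> s1\<bar>" if x: "x > 0" for x
  proof (cases "x \<ge> s1")
    case True
    then have "\<alpha> x < e * x" using s0[of x] x by (simp add: s1_def divide_less_eq)
    then show ?thesis by simp
  next
    case False
    then have "\<alpha> x \<le> \<alpha> s1" using x by (intro mono_onD[OF mono]) (auto simp: s1_def)
    moreover have "0 \<le> e * x" using e x by simp
    ultimately show ?thesis by simp
  qed
  then show thesis using that by blast
qed

section \<open>Dispersing data for (i), focusing data for (ii)\<close>

context bessel
begin

lemma cutoff_gauss_close:
  assumes p: "Re p > 0" and e: "e > 0"
  obtains m where "m > 0" "norm (abs_l2 (\<lambda>x. cutoff m x * gauss p x) - abs_l2 (gauss p)) < e"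
proof -
  obtain n where "norm (abs_l2 (\<lambda>x. cutoff (real (Suc n)) x * gauss p x) - abs_l2 (gauss p)) < e"
    using LIMSEQ_D[OF cutoff_times_tendsto(1)[OF gauss_L2[OF p]] e] by blast
  then show thesis using that[of "real (Suc n)"] by simp
qed

lemma cmod_cutoff_gauss_le: "cmod (cutoff m x * gauss p x) \<le> cmod (gauss p x)"
  using mult_left_le_one_le[of "cmod (gauss p x)" "log_cutoff m x"] log_cutoff_bounds[of m x]
  by (simp add: norm_mult)

lemma dispersing_gaussians:
  fixes a1 a2 lam T :: real
  assumes a: "0 < a1" "a1 < a2" and lam: "lam > 0" and T: "T > 0"
  shows "\<exists>(u :: nat \<Rightarrow> real \<Rightarrow> complex) (M::real). M > 0 \<and>
           (\<forall>k\<ge>1. u k \<in> test_functions \<and>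
              (LINT x|half_line. exp (lam * x) * (cmod (u k x))\<^sup>2) \<le> M \<and>
              (LINT x|half_line. (cmod (u k x))\<^sup>2) = 1) \<and>
           (\<lambda>k. LINT x:{a1..a2}|half_line. (cmod (bessel_solution \<nu> (u k) x T))\<^sup>2)
             \<longlonglongrightarrow> 0"
proof -
  obtain X where X: "isometry_group X"
    "\<And>t f. f \<in> L2 \<Longrightarrow> schrodinger_group (H_bessel \<nu>) t f \<in> L2"
    "\<And>t f. f \<in> L2 \<Longrightarrow> abs_l2 (schrodinger_group (H_bessel \<nu>) t f) = X t (abs_l2 f)"
    "\<And>t p. Re p > 0 \<Longrightarrow> X t (abs_l2 (gauss p)) = abs_l2 (gauss (p + 4 * \<i> * of_real t))"
    using schrodinger_group_isometry by blast
  interpret isometry_group X by (rule X(1))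
  define a where "a = \<nu> + 1/2"
  define E where "E x = x powr a * exp (- (1::real) * x\<^sup>2)" for x
  define p where "p k = 1 / (1 + \<i> * of_nat k)" for k :: nat
  define q where "q k = p k + 4 * \<i> * of_real T" for k
  define A where "A k = cmod (p k) powr - (\<nu> + 1)" for k
  have pden: "1 + \<i> * of_nat k \<noteq> 0" for k by (simp add: complex_eq_iff)
  \<comment> \<open>Equivalent to Re (1/p) = 1: the exponent in the modulus of the Gaussian is - x^2
    for every k.\<close>
  have Rep: "Re (p k) = (cmod (p k))\<^sup>2" for k
    by (simp add: p_def Re_divide norm_divide power_divide cmod_power2)
  have pnz: "p k \<noteq> 0" for k using pden by (simp add: p_def)
  have p0: "Re (p k) > 0" for k using pnz by (simp add: Rep)
  have q0: "Re (q k) > 0" for k using p0[of k] by (simp add: q_def)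
  have Apos: "A k > 0" for k using pnz by (simp add: A_def)
  have cg: "cmod (gauss (p k) x) = A k * E x" for k x
    using pnz[of k] by (subst cmod_gauss[OF p0]) (simp add: A_def E_def a_def Rep)
  define N where "N = sqrt (LINT x|half_line. (E x)\<^sup>2)"
  have ng: "norm (abs_l2 (gauss (p k))) = A k * N" for k
    using Apos[of k] by (simp add: norm_abs_l2[OF gauss_L2[OF p0]] l2_norm_def cg power_mult_distrib
        N_def real_sqrt_mult)
  have "norm (abs_l2 (gauss (p 0))) > 0"
    by (rule norm_pos_of_pos[OF gauss_L2[OF p0]]) (simp add: gauss_def)
  then have N: "N > 0" using Apos[of 0] by (simp add: ng zero_less_mult_iff)
  \<comment> \<open>A relative error 1/(k + 1): it tends to 0, and for k at least 1 it leaves at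
    least half of the norm.\<close>
  define \<delta> where "\<delta> k = A k * N / real (Suc k)" for k
  have \<delta>: "\<delta> k > 0" for k using Apos N by (simp add: \<delta>_def)
  have "\<forall>k. \<exists>m. m > 0 \<and> norm (abs_l2 (\<lambda>x. cutoff m x * gauss (p k) x) - abs_l2 (gauss (p k))) < \<delta> k"
  proof
    fix k
    show "\<exists>m. m > 0 \<and> norm (abs_l2 (\<lambda>x. cutoff m x * gauss (p k) x) - abs_l2 (gauss (p k))) < \<delta> k"
      by (rule cutoff_gauss_close[OF p0 \<delta>]) (intro exI conjI)
  qed
  from choice[OF this] obtain m where
    "\<forall>k. m k > 0 \<and> norm (abs_l2 (\<lambda>x. cutoff (m k) x * gauss (p k) x) - abs_l2 (gauss (p k))) < \<delta> k" ..
  then have m: "m k > 0"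
    "norm (abs_l2 (\<lambda>x. cutoff (m k) x * gauss (p k) x) - abs_l2 (gauss (p k))) < \<delta> k" for k by simp_all
  define w where "w k x = cutoff (m k) x * gauss (p k) x" for k x
  have wT: "w k \<in> test_functions" for k
    unfolding w_def by (rule cutoff_gauss_test_function[OF m(1) p0])
  have wL: "w k \<in> L2" for k by (rule test_function_L2[OF wT])
  define n where "n k = norm (abs_l2 (w k))" for k
  have wd: "norm (abs_l2 (w k) - abs_l2 (gauss (p k))) < \<delta> k" for k using m(2) by (simp only: w_def[abs_def])
  \<comment> \<open>For k = 0 the permitted error equals the norm of the Gaussian, so the bound
    starts at k = 1, as does the claim.\<close>
  have n: "n k \<ge> A k * N / 2" if k: "k \<ge> 1" for k
  proof -
    have "A k * N \<le> n k + \<delta> k"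
      using norm_triangle_ineq2[of "abs_l2 (gauss (p k))" "abs_l2 (w k)"] wd[of k]
      by (simp add: ng n_def norm_minus_commute)
    moreover have "\<delta> k \<le> A k * N / 2"
      using k Apos[of k] N unfolding \<delta>_def by (intro divide_left_mono) auto
    ultimately show ?thesis by simp
  qed
  have npos: "n k > 0" if "k \<ge> 1" for k
    using n[OF that] mult_pos_pos[OF Apos[of k] N] by linarith
  define u where "u k x = of_real (1 / n k) * w k x" for k x
  have uT: "u k \<in> test_functions" for k unfolding u_def by (rule test_functions_cmult[OF wT])
  have uL: "u k \<in> L2" for k by (rule test_function_L2[OF uT])
  have au: "abs_l2 (u k) = (1 / n k) *\<^sub>R abs_l2 (w k)" for k
    unfolding u_def[abs_def] abs_l2_cmult[OF wL] by (simp only: cscale_of_real)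
  have u1: "(LINT x|half_line. (cmod (u k x))\<^sup>2) = 1" if k: "k \<ge> 1" for k
    using npos[OF k] by (simp add: au n_def[symmetric] flip: norm_abs_l2_square[OF uL])
  \<comment> \<open>Dividing by at least half of the norm costs a factor 2 in the modulus of u k,
    hence 4 here. Neither E nor N depends on k.\<close>
  define J where "J = (LINT x|half_line. 4 / N\<^sup>2 * (exp (lam * x) * (E x)\<^sup>2))"
  have weight: "(LINT x|half_line. exp (lam * x) * (cmod (u k x))\<^sup>2) \<le> J" if k: "k \<ge> 1" for k
    unfolding J_def
  proof (rule integral_mono')
    have e: "exp (lam * x) * (E x)\<^sup>2 = x powr (2 * a) * exp (lam * x - 2 * x\<^sup>2)" if "x \<in> space half_line" for x
      using that by (simp add: space_restrict_space E_def power_mult_distrib power2_powr power2_exp exp_diff exp_minus field_simps)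
    have "integrable half_line (\<lambda>x. x powr (2 * a) * exp (lam * x - 2 * x\<^sup>2))"
      using \<nu>_nonneg by (intro integrable_powr_exp_quadratic) (auto simp: a_def)
    then have "integrable half_line (\<lambda>x. exp (lam * x) * (E x)\<^sup>2)"
      by (subst Bochner_Integration.integrable_cong[OF refl e])
    then show "integrable half_line (\<lambda>x. 4 / N\<^sup>2 * (exp (lam * x) * (E x)\<^sup>2))"
      by (rule Bochner_Integration.integrable_mult_right)
    show "exp (lam * x) * (cmod (u k x))\<^sup>2 \<le> 4 / N\<^sup>2 * (exp (lam * x) * (E x)\<^sup>2)" for x
    proof -
      have "cmod (u k x) = cmod (w k x) / n k" using npos[OF k] by (simp add: u_def norm_mult norm_divide)
      also have "\<dots> \<le> (A k * E x) / (A k * N / 2)"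
        using n[OF k] Apos[of k] N cmod_cutoff_gauss_le[of "m k" x "p k"]
        by (intro frac_le) (auto simp: w_def cg E_def)
      also have "\<dots> = 2 / N * E x" using Apos[of k] by simp
      finally have "(cmod (u k x))\<^sup>2 \<le> (2 / N * E x)\<^sup>2" by (intro power_mono) auto
      then have "exp (lam * x) * (cmod (u k x))\<^sup>2 \<le> exp (lam * x) * (2 / N * E x)\<^sup>2"
        by (intro mult_left_mono) auto
      then show ?thesis by (simp add: power_mult_distrib power_divide mult_ac)
    qed
  qed auto
  \<comment> \<open>A bound on [a1, a2] for the evolved Gaussian divided by the norm of the cut
    datum: the power of x is largest at a2, and the exponential is at most 1.\<close>
  define R where "R k = (cmod (p k) / cmod (q k)) powr (\<nu> + 1) * (2 * a2 powr a / N)" for k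
  have solution: "(LINT x:{a1..a2}|half_line. (cmod (bessel_solution \<nu> (u k) x T))\<^sup>2) \<le>
      2 * ((a2 - a1) * (R k)\<^sup>2) + 2 * (2 / real (Suc k))\<^sup>2" if k: "k \<ge> 1" for k
  proof -
    define g where "g x = of_real (1 / n k) * gauss (q k) x" for x
    have gL: "g \<in> L2" unfolding g_def by (intro L2_cmult gauss_L2 q0)
    let ?U = "schrodinger_group (H_bessel \<nu>) T (u k)"
    have "abs_l2 g = (1 / n k) *\<^sub>R X T (abs_l2 (gauss (p k)))"
    proof -
      have "abs_l2 g = cscale (of_real (1 / n k)) (abs_l2 (gauss (q k)))"
        unfolding g_def[abs_def] by (rule abs_l2_cmult[OF gauss_L2[OF q0]])
      then show ?thesis by (simp only: cscale_of_real X(4)[OF p0] q_def)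
    qed
    then have "abs_l2 ?U - abs_l2 g = (1 / n k) *\<^sub>R X T (abs_l2 (w k) - abs_l2 (gauss (p k)))"
      by (simp add: X(3) uL au U_scaleR U_diff scaleR_diff_right)
    then have "norm (abs_l2 ?U - abs_l2 g) = norm (abs_l2 (w k) - abs_l2 (gauss (p k))) / n k"
      using npos[OF k] by (simp add: norm_U)
    also have "\<dots> \<le> \<delta> k / (A k * N / 2)"
      using wd[of k] n[OF k] Apos[of k] N less_imp_le[OF \<delta>[of k]] by (intro frac_le) auto
    also have "\<dots> = 2 / real (Suc k)" using Apos[of k] N by (simp add: \<delta>_def)
    finally have d: "(norm (abs_l2 ?U - abs_l2 g))\<^sup>2 \<le> (2 / real (Suc k))\<^sup>2" by (intro power_mono) auto
    have "(LINT x:{a1..a2}|half_line. (cmod (g x))\<^sup>2) \<le> (a2 - a1) * (R k)\<^sup>2"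
    proof (rule set_integral_square_le_const[OF gL a(1,2)])
      fix x assume x: "x \<in> {a1..a2}"
      have qnz: "cmod (q k) > 0" using q0[of k] by auto
      have "cmod (gauss (q k) x) \<le> cmod (q k) powr - (\<nu> + 1) * (a2 powr a * 1)"
        unfolding cmod_gauss[OF q0] a_def using x a \<nu>_nonneg q0[of k]
        by (intro mult_left_mono mult_mono powr_mono2) auto
      moreover have "cmod (g x) = cmod (gauss (q k) x) / n k"
        using npos[OF k] by (simp add: g_def norm_mult norm_divide)
      ultimately have "cmod (g x) \<le> cmod (q k) powr - (\<nu> + 1) * a2 powr a / (A k * N / 2)"
        using n[OF k] npos[OF k] Apos[of k] N by (simp only: mult_1_right) (intro frac_le, auto)
      also have "\<dots> = R k"
        using qnz pnz[of k] by (simp only: R_def A_def powr_minus) (simp add: powr_divide field_simps)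
      finally show "cmod (g x) \<le> R k" .
    qed
    moreover have "{a1..a2} \<in> sets half_line"
      using a(1) by (subst sets_restrict_space_iff) auto
    ultimately show ?thesis
      using set_integral_square_le[OF X(2)[OF uL] gL, of "{a1..a2}" T k] d
      unfolding bessel_solution_def by linarith
  qed
  have "(\<lambda>k. 1 / (1 + \<i> * of_nat k)) \<longlonglongrightarrow> (0::complex)"
  proof (rule Lim_null_comparison)
    show "(\<lambda>k. 1 / real k) \<longlonglongrightarrow> 0" by (rule lim_1_over_n)
    have "norm (1 / (1 + \<i> * of_nat k)) \<le> 1 / real k" if "k \<ge> 1" for k :: nat
    proof -
      have "real k \<le> cmod (1 + \<i> * of_nat k)" using abs_Im_le_cmod[of "1 + \<i> * of_nat k"] by simp
      moreover from this that have "0 < cmod (1 + \<i> * of_nat k)" by linarith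
      ultimately show ?thesis using that unfolding norm_divide norm_one by (intro divide_left_mono) auto
    qed
    then show "\<forall>\<^sub>F k in sequentially. norm (1 / (1 + \<i> * of_nat k) :: complex) \<le> 1 / real k"
      by (rule eventually_sequentiallyI)
  qed
  then have plim: "p \<longlonglongrightarrow> 0" by (simp add: p_def[abs_def])
  have "(\<lambda>k. (cmod (p k) / cmod (p k + 4 * \<i> * of_real T)) powr (\<nu> + 1) * (2 * a2 powr a / N)) \<longlonglongrightarrow>
      (cmod 0 / cmod (0 + 4 * \<i> * of_real T)) powr (\<nu> + 1) * (2 * a2 powr a / N)"
    using T \<nu>_nonneg by (intro tendsto_intros tendsto_powr' plim) (auto simp: complex_eq_iff)
  then have Rlim: "R \<longlonglongrightarrow> 0" by (simp add: R_def[abs_def] q_def)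
  have "(\<lambda>k. 2 / real (Suc k)) \<longlonglongrightarrow> 0"
    by (intro real_tendsto_divide_at_top[OF tendsto_const] filterlim_compose[OF filterlim_real_sequentially filterlim_Suc])
  then have "(\<lambda>k. 2 * ((a2 - a1) * (R k)\<^sup>2) + 2 * (2 / real (Suc k))\<^sup>2) \<longlonglongrightarrow> 2 * ((a2 - a1) * 0\<^sup>2) + 2 * 0\<^sup>2"
    by (intro tendsto_intros Rlim)
  then have bound_lim: "(\<lambda>k. 2 * ((a2 - a1) * (R k)\<^sup>2) + 2 * (2 / real (Suc k))\<^sup>2) \<longlonglongrightarrow> 0" by simp
  have lim: "(\<lambda>k. LINT x:{a1..a2}|half_line. (cmod (bessel_solution \<nu> (u k) x T))\<^sup>2) \<longlonglongrightarrow> 0"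
  proof (rule tendsto_sandwich[OF _ _ tendsto_const bound_lim])
    show "\<forall>\<^sub>F k in sequentially. 0 \<le> (LINT x:{a1..a2}|half_line. (cmod (bessel_solution \<nu> (u k) x T))\<^sup>2)"
      unfolding set_lebesgue_integral_def by (intro always_eventually allI integral_nonneg_AE) auto
    show "\<forall>\<^sub>F k in sequentially. (LINT x:{a1..a2}|half_line. (cmod (bessel_solution \<nu> (u k) x T))\<^sup>2) \<le>
        2 * ((a2 - a1) * (R k)\<^sup>2) + 2 * (2 / real (Suc k))\<^sup>2"
      by (rule eventually_sequentiallyI[OF solution])
  qed
  \<comment> \<open>Only nonnegativity is at hand, so J + 1 serves as the positive constant.\<close>
  have "J \<ge> 0" unfolding J_def by (intro integral_nonneg_AE) auto
  then have "J + 1 > 0" "\<forall>k\<ge>1. u k \<in> test_functions \<and>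
      (LINT x|half_line. exp (lam * x) * (cmod (u k x))\<^sup>2) \<le> J + 1 \<and> (LINT x|half_line. (cmod (u k x))\<^sup>2) = 1"
    using uT u1 weight by force+
  with lim show ?thesis by blast
qed

text \<open>
  The exterior mass at time \<open>T\<close> is
  about \<open>exp (- b\<^sup>2 / p)\<close>, and the initial datum has variance about \<open>1 / p\<close>, so that a weight growing
  slower than every \<open>exp (\<epsilon> x)\<close> costs only \<open>exp (\<epsilon>\<^sup>2 / p)\<close>.
\<close>

lemma focusing_gaussians:
  fixes lam b T \<gamma> C :: real and \<alpha> :: "real \<Rightarrow> real"
  assumes lam: "lam > 0" and b: "b > 0" and T: "T > 0" and mono: "mono_on {0<..} \<alpha>"
    and lim: "((\<lambda>s. \<alpha> s / s) \<longlongrightarrow> 0) at_top" and \<gamma>: "0 < \<gamma>" "\<gamma> < 1" and C: "C > 0"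
  assumes ineq: "\<And>u0. u0 \<in> test_functions \<Longrightarrow>
                (LINT x|half_line. (cmod (u0 x))\<^sup>2) \<le>
                C * (LINT x:{0<..} - {0..b}|half_line. (cmod (bessel_solution \<nu> u0 x T))\<^sup>2) powr \<gamma>
                  * (LINT x|half_line. exp (lam * \<alpha> x) * (cmod (u0 x))\<^sup>2) powr (1 - \<gamma>)"
  shows False
proof -
  obtain X where X: "isometry_group X"
    "\<And>t f. f \<in> L2 \<Longrightarrow> schrodinger_group (H_bessel \<nu>) t f \<in> L2"
    "\<And>t f. f \<in> L2 \<Longrightarrow> abs_l2 (schrodinger_group (H_bessel \<nu>) t f) = X t (abs_l2 f)"
    "\<And>t p. Re p > 0 \<Longrightarrow> X t (abs_l2 (gauss p)) = abs_l2 (gauss (p + 4 * \<i> * of_real t))"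
    using schrodinger_group_isometry by blast
  interpret isometry_group X by (rule X(1))
  define a where "a = 2 * (\<nu> + 1/2)"
  have a: "a > 0" using \<nu>_nonneg by (simp add: a_def)
  \<comment> \<open>For r at most 1 the squared modulus r^2 + 16 T^2 of p is at most 1/\<kappa>, so
    the initial Gaussian decays at least like exp (- \<kappa> r x^2).\<close>
  define \<kappa> where "\<kappa> = 1 / (1 + 16 * T\<^sup>2)"
  have \<kappa>: "\<kappa> > 0" by (simp add: \<kappa>_def add_pos_nonneg)
  \<comment> \<open>Three linear terms d x occur in the weighted integral: from the weight, from the
    power of x, and for integrability. Completing the square with 3 d costs 9 d^2 y / (8 \<kappa>),
    and d makes this a quarter of \<gamma> times the exponent b^2 y / 2 of the exterior
    mass.\<close>
  define d where "d = b * sqrt (\<kappa> * \<gamma>) / 3"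
  have d: "d > 0" using b \<kappa> \<gamma> by (simp add: d_def)
  have d2: "9 * d\<^sup>2 / (8 * \<kappa>) = \<gamma> * b\<^sup>2 / 8"
    using \<kappa> \<gamma> by (simp add: d_def power_mult_distrib power_divide)
  obtain c where c: "\<And>x. x > 0 \<Longrightarrow> \<alpha> x \<le> d / lam * x + c"
    using sublinear_bound[OF mono lim, of "d / lam"] d lam by auto
  define D where "D = exp (- a - a * ln (d / a))"
  define I where "I = (LINT x|half_line. exp (- (d * x)))"
  have I: "I \<ge> 0" unfolding I_def by (intro integral_nonneg_AE) auto
  define K1 where "K1 = (LINT x|half_line. x powr a * exp (0 * x - 1 * x\<^sup>2))"
  have K1: "K1 \<ge> 0" unfolding K1_def by (intro integral_nonneg_AE) auto
  \<comment> \<open>The constant of \<open>powr_le_exp_linear\<close> for absorbing y powr (2 (\<nu>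
    + 1)) into half of the decay exp (- b^2 y).\<close>
  define D1 where "D1 = exp (- (2 * (\<nu> + 1)) - (2 * (\<nu> + 1)) * ln (b\<^sup>2 / 2 / (2 * (\<nu> + 1))))"
  \<comment> \<open>The summand 1 makes the constant positive, so that it yields an admissible
    cutoff error.\<close>
  define K2 where "K2 = D1 * (K1 + 1)"
  have K2: "K2 > 0" using K1 by (simp add: K2_def D1_def)
  define K3 where "K3 = (4 * T) powr - (2 * (\<nu> + 1)) * exp (lam * c) * D * I"
  have K3: "K3 \<ge> 0" using I by (simp add: K3_def D_def)
  \<comment> \<open>A lower bound for the modulus of the initial Gaussians, common to all r in (0,
    1]. Its squared norm c0 bounds their mass from below.\<close>
  define g0 where "g0 x = complex_of_real ((1 + 16 * T\<^sup>2) powr - ((\<nu> + 1) / 2) * (x powr (\<nu> + 1/2) * exp (0 * x - 1 / (16 * T\<^sup>2) * x\<^sup>2)))" for x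
  have g0L: "g0 \<in> L2"
  proof (rule gaussian_dominated_L2)
    have "continuous_on {0<..} g0" unfolding g0_def by (intro continuous_intros) auto
    then show "g0 \<in> borel_measurable half_line" by (rule measurable_half_line_continuous)
    show "cmod (g0 x) \<le> (1 + 16 * T\<^sup>2) powr - ((\<nu> + 1) / 2) * (x powr (\<nu> + 1/2) * exp (0 * x - 1 / (16 * T\<^sup>2) * x\<^sup>2))" for x
      by (simp add: g0_def norm_mult)
  qed (use \<nu>_nonneg T in auto)
  define c0 where "c0 = (norm (abs_l2 g0))\<^sup>2"
  have "norm (abs_l2 g0) > 0"
    by (rule norm_pos_of_pos[OF g0L]) (use T in \<open>auto simp: g0_def add_nonneg_eq_0_iff\<close>)
  then have c0: "c0 > 0" by (simp add: c0_def)
  \<comment> \<open>The gain \<gamma> b^2 / 2 from the exterior mass minus the cost \<gamma> b^2 / 8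
    of the weight.\<close>
  define \<theta> where "\<theta> = 3 * \<gamma> * b\<^sup>2 / 8"
  have \<theta>: "\<theta> > 0" using \<gamma> b by (simp add: \<theta>_def)
  define K where "K = C * (4 * K2) powr \<gamma> * K3 powr (1 - \<gamma>)"
  have main: "c0 / 4 \<le> K * exp (- \<theta> * y)" if y: "y \<ge> 1" for y
  proof -
    define r where "r = 1 / y"
    have r: "0 < r" "r \<le> 1" using y by (auto simp: r_def)
    define p where "p = of_real r - 4 * \<i> * of_real T"
    have p: "Re p > 0" "Re p = r" using r by (simp_all add: p_def)
    have cp: "(cmod p)\<^sup>2 = r\<^sup>2 + 16 * T\<^sup>2" by (simp add: cmod_power2 p_def power_mult_distrib)
    have p1: "(cmod p)\<^sup>2 \<le> 1 + 16 * T\<^sup>2" unfolding cp using r by (simp add: power_le_one)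
    have p2: "4 * T \<le> cmod p" using abs_Im_le_cmod[of p] T by (simp add: p_def)
    have pT: "p + 4 * \<i> * of_real T = of_real r" by (simp add: p_def)
    have s1: "r / (cmod p)\<^sup>2 \<le> 1 / (16 * T\<^sup>2)"
      using r T unfolding cp by (intro frac_le) auto
    have s2: "\<kappa> * r \<le> r / (cmod p)\<^sup>2"
    proof -
      have "\<kappa> * r = r / (1 + 16 * T\<^sup>2)" by (simp add: \<kappa>_def)
      also have "\<dots> \<le> r / (r\<^sup>2 + 16 * T\<^sup>2)"
        using r T p1 unfolding cp by (intro frac_le) (auto intro: add_pos_pos)
      finally show ?thesis unfolding cp .
    qed
    \<comment> \<open>Its square bounds the exterior mass of the focused Gaussian, so that cutting
      the datum only changes the constant.\<close>
    define e where "e = sqrt (K2 * exp (- (b\<^sup>2 / 2) * y))"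
    have e: "e > 0" "e\<^sup>2 = K2 * exp (- (b\<^sup>2 / 2) * y)" using K2 by (simp_all add: e_def)
    have lower: "sqrt c0 \<le> norm (abs_l2 (gauss p))"
    proof -
      have "c0 \<le> (norm (abs_l2 (gauss p)))\<^sup>2"
        unfolding c0_def norm_abs_l2_square[OF g0L] norm_abs_l2_square[OF gauss_L2[OF p(1)]]
      proof (rule integral_mono'[OF L2_integrable[OF gauss_L2[OF p(1)]]])
        fix x :: real assume "x \<in> space half_line"
        have "1 + 16 * T\<^sup>2 > 0" by (simp add: add_pos_nonneg)
        have "(1 + 16 * T\<^sup>2) powr - ((\<nu> + 1) / 2) \<le> ((cmod p)\<^sup>2) powr - ((\<nu> + 1) / 2)"
          using p1 p \<nu>_nonneg by (intro powr_mono2') auto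
        also have "\<dots> = cmod p powr - (\<nu> + 1)"
        proof -
          have "cmod p > 0" using p by auto
          then have "(cmod p)\<^sup>2 = cmod p powr 2" by simp
          moreover have "2 * - ((\<nu> + 1) / 2) = - (\<nu> + 1)" by (simp add: field_simps)
          ultimately show ?thesis by (simp only: powr_powr)
        qed
        finally have "cmod (g0 x) \<le> cmod (gauss p x)"
          unfolding cmod_gauss[OF p(1)] g0_def norm_of_real abs_mult p(2)
          using mult_right_mono[OF s1, of "x\<^sup>2"] by (intro mult_mono) auto
        then show "(cmod (g0 x))\<^sup>2 \<le> (cmod (gauss p x))\<^sup>2" by (intro power_mono) auto
      qed auto
      then show ?thesis by (simp add: real_le_lsqrt)
    qed
    \<comment> \<open>The bound e controls the exterior mass at time T, and sqrt c0 / 2 keeps at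
      least a quarter of the mass c0 at time 0.\<close>
    obtain m where m: "m > 0"
      "norm (abs_l2 (\<lambda>x. cutoff m x * gauss p x) - abs_l2 (gauss p)) < min e (sqrt c0 / 2)"
      using cutoff_gauss_close[OF p(1), of "min e (sqrt c0 / 2)"] e(1) c0 by auto
    define u where "u x = cutoff m x * gauss p x" for x
    have uT: "u \<in> test_functions" unfolding u_def by (rule cutoff_gauss_test_function[OF m(1) p(1)])
    have uL: "u \<in> L2" by (rule test_function_L2[OF uT])
    have ud: "norm (abs_l2 u - abs_l2 (gauss p)) < min e (sqrt c0 / 2)" using m(2) by (simp only: u_def[abs_def])
    have mass: "c0 / 4 \<le> (LINT x|half_line. (cmod (u x))\<^sup>2)"
    proof -
      have "sqrt c0 / 2 \<le> norm (abs_l2 u)"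
        using norm_triangle_ineq2[of "abs_l2 (gauss p)" "abs_l2 u"] ud lower
        by (simp add: norm_minus_commute)
      then have "(sqrt c0 / 2)\<^sup>2 \<le> (norm (abs_l2 u))\<^sup>2" using c0 by (intro power_mono) auto
      then show ?thesis using c0 by (simp add: norm_abs_l2_square[OF uL] power_divide)
    qed
    have ext: "(LINT x:{0<..} - {0..b}|half_line. (cmod (bessel_solution \<nu> u x T))\<^sup>2) \<le> 4 * K2 * exp (- (b\<^sup>2 / 2) * y)"
    proof -
      let ?U = "schrodinger_group (H_bessel \<nu>) T u"
      let ?g = "gauss (of_real r)"
      have rr: "Re (of_real r) > 0" using r by simp
      have "abs_l2 ?U - abs_l2 ?g = X T (abs_l2 u - abs_l2 (gauss p))"
        using X(4)[OF p(1), of T] by (simp add: X(3) uL U_diff pT)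
      then have "norm (abs_l2 ?U - abs_l2 ?g) \<le> e" using ud by (simp add: norm_U)
      then have 1: "(norm (abs_l2 ?U - abs_l2 ?g))\<^sup>2 \<le> e\<^sup>2" by (intro power_mono) auto
      have "(LINT x:{0<..} - {0..b}|half_line. (cmod (?g x))\<^sup>2) \<le>
          (LINT x|half_line. y powr (2 * (\<nu> + 1)) * exp (- (b\<^sup>2 * y)) * (x powr a * exp (0 * x - 1 * x\<^sup>2)))"
        unfolding set_lebesgue_integral_def
      proof (rule integral_mono')
        show "integrable half_line (\<lambda>x. y powr (2 * (\<nu> + 1)) * exp (- (b\<^sup>2 * y)) * (x powr a * exp (0 * x - 1 * x\<^sup>2)))"
          using a by (intro Bochner_Integration.integrable_mult_right integrable_powr_exp_quadratic) auto
        fix x :: real assume "x \<in> space half_line"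
        then have x: "x > 0" by (simp add: space_restrict_space)
        show "indicator ({0<..} - {0..b}) x *\<^sub>R (cmod (?g x))\<^sup>2 \<le>
            y powr (2 * (\<nu> + 1)) * exp (- (b\<^sup>2 * y)) * (x powr a * exp (0 * x - 1 * x\<^sup>2))"
        proof (cases "x > b")
          case True
          have "cmod (?g x) = y powr (\<nu> + 1) * (x powr (\<nu> + 1/2) * exp (- y * x\<^sup>2))"
          proof -
            have "cmod (of_real r) = r" using r by simp
            moreover have "r powr - t = y powr t" for t
              using y by (simp add: r_def powr_divide powr_minus)
            moreover have "Re (of_real r) / r\<^sup>2 = y" using y by (simp add: r_def power2_eq_square)
            ultimately show ?thesis unfolding cmod_gauss[OF rr] by (simp only:)
          qed
          then have "(cmod (?g x))\<^sup>2 = y powr (2 * (\<nu> + 1)) * (x powr a * exp (2 * (- y * x\<^sup>2)))"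
            using x y by (simp only: power_mult_distrib power2_exp) (simp add: power2_powr a_def)
          also have "\<dots> \<le> y powr (2 * (\<nu> + 1)) * (x powr a * exp (- (b\<^sup>2 * y) - 1 * x\<^sup>2))"
          proof (intro mult_left_mono)
            have "b\<^sup>2 \<le> x\<^sup>2" using True b by (intro power_mono) auto
            \<comment> \<open>The exponent 2 y x^2 is split in two: one half gives b^2 y because x >
              b, the other gives x^2 because y is at least 1.\<close>
            then have "b\<^sup>2 * y + 1 * x\<^sup>2 \<le> x\<^sup>2 * y + y * x\<^sup>2"
              using y by (intro add_mono mult_right_mono) auto
            then show "exp (2 * (- y * x\<^sup>2)) \<le> exp (- (b\<^sup>2 * y) - 1 * x\<^sup>2)" by (simp add: algebra_simps)
          qed auto
          also have "\<dots> = y powr (2 * (\<nu> + 1)) * exp (- (b\<^sup>2 * y)) * (x powr a * exp (0 * x - 1 * x\<^sup>2))"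
            by (simp add: exp_diff exp_minus field_simps)
          finally show ?thesis using True b by simp
        qed (use b in simp)
      qed auto
      also have "\<dots> = y powr (2 * (\<nu> + 1)) * exp (- (b\<^sup>2 * y)) * K1" unfolding K1_def by simp
      also have "\<dots> \<le> (D1 * exp (b\<^sup>2 / 2 * y)) * exp (- (b\<^sup>2 * y)) * (K1 + 1)"
        unfolding D1_def using y b \<nu>_nonneg K1 by (intro mult_mono powr_le_exp_linear) auto
      also have "\<dots> = e\<^sup>2"
        unfolding e(2) K2_def by (simp add: field_simps flip: exp_add)
      finally have 2: "(LINT x:{0<..} - {0..b}|half_line. (cmod (?g x))\<^sup>2) \<le> e\<^sup>2" .
      have "{0<..} - {0..b} \<in> sets half_line" by (subst sets_restrict_space_iff) auto
      from set_integral_square_le[OF X(2)[OF uL] gauss_L2[OF rr] this, of T] 1 2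
      have "(LINT x:{0<..} - {0..b}|half_line. (cmod (?U x))\<^sup>2) \<le> 4 * e\<^sup>2" by linarith
      then show ?thesis by (simp add: bessel_solution_def e(2))
    qed
    have wt: "(LINT x|half_line. exp (lam * \<alpha> x) * (cmod (u x))\<^sup>2) \<le> K3 * exp (\<gamma> * b\<^sup>2 / 8 * y)"
    proof -
      let ?c = "(4 * T) powr - (2 * (\<nu> + 1)) * exp (lam * c) * D * exp (\<gamma> * b\<^sup>2 / 8 * y)"
      have "(LINT x|half_line. exp (lam * \<alpha> x) * (cmod (u x))\<^sup>2) \<le> (LINT x|half_line. ?c * exp (- (d * x)))"
      proof (rule integral_mono')
        show "integrable half_line (\<lambda>x. ?c * exp (- (d * x)))"
          by (intro Bochner_Integration.integrable_mult_right integrable_exp_minus_half_line d)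
        fix x :: real assume "x \<in> space half_line"
        then have x: "x > 0" by (simp add: space_restrict_space)
        have "cmod (u x) \<le> cmod (gauss p x)" unfolding u_def by (rule cmod_cutoff_gauss_le)
        also have "\<dots> \<le> (4 * T) powr - (\<nu> + 1) * (x powr (\<nu> + 1/2) * exp (- (\<kappa> * r) * x\<^sup>2))"
          unfolding cmod_gauss[OF p(1)] p(2) using p2 T \<nu>_nonneg mult_right_mono[OF s2, of "x\<^sup>2"]
          by (intro mult_mono[OF powr_mono2'] mult_left_mono) auto
        finally have "(cmod (u x))\<^sup>2 \<le> ((4 * T) powr - (\<nu> + 1) * (x powr (\<nu> + 1/2) * exp (- (\<kappa> * r) * x\<^sup>2)))\<^sup>2"
          by (intro power_mono) auto
        also have "\<dots> = (4 * T) powr - (2 * (\<nu> + 1)) * (x powr a * exp (2 * (- (\<kappa> * r) * x\<^sup>2)))"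
          using x T by (simp only: power_mult_distrib power2_exp) (simp add: power2_powr a_def algebra_simps)
        finally have u2: "(cmod (u x))\<^sup>2 \<le> (4 * T) powr - (2 * (\<nu> + 1)) * (x powr a * exp (2 * (- (\<kappa> * r) * x\<^sup>2)))" .
        have "lam * \<alpha> x \<le> lam * (d / lam * x + c)" using c[OF x] lam by (intro mult_left_mono) auto
        then have al: "exp (lam * \<alpha> x) \<le> exp (lam * c) * exp (d * x)"
          using lam by (simp add: algebra_simps flip: exp_add)
        have xa: "x powr a \<le> D * exp (d * x)" unfolding D_def by (rule powr_le_exp_linear[OF x a d])
        \<comment> \<open>The square completed for 2 \<kappa> r x^2 - 3 d x; with r = 1/y its
          constant term is proportional to y.\<close>
        have "0 \<le> (sqrt (2 * \<kappa> * r) * x - 3 * d / (2 * sqrt (2 * \<kappa> * r)))\<^sup>2" by simp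
        also have "\<dots> = 2 * \<kappa> * r * x\<^sup>2 - 3 * d * x + 9 * d\<^sup>2 / (8 * \<kappa>) * y"
          using r \<kappa> y by (simp add: power2_diff power_mult_distrib power_divide r_def field_simps)
            (simp add: power2_eq_square)
        finally have sq: "d * x + d * x + 2 * (- (\<kappa> * r) * x\<^sup>2) \<le> \<gamma> * b\<^sup>2 / 8 * y + - (d * x)"
          unfolding d2 by (simp add: algebra_simps)
        have "exp (lam * \<alpha> x) * (cmod (u x))\<^sup>2 \<le>
            (exp (lam * c) * exp (d * x)) * ((4 * T) powr - (2 * (\<nu> + 1)) * ((D * exp (d * x)) * exp (2 * (- (\<kappa> * r) * x\<^sup>2))))"
          using xa by (intro mult_mono al order_trans[OF u2] mult_left_mono mult_right_mono) (auto simp: D_def)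
        also have "\<dots> = (4 * T) powr - (2 * (\<nu> + 1)) * exp (lam * c) * D * exp (d * x + d * x + 2 * (- (\<kappa> * r) * x\<^sup>2))"
          by (simp only: exp_add) (simp only: mult_ac)
        also have "\<dots> \<le> (4 * T) powr - (2 * (\<nu> + 1)) * exp (lam * c) * D * exp (\<gamma> * b\<^sup>2 / 8 * y + - (d * x))"
          using sq by (intro mult_left_mono) (auto simp: D_def)
        also have "\<dots> = ?c * exp (- (d * x))" by (simp only: exp_add mult_ac)
        finally show "exp (lam * \<alpha> x) * (cmod (u x))\<^sup>2 \<le> ?c * exp (- (d * x))" .
      qed (auto simp: D_def)
      also have "\<dots> = K3 * exp (\<gamma> * b\<^sup>2 / 8 * y)" by (simp add: K3_def I_def)
      finally show ?thesis .
    qed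
    have "c0 / 4 \<le> C * (LINT x:{0<..} - {0..b}|half_line. (cmod (bessel_solution \<nu> u x T))\<^sup>2) powr \<gamma>
                  * (LINT x|half_line. exp (lam * \<alpha> x) * (cmod (u x))\<^sup>2) powr (1 - \<gamma>)"
      using mass ineq[OF uT] by linarith
    also have "\<dots> \<le> C * (4 * K2 * exp (- (b\<^sup>2 / 2) * y)) powr \<gamma> * (K3 * exp (\<gamma> * b\<^sup>2 / 8 * y)) powr (1 - \<gamma>)"
      using C \<gamma> ext wt
      by (intro mult_mono powr_mono2 mult_nonneg_nonneg) (auto simp: set_lebesgue_integral_def intro!: integral_nonneg_AE)
    also have "\<dots> = K * (exp (\<gamma> * (- (b\<^sup>2 / 2) * y)) * exp ((1 - \<gamma>) * (\<gamma> * b\<^sup>2 / 8 * y)))"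
    proof -
      have pe: "exp z powr t = exp (t * z)" for z t :: real by (simp add: powr_def)
      have e1: "(4 * K2 * exp z) powr \<gamma> = (4 * K2) powr \<gamma> * exp (\<gamma> * z)" for z
        using K2 powr_mult[of "4 * K2" "exp z" \<gamma>] by (simp add: pe)
      have e2: "(K3 * exp z) powr (1 - \<gamma>) = K3 powr (1 - \<gamma>) * exp ((1 - \<gamma>) * z)" for z
        using K3 powr_mult[of K3 "exp z" "1 - \<gamma>"] by (simp add: pe)
      show ?thesis unfolding K_def e1 e2 by (simp only: mult_ac)
    qed
    also have "\<dots> \<le> K * exp (- \<theta> * y)"
    proof (rule mult_left_mono)
      \<comment> \<open>The exponents add up to - \<theta> y minus this nonnegative quantity, which
        is discarded.\<close>
      have "\<gamma> * (\<gamma> * b\<^sup>2 / 8 * y) \<ge> 0" using \<gamma> y by simp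
      then have "\<gamma> * (- (b\<^sup>2 / 2) * y) + (1 - \<gamma>) * (\<gamma> * b\<^sup>2 / 8 * y) \<le> - \<theta> * y"
        by (simp add: \<theta>_def algebra_simps)
      then show "exp (\<gamma> * (- (b\<^sup>2 / 2) * y)) * exp ((1 - \<gamma>) * (\<gamma> * b\<^sup>2 / 8 * y)) \<le> exp (- \<theta> * y)"
        by (simp flip: exp_add)
      show "0 \<le> K" using C by (simp add: K_def)
    qed
    finally show ?thesis .
  qed
  have "filterlim (\<lambda>y. - \<theta> * y) at_bot at_top"
    using \<theta> by (intro filterlim_tendsto_neg_mult_at_bot[OF tendsto_const _ filterlim_ident]) auto
  then have "((\<lambda>y. K * exp (- \<theta> * y)) \<longlongrightarrow> K * 0) at_top"
    by (intro tendsto_mult tendsto_const filterlim_compose[OF exp_at_bot])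
  moreover have "\<forall>\<^sub>F y in at_top. c0 / 4 \<le> K * exp (- \<theta> * y)"
    using main by (auto simp: eventually_at_top_linorder intro!: exI[of _ 1])
  ultimately have "c0 / 4 \<le> K * 0" by (intro tendsto_lowerbound[of _ _ at_top]) auto
  then show False using c0 by simp
qed

end

theorem theorem5p3:
  fixes \<nu> :: real
  assumes "\<nu> \<ge> 0"
  shows
    "(\<forall>(a1::real) (a2::real) (lam::real) (T::real).
        0 < a1 \<and> a1 < a2 \<and> lam > 0 \<and> T > 0 \<longrightarrow>
        (\<exists>(u :: nat \<Rightarrow> real \<Rightarrow> complex) (M::real). M > 0 \<and>
           (\<forall>k\<ge>1. u k \<in> test_functions \<and>
              (LINT x|half_line. exp (lam * x) * (cmod (u k x))\<^sup>2) \<le> M \<and>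
              (LINT x|half_line. (cmod (u k x))\<^sup>2) = 1) \<and>
           (\<lambda>k. LINT x:{a1..a2}|half_line. (cmod (bessel_solution \<nu> (u k) x T))\<^sup>2)
             \<longlonglongrightarrow> 0))
     \<and>
     (\<forall>(lam::real) (b::real) (T::real) (\<alpha> :: real \<Rightarrow> real).
        lam > 0 \<and> b > 0 \<and> T > 0 \<and> mono_on {0<..} \<alpha> \<and> ((\<lambda>s. \<alpha> s / s) \<longlongrightarrow> 0) at_top \<longrightarrow>
        (\<forall>\<gamma>\<in>{0<..<1}.
           \<not> (\<exists>C>0. \<forall>u0\<in>test_functions.
                (LINT x|half_line. (cmod (u0 x))\<^sup>2) \<le>
                C * (LINT x:{0<..} - {0..b}|half_line. (cmod (bessel_solution \<nu> u0 x T))\<^sup>2) powr \<gamma>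
                  * (LINT x|half_line. exp (lam * \<alpha> x) * (cmod (u0 x))\<^sup>2) powr (1 - \<gamma>))))"
proof -
  interpret bessel \<nu> by standard fact
  show ?thesis
  proof (intro conjI allI impI ballI notI)
    fix a1 a2 lam T :: real assume "0 < a1 \<and> a1 < a2 \<and> lam > 0 \<and> T > 0"
    then show "\<exists>(u :: nat \<Rightarrow> real \<Rightarrow> complex) (M::real). M > 0 \<and>
           (\<forall>k\<ge>1. u k \<in> test_functions \<and>
              (LINT x|half_line. exp (lam * x) * (cmod (u k x))\<^sup>2) \<le> M \<and>
              (LINT x|half_line. (cmod (u k x))\<^sup>2) = 1) \<and>
           (\<lambda>k. LINT x:{a1..a2}|half_line. (cmod (bessel_solution \<nu> (u k) x T))\<^sup>2)
             \<longlonglongrightarrow> 0"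
      using dispersing_gaussians by blast
  next
    fix lam b T :: real and \<alpha> :: "real \<Rightarrow> real" and \<gamma> :: real
    assume "lam > 0 \<and> b > 0 \<and> T > 0 \<and> mono_on {0<..} \<alpha> \<and> ((\<lambda>s. \<alpha> s / s) \<longlongrightarrow> 0) at_top"
      and "\<gamma> \<in> {0<..<1}"
      and "\<exists>C>0. \<forall>u0\<in>test_functions.
                (LINT x|half_line. (cmod (u0 x))\<^sup>2) \<le>
                C * (LINT x:{0<..} - {0..b}|half_line. (cmod (bessel_solution \<nu> u0 x T))\<^sup>2) powr \<gamma>
                  * (LINT x|half_line. exp (lam * \<alpha> x) * (cmod (u0 x))\<^sup>2) powr (1 - \<gamma>)"
    then show False using focusing_gaussians[of lam b T \<alpha> \<gamma>] by auto
  qed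
qed

end
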